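(* Let $\omega$ be a non-principal ultrafilter on $\mathbb{N}$ and $(d_n)$ an unbounded non-decreasing sequence of positive reals. (1) Let $G$ be an infinite hyperbolic group. Then $G$ is non-elementary if and only if $\ker\left(G \curvearrowright \mathrm{Cone}_{\omega}(G,d_n)\right)$ is finite. (2) Suppose that a finitely generated group $G$ acts acylindrically on some $\delta$-hyperbolic space $X$ and contains a loxodromic element. Then the action of $G$ on $X$ is non-elementary (so $G$ is acylindrically hyperbolic) if and only if $\ker\left(G \curvearrowright \mathrm{Cone}_{\omega}(G,d_n)\right)$ is finite.
   Context: Asymptotic cones. Let $G$ be a finitely generated group with finite generating set $S$ and word length $\|\cdot\|_S$. $\mathrm{Cone}_\omega(G,d_n)$ is the ultralimit of $(\Gamma(G,S), \frac{1}{d_n}d_S, e)$; its points are represented by sequences $\{x_n\}$ in $G$ with $\|x_n\|_S/d_n$ bounded (admissible sequences), where $\{x_n\}=\{y_n\}$ iff $\lim_\omega \|x_n^{-1}y_n\|_S/d_n=0$. $G$ acts isometrically by $g\cdot\{x_n\}=\{gx_n\}$. The kernel is the set of $g \in G$ with $\lim_\omega \|x_n^{-1}gx_n\|_S/d_n=0$ for all admissible $\{x_n\}$. A hyperbolic group is elementary if it is finite or contains a finite-index subgroup isomorphic to $\mathbb{Z}$; otherwise non-elementary. A $\delta$-hyperbolic space is a geodesic metric space with uniformly thin geodesic triangles. An isometric action of $G$ on a metric space $X$ is acylindrical if for every $\epsilon>0$ there are $R,N>0$ such that $|\{g\in G: d(x,gx)\le\epsilon, d(y,gy)\le\epsilon\}|\le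 N$ whenever $d(x,y)\ge R$. An action on a $\delta$-hyperbolic space $X$ is non-elementary if the limit set of $G$ in the Gromov boundary $\partial X$ has more than 2 points. An element $g$ is loxodromic if $n\mapsto g^n\cdot x$ is a quasi-isometric embedding $\mathbb{Z}\to X$ for some (any) $x\in X$. $G$ is acylindrically hyperbolic if it admits a non-elementary acylindrical isometric action on some $\delta$-hyperbolic space. *)

theory Defs
  imports "HOL-Analysis.Abstract_Metric_Spaces" "HOL-Algebra.Elementary_Groups"
    "HOL-Algebra.Generated_Groups" "HOL-Algebra.Group_Action"
begin

section \<open>Word metrics\<close>

definition finite_generating_set :: "('a, 'm) monoid_scheme \<Rightarrow> 'a set \<Rightarrow> bool" where
  "finite_generating_set G S \<longleftrightarrow> finite S \<and> S \<subseteq> carrier G \<and> generate G S = carrier G"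

definition words :: "('a, 'm) monoid_scheme \<Rightarrow> 'a set \<Rightarrow> 'a list set" where
  "words G S = lists (S \<union> m_inv G ` S)"

definition word_eval :: "('a, 'm) monoid_scheme \<Rightarrow> 'a list \<Rightarrow> 'a" where
  "word_eval G ws = foldr (mult G) ws \<one>\<^bsub>G\<^esub>"

definition word_length :: "('a, 'm) monoid_scheme \<Rightarrow> 'a set \<Rightarrow> 'a \<Rightarrow> nat" where
  "word_length G S g = (LEAST n. \<exists>ws \<in> words G S. length ws = n \<and> word_eval G ws = g)"

definition word_dist :: "('a, 'm) monoid_scheme \<Rightarrow> 'a set \<Rightarrow> 'a \<Rightarrow> 'a \<Rightarrow> nat" where
  "word_dist G S x y = word_length G S (inv\<^bsub>G\<^esub> x \<otimes>\<^bsub>G\<^esub> y)"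

context group
begin

lemma word_eval_simps [simp]:
  "word_eval G [] = \<one>" "word_eval G (w # ws) = w \<otimes> word_eval G ws"
  by (simp_all add: word_eval_def)

lemma words_carrier: "S \<subseteq> carrier G \<Longrightarrow> ws \<in> words G S \<Longrightarrow> set ws \<subseteq> carrier G"
  by (force simp: words_def)

lemma word_eval_closed: "set ws \<subseteq> carrier G \<Longrightarrow> word_eval G ws \<in> carrier G"
  by (induction ws) auto

lemma word_eval_append:
  "set us \<subseteq> carrier G \<Longrightarrow> set vs \<subseteq> carrier G \<Longrightarrow>
    word_eval G (us @ vs) = word_eval G us \<otimes> word_eval G vs"
  by (induction us) (auto simp: m_assoc word_eval_closed)

lemma word_eval_inverse:
  "set ws \<subseteq> carrier G \<Longrightarrow> word_eval G (rev (map (m_inv G) ws)) = inv (word_eval G ws)"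
proof (induction ws)
  case (Cons w ws)
  have "set (rev (map (m_inv G) ws)) \<subseteq> carrier G" using Cons.prems by auto
  then show ?case
    using Cons by (simp add: word_eval_append word_eval_closed inv_mult_group)
qed simp

lemma words_inverse:
  assumes "S \<subseteq> carrier G" "ws \<in> words G S"
  shows "rev (map (m_inv G) ws) \<in> words G S"
proof -
  have "inv w \<in> S \<union> m_inv G ` S" if "w \<in> S \<union> m_inv G ` S" for w
    using that
  proof
    assume "w \<in> m_inv G ` S"
    then obtain v where "v \<in> S" "w = inv v" by blast
    then have "inv w = v" using assms(1) by auto
    then show ?thesis using \<open>v \<in> S\<close> by simp
  qed simp
  then have "\<forall>w \<in> set ws. inv w \<in> S \<union> m_inv G ` S"
    using assms(2) unfolding words_def in_lists_conv_set by blast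
  then show ?thesis by (simp add: words_def in_lists_conv_set)
qed

lemma word_exists:
  assumes S: "S \<subseteq> carrier G" and g: "g \<in> generate G S"
  shows "\<exists>ws \<in> words G S. word_eval G ws = g"
  using g
proof (induction g rule: generate.induct)
  case one
  show ?case by (rule bexI[of _ "[]"]) (auto simp: words_def)
next
  case (incl h)
  with S show ?case by (intro bexI[of _ "[h]"]) (auto simp: words_def)
next
  case (inv h)
  with S show ?case by (intro bexI[of _ "[inv h]"]) (auto simp: words_def)
next
  case (eng h1 h2)
  then obtain us vs where "us \<in> words G S" "vs \<in> words G S"
    "word_eval G us = h1" "word_eval G vs = h2" by auto
  with words_carrier[OF S] show ?case
    by (intro bexI[of _ "us @ vs"]) (auto simp: word_eval_append words_def)
qed

lemma word_length_le: "ws \<in> words G S \<Longrightarrow> word_length G S (word_eval G ws) \<le> length ws"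
  unfolding word_length_def by (rule Least_le) auto

lemma word_length_witness:
  assumes "finite_generating_set G S" "g \<in> carrier G"
  obtains ws where "ws \<in> words G S" "length ws = word_length G S g" "word_eval G ws = g"
proof -
  have "S \<subseteq> carrier G" "g \<in> generate G S"
    using assms unfolding finite_generating_set_def by blast+
  then obtain vs where vs: "vs \<in> words G S" "word_eval G vs = g"
    using word_exists by blast
  let ?P = "\<lambda>n. \<exists>ws \<in> words G S. length ws = n \<and> word_eval G ws = g"
  have "?P (length vs)" using vs by blast
  then have "?P (LEAST n. ?P n)" by (rule LeastI)
  then have "?P (word_length G S g)" by (simp only: word_length_def)
  then show thesis using that by blast
qed

lemma word_length_eq_0:
  assumes "finite_generating_set G S" "g \<in> carrier G"
  shows "word_length G S g = 0 \<longleftrightarrow> g = \<one>"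
proof
  assume "word_length G S g = 0"
  then show "g = \<one>" using word_length_witness[OF assms] by auto
next
  assume "g = \<one>"
  then show "word_length G S g = 0" using word_length_le[of "[]" S] by (simp add: words_def)
qed

lemma word_length_inv_le:
  assumes S: "finite_generating_set G S" and g: "g \<in> carrier G"
  shows "word_length G S (inv g) \<le> word_length G S g"
proof -
  have SG: "S \<subseteq> carrier G" using S by (simp add: finite_generating_set_def)
  obtain ws where ws: "ws \<in> words G S" "length ws = word_length G S g" "word_eval G ws = g"
    using word_length_witness[OF S g] .
  show ?thesis
    using word_length_le[OF words_inverse[OF SG ws(1)]] ws
      word_eval_inverse[OF words_carrier[OF SG ws(1)]] by simp
qed

lemma word_length_inv:
  assumes "finite_generating_set G S" "g \<in> carrier G"
  shows "word_length G S (inv g) = word_length G S g"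
  using word_length_inv_le[OF assms] word_length_inv_le[of S "inv g"] assms by simp

lemma word_length_mult:
  assumes S: "finite_generating_set G S" and g: "g \<in> carrier G" and h: "h \<in> carrier G"
  shows "word_length G S (g \<otimes> h) \<le> word_length G S g + word_length G S h"
proof -
  have SG: "S \<subseteq> carrier G" using S by (simp add: finite_generating_set_def)
  obtain us where us: "us \<in> words G S" "length us = word_length G S g" "word_eval G us = g"
    using word_length_witness[OF S g] .
  obtain vs where vs: "vs \<in> words G S" "length vs = word_length G S h" "word_eval G vs = h"
    using word_length_witness[OF S h] .
  have "us @ vs \<in> words G S" using us vs by (auto simp: words_def)
  from word_length_le[OF this] show ?thesis
    using us vs words_carrier[OF SG] by (simp add: word_eval_append)
qed

lemma mult_inv_cancel: "y \<in> carrier G \<Longrightarrow> z \<in> carrier G \<Longrightarrow> y \<otimes> (inv y \<otimes> z) = z"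
  by (simp add: m_assoc[symmetric])

lemma inv_mult_cancel: "y \<in> carrier G \<Longrightarrow> z \<in> carrier G \<Longrightarrow> inv y \<otimes> (y \<otimes> z) = z"
  by (simp add: m_assoc[symmetric])

lemma word_dist_commute:
  assumes "finite_generating_set G S" "x \<in> carrier G" "y \<in> carrier G"
  shows "word_dist G S x y = word_dist G S y x"
  using word_length_inv[OF assms(1), of "inv x \<otimes> y"] assms
  by (simp add: word_dist_def inv_mult_group)

lemma word_dist_eq_0:
  assumes "finite_generating_set G S" "x \<in> carrier G" "y \<in> carrier G"
  shows "word_dist G S x y = 0 \<longleftrightarrow> x = y"
proof -
  have "x = y" if "inv x \<otimes> y = \<one>"
  proof -
    have "y = x \<otimes> (inv x \<otimes> y)" by (simp only: mult_inv_cancel assms)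
    also have "\<dots> = x" by (simp only: that r_one assms)
    finally show ?thesis by (rule sym)
  qed
  moreover have "inv x \<otimes> y = \<one>" if "x = y"
    using assms(3) that by (simp only: l_inv)
  ultimately have "inv x \<otimes> y = \<one> \<longleftrightarrow> x = y" by (rule iffI)
  moreover have "word_length G S (inv x \<otimes> y) = 0 \<longleftrightarrow> inv x \<otimes> y = \<one>"
    by (intro word_length_eq_0 m_closed inv_closed assms)
  ultimately show ?thesis by (simp only: word_dist_def)
qed

lemma word_dist_self:
  assumes "finite_generating_set G S" "x \<in> carrier G"
  shows "word_dist G S x x = 0"
  using word_dist_eq_0[OF assms(1,2,2)] by simp

lemma word_dist_triangle:
  assumes "finite_generating_set G S" "x \<in> carrier G" "y \<in> carrier G" "z \<in> carrier G"
  shows "word_dist G S x z \<le> word_dist G S x y + word_dist G S y z"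
proof -
  have "inv x \<otimes> z = (inv x \<otimes> y) \<otimes> (inv y \<otimes> z)"
    by (simp only: m_assoc mult_inv_cancel inv_closed m_closed assms)
  moreover have "word_length G S ((inv x \<otimes> y) \<otimes> (inv y \<otimes> z))
      \<le> word_length G S (inv x \<otimes> y) + word_length G S (inv y \<otimes> z)"
    by (intro word_length_mult m_closed inv_closed assms)
  ultimately show ?thesis by (simp only: word_dist_def)
qed

lemma word_dist_left:
  assumes "g \<in> carrier G" "x \<in> carrier G" "y \<in> carrier G"
  shows "word_dist G S (g \<otimes> x) (g \<otimes> y) = word_dist G S x y"
proof -
  have "inv (g \<otimes> x) \<otimes> (g \<otimes> y) = inv x \<otimes> y"
    by (simp only: inv_mult_group m_assoc inv_mult_cancel inv_closed m_closed assms)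
  then show ?thesis by (simp only: word_dist_def)
qed

end


section \<open>Asymptotic cones\<close>

text \<open>An ultrafilter is represented by a filter in the sense of the library; the limit along
  \<open>\<omega>\<close> is then the usual \<open>(f \<longlongrightarrow> l) \<omega>\<close>.\<close>

definition nonprincipal_ultrafilter :: "'i filter \<Rightarrow> bool" where
  "nonprincipal_ultrafilter \<omega> \<longleftrightarrow>
     \<omega> \<noteq> bot \<and> (\<forall>P. eventually P \<omega> \<or> eventually (\<lambda>i. \<not> P i) \<omega>) \<and> (\<forall>i. \<omega> \<noteq> principal {i})"

definition admissible :: "('a, 'm) monoid_scheme \<Rightarrow> 'a set \<Rightarrow> (nat \<Rightarrow> real) \<Rightarrow> (nat \<Rightarrow> 'a) set" where
  "admissible G S s =
     {x. (\<forall>n. x n \<in> carrier G) \<and> (\<exists>C. \<forall>n. real (word_length G S (x n)) / s n \<le> C)}"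

definition cone_rel ::
  "nat filter \<Rightarrow> ('a, 'm) monoid_scheme \<Rightarrow> 'a set \<Rightarrow> (nat \<Rightarrow> real) \<Rightarrow> ((nat \<Rightarrow> 'a) \<times> (nat \<Rightarrow> 'a)) set" where
  "cone_rel \<omega> G S s =
     {(x, y). x \<in> admissible G S s \<and> y \<in> admissible G S s \<and>
        ((\<lambda>n. real (word_length G S (inv\<^bsub>G\<^esub> (x n) \<otimes>\<^bsub>G\<^esub> y n)) / s n) \<longlongrightarrow> 0) \<omega>}"

definition asymptotic_cone ::
  "nat filter \<Rightarrow> ('a, 'm) monoid_scheme \<Rightarrow> 'a set \<Rightarrow> (nat \<Rightarrow> real) \<Rightarrow> (nat \<Rightarrow> 'a) set set" where
  "asymptotic_cone \<omega> G S s = admissible G S s // cone_rel \<omega> G S s"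

text \<open>\<open>g\<close> sends the class of \<open>x\<close> to the class of \<open>\<lambda>n. g \<otimes> x n\<close>.\<close>

definition cone_action ::
  "nat filter \<Rightarrow> ('a, 'm) monoid_scheme \<Rightarrow> 'a set \<Rightarrow> (nat \<Rightarrow> real) \<Rightarrow>
     'a \<Rightarrow> (nat \<Rightarrow> 'a) set \<Rightarrow> (nat \<Rightarrow> 'a) set" where
  "cone_action \<omega> G S s g =
     (\<lambda>p \<in> asymptotic_cone \<omega> G S s. cone_rel \<omega> G S s `` ((\<lambda>x n. g \<otimes>\<^bsub>G\<^esub> x n) ` p))"

definition cone_kernel ::
  "nat filter \<Rightarrow> ('a, 'm) monoid_scheme \<Rightarrow> 'a set \<Rightarrow> (nat \<Rightarrow> real) \<Rightarrow> 'a set" where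
  "cone_kernel \<omega> G S s =
     kernel G (BijGroup (asymptotic_cone \<omega> G S s)) (cone_action \<omega> G S s)"

context group
begin

context
  fixes \<omega> :: "nat filter" and S :: "'a set" and s :: "nat \<Rightarrow> real"
  assumes S: "finite_generating_set G S"
    and spos: "\<And>n. 0 < s n" and smono: "mono s"
begin

lemma admissible_carrier: "x \<in> admissible G S s \<Longrightarrow> x n \<in> carrier G"
  by (simp add: admissible_def)

lemma cone_rel_iff:
  "(x, y) \<in> cone_rel \<omega> G S s \<longleftrightarrow> x \<in> admissible G S s \<and> y \<in> admissible G S s \<and>
     ((\<lambda>n. real (word_dist G S (x n) (y n)) / s n) \<longlongrightarrow> 0) \<omega>"
  by (simp add: cone_rel_def word_dist_def)

lemma equiv_cone_rel: "equiv (admissible G S s) (cone_rel \<omega> G S s)"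
proof (rule equivI)
  show "cone_rel \<omega> G S s \<subseteq> admissible G S s \<times> admissible G S s"
    by (auto simp: cone_rel_iff)
  show "refl_on (admissible G S s) (cone_rel \<omega> G S s)"
    by (auto simp: refl_on_def cone_rel_iff admissible_carrier word_dist_self[OF S])
  show "sym (cone_rel \<omega> G S s)"
    by (auto simp: sym_def cone_rel_iff admissible_carrier word_dist_commute[OF S])
  show "trans (cone_rel \<omega> G S s)"
  proof (rule transI)
    fix x y z assume xy: "(x, y) \<in> cone_rel \<omega> G S s" and yz: "(y, z) \<in> cone_rel \<omega> G S s"
    have lim: "((\<lambda>n. real (word_dist G S (x n) (y n)) / s n + real (word_dist G S (y n) (z n)) / s n)
        \<longlongrightarrow> 0 + 0) \<omega>"
      using xy yz by (intro tendsto_add) (auto simp: cone_rel_iff)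
    have le: "real (word_dist G S (x n) (z n)) / s n
        \<le> real (word_dist G S (x n) (y n)) / s n + real (word_dist G S (y n) (z n)) / s n" for n
    proof -
      have "word_dist G S (x n) (z n) \<le> word_dist G S (x n) (y n) + word_dist G S (y n) (z n)"
        using xy yz by (intro word_dist_triangle[OF S]) (auto simp: cone_rel_iff admissible_carrier)
      then show ?thesis
        using spos[of n] by (simp add: add_divide_distrib[symmetric] divide_right_mono)
    qed
    have nn: "0 \<le> real (word_dist G S (x n) (z n)) / s n" for n
      using spos[of n] by (intro divide_nonneg_pos) auto
    have "((\<lambda>n. real (word_dist G S (x n) (z n)) / s n) \<longlongrightarrow> 0) \<omega>"
    proof (rule tendsto_sandwich[OF _ _ tendsto_const])
      show "\<forall>\<^sub>F n in \<omega>. 0 \<le> real (word_dist G S (x n) (z n)) / s n"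
        by (rule always_eventually[OF allI[OF nn]])
      show "\<forall>\<^sub>F n in \<omega>. real (word_dist G S (x n) (z n)) / s n
          \<le> real (word_dist G S (x n) (y n)) / s n + real (word_dist G S (y n) (z n)) / s n"
        by (rule always_eventually[OF allI[OF le]])
      show "((\<lambda>n. real (word_dist G S (x n) (y n)) / s n + real (word_dist G S (y n) (z n)) / s n)
          \<longlongrightarrow> 0) \<omega>"
        using lim by simp
    qed
    then show "(x, z) \<in> cone_rel \<omega> G S s"
      using xy yz by (simp add: cone_rel_iff)
  qed
qed

lemma translate_admissible:
  assumes g: "g \<in> carrier G" and x: "x \<in> admissible G S s"
  shows "(\<lambda>n. g \<otimes> x n) \<in> admissible G S s"
proof -
  obtain C where C: "\<And>n. real (word_length G S (x n)) / s n \<le> C"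
    using x by (auto simp: admissible_def)
  have "real (word_length G S (g \<otimes> x n)) / s n \<le> real (word_length G S g) / s 0 + C" for n
  proof -
    have "word_length G S (g \<otimes> x n) \<le> word_length G S g + word_length G S (x n)"
      using g x by (intro word_length_mult[OF S]) (auto simp: admissible_carrier)
    then have "real (word_length G S (g \<otimes> x n)) / s n
        \<le> real (word_length G S g) / s n + real (word_length G S (x n)) / s n"
      using spos[of n] by (simp add: add_divide_distrib[symmetric] divide_right_mono)
    also have "real (word_length G S g) / s n \<le> real (word_length G S g) / s 0"
      using spos[of 0] monoD[OF smono, of 0 n] by (intro divide_left_mono) auto
    finally show ?thesis using C[of n] by simp
  qed
  then show ?thesis using g x by (auto simp: admissible_def)
qed

lemma translate_cone_rel:
  assumes "g \<in> carrier G" "(x, y) \<in> cone_rel \<omega> G S s"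
  shows "(\<lambda>n. g \<otimes> x n, \<lambda>n. g \<otimes> y n) \<in> cone_rel \<omega> G S s"
  using assms by (auto simp: cone_rel_iff translate_admissible word_dist_left admissible_carrier)

lemma cone_action_class:
  assumes g: "g \<in> carrier G" and x: "x \<in> admissible G S s"
  shows "cone_action \<omega> G S s g (cone_rel \<omega> G S s `` {x}) = cone_rel \<omega> G S s `` {\<lambda>n. g \<otimes> x n}"
proof -
  note eq = equiv_cone_rel
  have "cone_rel \<omega> G S s `` {x} \<in> asymptotic_cone \<omega> G S s"
    using x by (auto simp: asymptotic_cone_def intro: quotientI)
  then have 1: "cone_action \<omega> G S s g (cone_rel \<omega> G S s `` {x}) =
      cone_rel \<omega> G S s `` ((\<lambda>x n. g \<otimes> x n) ` (cone_rel \<omega> G S s `` {x}))"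
    by (simp add: cone_action_def)
  have "(x, x) \<in> cone_rel \<omega> G S s" using eq x by (meson equiv_class_self Image_singleton_iff)
  then have "cone_rel \<omega> G S s `` {\<lambda>n. g \<otimes> x n}
      \<subseteq> cone_rel \<omega> G S s `` ((\<lambda>x n. g \<otimes> x n) ` (cone_rel \<omega> G S s `` {x}))"
    by (intro Image_mono) auto
  moreover have "(\<lambda>n. g \<otimes> x n, z) \<in> cone_rel \<omega> G S s"
    if "(x, y) \<in> cone_rel \<omega> G S s" "(\<lambda>n. g \<otimes> y n, z) \<in> cone_rel \<omega> G S s" for y z
    using translate_cone_rel[OF g that(1)] that(2) eq by (meson equivE transE)
  ultimately show ?thesis unfolding 1 by blast
qed

lemma asymptotic_cone_cases:
  assumes "p \<in> asymptotic_cone \<omega> G S s"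
  obtains x where "x \<in> admissible G S s" "p = cone_rel \<omega> G S s `` {x}"
  using assms by (auto simp: asymptotic_cone_def elim: quotientE)

lemma asymptotic_cone_classI:
  "x \<in> admissible G S s \<Longrightarrow> cone_rel \<omega> G S s `` {x} \<in> asymptotic_cone \<omega> G S s"
  by (auto simp: asymptotic_cone_def intro: quotientI)

lemma cone_action_closed:
  assumes "g \<in> carrier G" "p \<in> asymptotic_cone \<omega> G S s"
  shows "cone_action \<omega> G S s g p \<in> asymptotic_cone \<omega> G S s"
  using assms(2)
  by (rule asymptotic_cone_cases)
     (simp add: cone_action_class assms(1) asymptotic_cone_classI translate_admissible)

lemma cone_action_mult:
  assumes "g \<in> carrier G" "h \<in> carrier G" "p \<in> asymptotic_cone \<omega> G S s"
  shows "cone_action \<omega> G S s (g \<otimes> h) p = cone_action \<omega> G S s g (cone_action \<omega> G S s h p)"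
  using assms(3)
  by (rule asymptotic_cone_cases)
     (simp add: cone_action_class assms(1,2) translate_admissible m_assoc admissible_carrier)

lemma cone_action_one:
  assumes "p \<in> asymptotic_cone \<omega> G S s"
  shows "cone_action \<omega> G S s \<one> p = p"
  using assms
  by (rule asymptotic_cone_cases) (simp add: cone_action_class admissible_carrier)

lemma group_action_cone: "group_action G (asymptotic_cone \<omega> G S s) (cone_action \<omega> G S s)"
proof -
  let ?E = "asymptotic_cone \<omega> G S s" and ?\<phi> = "cone_action \<omega> G S s"
  have Bij: "?\<phi> g \<in> Bij ?E" if g: "g \<in> carrier G" for g
  proof -
    have "bij_betw (?\<phi> g) ?E ?E"
      by (rule bij_betw_byWitness[where f' = "?\<phi> (inv g)"])
         (auto simp: g cone_action_closed cone_action_one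
           simp flip: cone_action_mult[OF g inv_closed[OF g]] cone_action_mult[OF inv_closed[OF g] g])
    then show ?thesis by (simp add: Bij_def cone_action_def)
  qed
  have "?\<phi> (g \<otimes> h) = compose ?E (?\<phi> g) (?\<phi> h)" if "g \<in> carrier G" "h \<in> carrier G" for g h
  proof (rule extensionalityI[where A = ?E])
    show "?\<phi> (g \<otimes> h) \<in> extensional ?E" by (simp add: cone_action_def)
    show "compose ?E (?\<phi> g) (?\<phi> h) \<in> extensional ?E" by simp
    show "?\<phi> (g \<otimes> h) p = compose ?E (?\<phi> g) (?\<phi> h) p" if "p \<in> ?E" for p
      using that \<open>g \<in> carrier G\<close> \<open>h \<in> carrier G\<close> by (simp add: compose_def cone_action_mult)
  qed
  then have "?\<phi> \<in> hom G (BijGroup ?E)"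
    using Bij by (auto simp: hom_def BijGroup_def)
  then show ?thesis
    by (simp add: group_action_def group_hom_def group_hom_axioms_def group_BijGroup is_group)
qed

lemma cone_kernel_iff:
  "g \<in> cone_kernel \<omega> G S s \<longleftrightarrow> g \<in> carrier G \<and>
     (\<forall>x \<in> admissible G S s.
        ((\<lambda>n. real (word_length G S (inv (x n) \<otimes> (g \<otimes> x n))) / s n) \<longlongrightarrow> 0) \<omega>)"
proof (cases "g \<in> carrier G")
  case True
  note eq = equiv_cone_rel
  let ?E = "asymptotic_cone \<omega> G S s" and ?\<phi> = "cone_action \<omega> G S s" and ?r = "cone_rel \<omega> G S s"
  have "g \<in> cone_kernel \<omega> G S s \<longleftrightarrow> ?\<phi> g = (\<lambda>p \<in> ?E. p)"
    using True by (simp add: cone_kernel_def kernel_def BijGroup_def)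
  also have "\<dots> \<longleftrightarrow> (\<forall>p \<in> ?E. ?\<phi> g p = p)"
    by (auto simp: fun_eq_iff cone_action_def restrict_def)
  also have "\<dots> \<longleftrightarrow> (\<forall>x \<in> admissible G S s. ?r `` {\<lambda>n. g \<otimes> x n} = ?r `` {x})"
    using True by (metis cone_action_class asymptotic_cone_cases asymptotic_cone_classI)
  also have "\<dots> \<longleftrightarrow> (\<forall>x \<in> admissible G S s. (x, \<lambda>n. g \<otimes> x n) \<in> ?r)"
    using True eq translate_admissible by (metis eq_equiv_class_iff)
  also have "\<dots> \<longleftrightarrow> (\<forall>x \<in> admissible G S s.
      ((\<lambda>n. real (word_length G S (inv (x n) \<otimes> (g \<otimes> x n))) / s n) \<longlongrightarrow> 0) \<omega>)"
    using True translate_admissible by (auto simp: cone_rel_def)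
  finally show ?thesis using True by simp
qed (simp add: cone_kernel_def kernel_def)

end

end


section \<open>Hyperbolic spaces\<close>

definition geodesic_segment :: "'x set \<Rightarrow> ('x \<Rightarrow> 'x \<Rightarrow> real) \<Rightarrow> 'x \<Rightarrow> 'x \<Rightarrow> 'x set \<Rightarrow> bool" where
  "geodesic_segment X d x y A \<longleftrightarrow>
     (\<exists>L \<gamma>. 0 \<le> L \<and> \<gamma> 0 = x \<and> \<gamma> L = y \<and> A = \<gamma> ` {0..L} \<and> A \<subseteq> X \<and>
        (\<forall>t \<in> {0..L}. \<forall>t' \<in> {0..L}. d (\<gamma> t) (\<gamma> t') = \<bar>t - t'\<bar>))"

definition delta_hyperbolic :: "real \<Rightarrow> 'x set \<Rightarrow> ('x \<Rightarrow> 'x \<Rightarrow> real) \<Rightarrow> bool" where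
  "delta_hyperbolic \<delta> X d \<longleftrightarrow>
     Metric_space X d \<and>
     (\<forall>x \<in> X. \<forall>y \<in> X. \<exists>A. geodesic_segment X d x y A) \<and>
     (\<forall>x y z A B C. geodesic_segment X d x y A \<and> geodesic_segment X d y z B \<and>
        geodesic_segment X d z x C \<longrightarrow> (\<forall>p \<in> A. \<exists>q \<in> B \<union> C. d p q \<le> \<delta>))"

definition hyperbolic_space :: "'x set \<Rightarrow> ('x \<Rightarrow> 'x \<Rightarrow> real) \<Rightarrow> bool" where
  "hyperbolic_space X d \<longleftrightarrow> (\<exists>\<delta>. delta_hyperbolic \<delta> X d)"


section \<open>Cayley graphs and hyperbolic groups\<close>

definition cayley_adj :: "('a, 'm) monoid_scheme \<Rightarrow> 'a set \<Rightarrow> 'a \<Rightarrow> 'a \<Rightarrow> bool" where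
  "cayley_adj G S u v \<longleftrightarrow> u \<in> carrier G \<and> v \<in> carrier G \<and> u \<noteq> v \<and>
     inv\<^bsub>G\<^esub> u \<otimes>\<^bsub>G\<^esub> v \<in> S \<union> m_inv G ` S"

text \<open>The geometric realization of the Cayley graph, with points given by their barycentric
  coordinates: the vertex \<open>u\<close> is the indicator function of \<open>u\<close>, and the point at distance \<open>t\<close> from
  \<open>u\<close> on the unit edge from \<open>u\<close> to \<open>v\<close> is \<open>(1 - t) u + t v\<close>. Loops and multiple edges of the
  Cayley graph are discarded.\<close>

definition cayley_graph :: "('a, 'm) monoid_scheme \<Rightarrow> 'a set \<Rightarrow> ('a \<Rightarrow> real) set" where
  "cayley_graph G S =
     {(\<lambda>_. 0)(u := 1) | u. u \<in> carrier G} \<union>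
     {(\<lambda>_. 0)(u := 1 - t, v := t) | u v t. cayley_adj G S u v \<and> 0 \<le> t \<and> t \<le> 1}"

definition support :: "('a \<Rightarrow> real) \<Rightarrow> 'a set" where
  "support p = {v. p v \<noteq> 0}"

text \<open>The path metric. The point \<open>p\<close> has distance \<open>1 - p u\<close> from an endpoint \<open>u\<close> of the edge carrying
  it. Two points with the same support lie in the same open edge (or are the same vertex);
  otherwise a shortest path passes through a vertex in the support of each.
  The value \<open>0\<close> off the graph is a convention: the library's locale of metric spaces
  demands symmetry and nonnegativity everywhere.\<close>

definition cayley_dist ::
  "('a, 'm) monoid_scheme \<Rightarrow> 'a set \<Rightarrow> ('a \<Rightarrow> real) \<Rightarrow> ('a \<Rightarrow> real) \<Rightarrow> real" where
  "cayley_dist G S p q =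
     (if p \<notin> cayley_graph G S \<or> q \<notin> cayley_graph G S then 0
      else if support p = support q then Max ((\<lambda>v. \<bar>p v - q v\<bar>) ` support p)
      else Min ((\<lambda>(u, v). (1 - p u) + real (word_dist G S u v) + (1 - q v)) ` (support p \<times> support q)))"

context group
begin

lemma word_dist_adj:
  assumes "cayley_adj G S u v" "S \<subseteq> carrier G"
  shows "word_dist G S u v \<le> 1"
proof -
  have "[inv u \<otimes> v] \<in> words G S" using assms by (auto simp: words_def cayley_adj_def)
  moreover have "inv u \<otimes> v \<in> carrier G" using assms by (simp add: cayley_adj_def)
  ultimately show ?thesis
    using word_length_le[of "[inv u \<otimes> v]" S] by (simp add: word_dist_def)
qed

lemma cayley_graph_cases:
  assumes "p \<in> cayley_graph G S"
  obtains (vertex) u where "u \<in> carrier G" "p u = 1" "support p = {u}"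
  | (edge) u v where "cayley_adj G S u v" "support p = {u, v}" "0 < p u" "0 < p v" "p u + p v = 1"
proof -
  consider u where "u \<in> carrier G" "p = (\<lambda>_. 0)(u := 1)"
    | u v t where "cayley_adj G S u v" "0 \<le> t" "t \<le> 1" "p = (\<lambda>_. 0)(u := 1 - t, v := t)"
    using assms unfolding cayley_graph_def by blast
  then show thesis
  proof cases
    case 1
    then show thesis by (intro vertex[of u]) (auto simp: support_def)
  next
    case 2
    then have uv: "u \<noteq> v" "u \<in> carrier G" "v \<in> carrier G" by (auto simp: cayley_adj_def)
    consider "t = 0" | "t = 1" | "0 < t" "t < 1" using 2 by linarith
    then show thesis
    proof cases
      case 1
      with 2 uv show thesis by (intro vertex[of u]) (auto simp: support_def)
    next
      case 2
      with \<open>p = _\<close> uv show thesis by (intro vertex[of v]) (auto simp: support_def)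
    next
      case 3
      with 2 uv show thesis by (intro edge[of u v]) (auto simp: support_def)
    qed
  qed
qed

context
  fixes S :: "'a set"
  assumes S: "finite_generating_set G S"
begin

lemma support_facts:
  assumes "p \<in> cayley_graph G S"
  shows "finite (support p)" "support p \<noteq> {}" "support p \<subseteq> carrier G"
    and "\<And>u. u \<in> support p \<Longrightarrow> 0 < p u \<and> p u \<le> 1"
    and "\<And>u v. u \<in> support p \<Longrightarrow> v \<in> support p \<Longrightarrow> u \<noteq> v \<Longrightarrow>
       support p = {u, v} \<and> p u + p v = 1 \<and> word_dist G S u v = 1"
proof -
  have SG: "S \<subseteq> carrier G" using S by (simp add: finite_generating_set_def)
  have d1: "word_dist G S u v = 1 \<and> word_dist G S v u = 1" if "cayley_adj G S u v" for u v
  proof -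
    have uv: "u \<in> carrier G" "v \<in> carrier G" "u \<noteq> v" using that by (auto simp: cayley_adj_def)
    have "word_dist G S u v \<le> 1" by (rule word_dist_adj[OF that SG])
    moreover have "word_dist G S u v \<noteq> 0" using uv word_dist_eq_0[OF S] by blast
    ultimately have "word_dist G S u v = 1" by linarith
    then show ?thesis using word_dist_commute[OF S uv(1,2)] by simp
  qed
  from assms have "finite (support p) \<and> support p \<noteq> {} \<and> support p \<subseteq> carrier G \<and>
     (\<forall>u \<in> support p. 0 < p u \<and> p u \<le> 1) \<and>
     (\<forall>u \<in> support p. \<forall>v \<in> support p. u \<noteq> v \<longrightarrow>
       support p = {u, v} \<and> p u + p v = 1 \<and> word_dist G S u v = 1)"
  proof (cases rule: cayley_graph_cases)
    case (vertex u)
    then show ?thesis by auto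
  next
    case (edge u v)
    then show ?thesis using d1[OF edge(1)] by (auto simp: cayley_adj_def)
  qed
  note h = this[THEN conjunct1] this[THEN conjunct2, THEN conjunct1]
    this[THEN conjunct2, THEN conjunct2, THEN conjunct1]
    this[THEN conjunct2, THEN conjunct2, THEN conjunct2, THEN conjunct1]
    this[THEN conjunct2, THEN conjunct2, THEN conjunct2, THEN conjunct2]
  show "finite (support p)" "support p \<noteq> {}" "support p \<subseteq> carrier G" by (fact h)+
  show "0 < p u \<and> p u \<le> 1" if "u \<in> support p" for u
    by (rule bspec[OF h(4) that])
  show "support p = {u, v} \<and> p u + p v = 1 \<and> word_dist G S u v = 1"
    if "u \<in> support p" "v \<in> support p" "u \<noteq> v" for u v
    by (rule h(5)[rule_format, OF that])
qed

lemma cayley_dist_same: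
  assumes p: "p \<in> cayley_graph G S" and q: "q \<in> cayley_graph G S"
    and eq: "support p = support q" and u: "u \<in> support p"
  shows "cayley_dist G S p q = \<bar>p u - q u\<bar>"
proof -
  have "\<bar>p v - q v\<bar> = \<bar>p u - q u\<bar>" if v: "v \<in> support p" for v
  proof (cases "u = v")
    case False
    then have "p u + p v = 1" "q u + q v = 1"
      using support_facts(5)[OF p u v] support_facts(5)[OF q, of u v] u v eq by auto
    then show ?thesis by linarith
  qed simp
  then have "(\<lambda>v. \<bar>p v - q v\<bar>) ` support p = (\<lambda>_. \<bar>p u - q u\<bar>) ` support p"
    by (rule image_cong[OF refl])
  also have "\<dots> = {\<bar>p u - q u\<bar>}" by (rule image_constant[OF u])
  finally have "(\<lambda>v. \<bar>p v - q v\<bar>) ` support p = {\<bar>p u - q u\<bar>}" .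
  then show ?thesis using p q eq by (simp add: cayley_dist_def)
qed

lemma cayley_dist_diff_witness:
  assumes p: "p \<in> cayley_graph G S" and q: "q \<in> cayley_graph G S" and ne: "support p \<noteq> support q"
  obtains u v where "u \<in> support p" "v \<in> support q"
    "cayley_dist G S p q = (1 - p u) + real (word_dist G S u v) + (1 - q v)"
proof -
  let ?F = "(\<lambda>(u, v). (1 - p u) + real (word_dist G S u v) + (1 - q v)) ` (support p \<times> support q)"
  have "finite ?F" "?F \<noteq> {}"
    using support_facts(1,2)[OF p] support_facts(1,2)[OF q] by auto
  then have "Min ?F \<in> ?F" by (rule Min_in)
  then show thesis using that p q ne by (auto simp: cayley_dist_def)
qed

lemma cayley_dist_le:
  assumes p: "p \<in> cayley_graph G S" and q: "q \<in> cayley_graph G S"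
    and u: "u \<in> support p" and v: "v \<in> support q"
  shows "cayley_dist G S p q \<le> (1 - p u) + real (word_dist G S u v) + (1 - q v)"
proof (cases "support p = support q")
  case True
  have d: "cayley_dist G S p q = \<bar>p u - q u\<bar>" by (rule cayley_dist_same[OF p q True u])
  have pu: "0 < p u" "p u \<le> 1" and qv: "0 < q v" "q v \<le> 1"
    and qu: "0 < q u" "q u \<le> 1"
    using support_facts(4)[OF p u] support_facts(4)[OF q v] support_facts(4)[OF q, of u] u True by auto
  show ?thesis
  proof (cases "u = v")
    case True
    then have "q v = q u" by simp
    moreover have "0 \<le> real (word_dist G S u v)" by simp
    ultimately show ?thesis using d pu qu by linarith
  next
    case False
    have "v \<in> support p" using v True by simp
    then have "real (word_dist G S u v) = 1" using support_facts(5)[OF p u _ False] by simp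
    then show ?thesis using d pu qu qv by linarith
  qed
next
  case False
  let ?F = "(\<lambda>(u, v). (1 - p u) + real (word_dist G S u v) + (1 - q v)) ` (support p \<times> support q)"
  have "finite ?F" using support_facts(1)[OF p] support_facts(1)[OF q] by auto
  then have "Min ?F \<le> (1 - p u) + real (word_dist G S u v) + (1 - q v)"
    using u v by (intro Min_le) auto
  then show ?thesis using p q False by (simp add: cayley_dist_def)
qed

lemma support_word_dist_le:
  assumes "q \<in> cayley_graph G S" "u \<in> support q" "v \<in> support q"
  shows "real (word_dist G S u v) \<le> (1 - q u) + (1 - q v)"
proof (cases "u = v")
  case True
  have "u \<in> carrier G" using support_facts(3)[OF assms(1)] assms(2) by blast
  then have "word_dist G S u v = 0" using True word_dist_eq_0[OF S] by auto
  then show ?thesis using support_facts(4)[OF assms(1,2)] support_facts(4)[OF assms(1,3)] by simp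
next
  case False
  then show ?thesis using support_facts(5)[OF assms] by auto
qed

lemma cayley_dist_commute: "cayley_dist G S p q = cayley_dist G S q p"
proof (cases "p \<in> cayley_graph G S \<and> q \<in> cayley_graph G S")
  case True
  then have p: "p \<in> cayley_graph G S" and q: "q \<in> cayley_graph G S" by auto
  show ?thesis
  proof (cases "support p = support q")
    case True
    obtain u where u: "u \<in> support p" using support_facts(2)[OF p] by auto
    then show ?thesis
      using cayley_dist_same[OF p q True u] cayley_dist_same[OF q p, of u] True by auto
  next
    case False
    have le: "cayley_dist G S p' q' \<le> cayley_dist G S q' p'"
      if p': "p' \<in> cayley_graph G S" and q': "q' \<in> cayley_graph G S"
        and ne: "support q' \<noteq> support p'" for p' q'
    proof -
      obtain u v where uv: "u \<in> support q'" "v \<in> support p'"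
        "cayley_dist G S q' p' = (1 - q' u) + real (word_dist G S u v) + (1 - p' v)"
        using cayley_dist_diff_witness[OF q' p' ne] .
      have "word_dist G S u v = word_dist G S v u"
        using uv support_facts(3)[OF p'] support_facts(3)[OF q'] by (intro word_dist_commute[OF S]) auto
      then show ?thesis using cayley_dist_le[OF p' q' uv(2,1)] uv(3) by simp
    qed
    show ?thesis using le[OF p q] le[OF q p] False by (metis order_antisym)
  qed
qed (auto simp: cayley_dist_def)

lemma cayley_dist_triangle_same:
  assumes p: "p \<in> cayley_graph G S" and q: "q \<in> cayley_graph G S" and r: "r \<in> cayley_graph G S"
    and pq: "support p = support q"
  shows "cayley_dist G S p r \<le> cayley_dist G S p q + cayley_dist G S q r"
proof (cases "support q = support r")
  case True
  obtain u where u: "u \<in> support p" using support_facts(2)[OF p] by auto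
  have "cayley_dist G S p q = \<bar>p u - q u\<bar>" "cayley_dist G S q r = \<bar>q u - r u\<bar>"
    "cayley_dist G S p r = \<bar>p u - r u\<bar>"
    using cayley_dist_same[of p q u] cayley_dist_same[of q r u] cayley_dist_same[of p r u]
      p q r u pq True by auto
  then show ?thesis by linarith
next
  case False
  obtain u v where uv: "u \<in> support q" "v \<in> support r"
    "cayley_dist G S q r = (1 - q u) + real (word_dist G S u v) + (1 - r v)"
    using cayley_dist_diff_witness[OF q r False] .
  have u: "u \<in> support p" using uv pq by simp
  show ?thesis
    using cayley_dist_le[OF p r u uv(2)] uv(3) cayley_dist_same[OF p q pq u] by linarith
qed

lemma cayley_dist_triangle:
  assumes p: "p \<in> cayley_graph G S" and q: "q \<in> cayley_graph G S" and r: "r \<in> cayley_graph G S"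
  shows "cayley_dist G S p r \<le> cayley_dist G S p q + cayley_dist G S q r"
proof -
  consider "support p = support q" | "support r = support q"
    | "support p \<noteq> support q" "support q \<noteq> support r" by metis
  then show ?thesis
  proof cases
    case 1
    then show ?thesis by (rule cayley_dist_triangle_same[OF p q r])
  next
    case 2
    then show ?thesis
      using cayley_dist_triangle_same[OF r q p] by (simp add: cayley_dist_commute)
  next
    case 3
    obtain a b where ab: "a \<in> support p" "b \<in> support q"
      "cayley_dist G S p q = (1 - p a) + real (word_dist G S a b) + (1 - q b)"
      using cayley_dist_diff_witness[OF p q 3(1)] .
    obtain b' c where bc: "b' \<in> support q" "c \<in> support r"
      "cayley_dist G S q r = (1 - q b') + real (word_dist G S b' c) + (1 - r c)"
      using cayley_dist_diff_witness[OF q r 3(2)] .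
    have car: "a \<in> carrier G" "b \<in> carrier G" "b' \<in> carrier G" "c \<in> carrier G"
      using ab bc support_facts(3)[OF p] support_facts(3)[OF q] support_facts(3)[OF r] by auto
    have "word_dist G S a c \<le> word_dist G S a b + word_dist G S b c"
      "word_dist G S b c \<le> word_dist G S b b' + word_dist G S b' c"
      using car by (auto intro: word_dist_triangle[OF S])
    then have "real (word_dist G S a c)
        \<le> real (word_dist G S a b) + real (word_dist G S b b') + real (word_dist G S b' c)"
      by linarith
    then show ?thesis
      using cayley_dist_le[OF p r ab(1) bc(2)] support_word_dist_le[OF q ab(2) bc(1)] ab(3) bc(3)
      by linarith
  qed
qed

lemma cayley_dist_nonneg: "0 \<le> cayley_dist G S p q"
proof (cases "p \<in> cayley_graph G S \<and> q \<in> cayley_graph G S")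
  case True
  then have p: "p \<in> cayley_graph G S" and q: "q \<in> cayley_graph G S" by auto
  show ?thesis
  proof (cases "support p = support q")
    case True
    obtain u where u: "u \<in> support p" using support_facts(2)[OF p] by auto
    then show ?thesis using cayley_dist_same[OF p q True u] by simp
  next
    case False
    obtain u v where uv: "u \<in> support p" "v \<in> support q"
      "cayley_dist G S p q = (1 - p u) + real (word_dist G S u v) + (1 - q v)"
      using cayley_dist_diff_witness[OF p q False] .
    then show ?thesis
      using support_facts(4)[OF p uv(1)] support_facts(4)[OF q uv(2)] by simp
  qed
qed (auto simp: cayley_dist_def)

lemma cayley_dist_eq_0:
  assumes p: "p \<in> cayley_graph G S" and q: "q \<in> cayley_graph G S"
  shows "cayley_dist G S p q = 0 \<longleftrightarrow> p = q"
proof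
  assume "p = q"
  moreover obtain u where "u \<in> support p" using support_facts(2)[OF p] by auto
  ultimately show "cayley_dist G S p q = 0" using cayley_dist_same[OF p q, of u] by simp
next
  assume 0: "cayley_dist G S p q = 0"
  show "p = q"
  proof (cases "support p = support q")
    case True
    have "p u = q u" for u
    proof (cases "u \<in> support p")
      case u: True
      then show ?thesis using cayley_dist_same[OF p q True u] 0 by simp
    next
      case False
      moreover have "u \<notin> support q" using False True by simp
      ultimately show ?thesis by (simp add: support_def)
    qed
    then show ?thesis by (rule ext)
  next
    case False
    obtain u v where uv: "u \<in> support p" "v \<in> support q"
      "cayley_dist G S p q = (1 - p u) + real (word_dist G S u v) + (1 - q v)"
      using cayley_dist_diff_witness[OF p q False] .
    have le: "p u \<le> 1" "q v \<le> 1"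
      using support_facts(4)[OF p uv(1)] support_facts(4)[OF q uv(2)] by auto
    have ge: "0 \<le> real (word_dist G S u v)" by simp
    have pu: "p u = 1" and qv: "q v = 1" and "real (word_dist G S u v) = 0"
      using uv(3) 0 le ge by linarith+
    then have uv_eq: "u = v"
      using word_dist_eq_0[OF S, of u v] uv support_facts(3)[OF p] support_facts(3)[OF q] by auto
    have "w = u" if w: "w \<in> support p" for w
      using support_facts(5)[OF p uv(1) w] support_facts(4)[OF p w] pu by force
    then have "support p = {u}" using uv(1) by blast
    moreover have "w = v" if w: "w \<in> support q" for w
      using support_facts(5)[OF q uv(2) w] support_facts(4)[OF q w] qv by force
    then have "support q = {v}" using uv(2) by blast
    ultimately show ?thesis using False uv_eq by simp
  qed
qed

lemma Metric_space_cayley: "Metric_space (cayley_graph G S) (cayley_dist G S)"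
  by unfold_locales
     (auto simp: cayley_dist_nonneg cayley_dist_eq_0 intro: cayley_dist_commute cayley_dist_triangle)

end

end

definition hyperbolic_group :: "('a, 'm) monoid_scheme \<Rightarrow> bool" where
  "hyperbolic_group G \<longleftrightarrow> group G \<and>
     (\<exists>S. finite_generating_set G S \<and> hyperbolic_space (cayley_graph G S) (cayley_dist G S))"

definition elementary_group :: "('a, 'm) monoid_scheme \<Rightarrow> bool" where
  "elementary_group G \<longleftrightarrow> finite (carrier G) \<or>
     (\<exists>H. subgroup H G \<and> finite (rcosets\<^bsub>G\<^esub> H) \<and> G\<lparr>carrier := H\<rparr> \<cong> integer_group)"


section \<open>The Gromov boundary\<close>

definition gromov_product :: "('x \<Rightarrow> 'x \<Rightarrow> real) \<Rightarrow> 'x \<Rightarrow> 'x \<Rightarrow> 'x \<Rightarrow> real" where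
  "gromov_product d b x y = (d x b + d y b - d x y) / 2"

definition sequences_equiv ::
  "'x set \<Rightarrow> ('x \<Rightarrow> 'x \<Rightarrow> real) \<Rightarrow> (nat \<Rightarrow> 'x) \<Rightarrow> (nat \<Rightarrow> 'x) \<Rightarrow> bool" where
  "sequences_equiv X d x y \<longleftrightarrow>
     (\<forall>b \<in> X. filterlim (\<lambda>(m, n). gromov_product d b (x m) (y n)) at_top (sequentially \<times>\<^sub>F sequentially))"

definition sequences_to_infinity :: "'x set \<Rightarrow> ('x \<Rightarrow> 'x \<Rightarrow> real) \<Rightarrow> (nat \<Rightarrow> 'x) set" where
  "sequences_to_infinity X d = {x. (\<forall>n. x n \<in> X) \<and> sequences_equiv X d x x}"

text \<open>The sequential boundary, which does not require \<open>X\<close> to be proper.\<close>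

definition gromov_boundary :: "'x set \<Rightarrow> ('x \<Rightarrow> 'x \<Rightarrow> real) \<Rightarrow> (nat \<Rightarrow> 'x) set set" where
  "gromov_boundary X d =
     sequences_to_infinity X d //
       {(x, y). x \<in> sequences_to_infinity X d \<and> y \<in> sequences_to_infinity X d \<and> sequences_equiv X d x y}"


section \<open>Isometric actions\<close>

definition isometric_action ::
  "('a, 'm) monoid_scheme \<Rightarrow> 'x set \<Rightarrow> ('x \<Rightarrow> 'x \<Rightarrow> real) \<Rightarrow> ('a \<Rightarrow> 'x \<Rightarrow> 'x) \<Rightarrow> bool" where
  "isometric_action G X d \<phi> \<longleftrightarrow> group_action G X \<phi> \<and>
     (\<forall>g \<in> carrier G. \<forall>x \<in> X. \<forall>y \<in> X. d (\<phi> g x) (\<phi> g y) = d x y)"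

definition acylindrical_action ::
  "('a, 'm) monoid_scheme \<Rightarrow> 'x set \<Rightarrow> ('x \<Rightarrow> 'x \<Rightarrow> real) \<Rightarrow> ('a \<Rightarrow> 'x \<Rightarrow> 'x) \<Rightarrow> bool" where
  "acylindrical_action G X d \<phi> \<longleftrightarrow> isometric_action G X d \<phi> \<and>
     (\<forall>\<epsilon>>0. \<exists>R>0. \<exists>N>0. \<forall>x \<in> X. \<forall>y \<in> X. R \<le> d x y \<longrightarrow>
        finite {g \<in> carrier G. d x (\<phi> g x) \<le> \<epsilon> \<and> d y (\<phi> g y) \<le> \<epsilon>} \<and>
        card {g \<in> carrier G. d x (\<phi> g x) \<le> \<epsilon> \<and> d y (\<phi> g y) \<le> \<epsilon>} \<le> N)"

text \<open>The boundary points represented by sequences in an orbit; all orbits give the same set.\<close>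

definition limit_set ::
  "('a, 'm) monoid_scheme \<Rightarrow> 'x set \<Rightarrow> ('x \<Rightarrow> 'x \<Rightarrow> real) \<Rightarrow> ('a \<Rightarrow> 'x \<Rightarrow> 'x) \<Rightarrow> (nat \<Rightarrow> 'x) set set" where
  "limit_set G X d \<phi> =
     {\<xi> \<in> gromov_boundary X d. \<exists>x \<in> X. \<exists>y \<in> \<xi>. \<forall>n. y n \<in> orbit G \<phi> x}"

definition nonelementary_action ::
  "('a, 'm) monoid_scheme \<Rightarrow> 'x set \<Rightarrow> ('x \<Rightarrow> 'x \<Rightarrow> real) \<Rightarrow> ('a \<Rightarrow> 'x \<Rightarrow> 'x) \<Rightarrow> bool" where
  "nonelementary_action G X d \<phi> \<longleftrightarrow> infinite (limit_set G X d \<phi>) \<or> card (limit_set G X d \<phi>) > 2"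

definition quasi_isometric_embedding ::
  "'x set \<Rightarrow> ('x \<Rightarrow> 'x \<Rightarrow> real) \<Rightarrow> 'y set \<Rightarrow> ('y \<Rightarrow> 'y \<Rightarrow> real) \<Rightarrow> ('x \<Rightarrow> 'y) \<Rightarrow> bool" where
  "quasi_isometric_embedding X d Y d' f \<longleftrightarrow> f ` X \<subseteq> Y \<and>
     (\<exists>K\<ge>1. \<exists>C\<ge>0. \<forall>x \<in> X. \<forall>y \<in> X.
        d x y / K - C \<le> d' (f x) (f y) \<and> d' (f x) (f y) \<le> K * d x y + C)"

definition loxodromic ::
  "('a, 'm) monoid_scheme \<Rightarrow> 'x set \<Rightarrow> ('x \<Rightarrow> 'x \<Rightarrow> real) \<Rightarrow> ('a \<Rightarrow> 'x \<Rightarrow> 'x) \<Rightarrow> 'a \<Rightarrow> bool" where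
  "loxodromic G X d \<phi> g \<longleftrightarrow> g \<in> carrier G \<and>
     (\<exists>x \<in> X. quasi_isometric_embedding (UNIV :: int set) dist X d (\<lambda>n. \<phi> (g [^]\<^bsub>G\<^esub> n) x))"

text \<open>The type argument bounds the size of the spaces over which the existential ranges.\<close>

definition acylindrically_hyperbolic :: "'x itself \<Rightarrow> ('a, 'm) monoid_scheme \<Rightarrow> bool" where
  "acylindrically_hyperbolic _ G \<longleftrightarrow>
     (\<exists>(X :: 'x set) d \<phi>. hyperbolic_space X d \<and> acylindrical_action G X d \<phi> \<and> nonelementary_action G X d \<phi>)"

end

theory Submission
  imports Defs
begin

text \<open>
  Everything takes place in a metric space with Gromov's four-point inequality. The orbit of a point
  \<open>x\<^sub>0\<close> under the powers of a loxodromic \<open>g\<close> satisfies \<open>d(g\<^sup>m x\<^sub>0, g\<^sup>n x\<^sub>0) = \<tau> |m - n| + O(1)\<close>, by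
  subadditivity and the four-point inequality alone, so no stability of quasi-geodesics is needed.
  There are two cases. If every element of \<open>G\<close> preserves the pair of ends of this rough axis, the whole
  orbit lies uniformly close to the axis: there are at most two limit points, and by acylindricity the
  powers of \<open>g\<close> have finite conjugacy classes, hence lie in the kernel. Otherwise there is a third end
  \<open>h g\<^sup>\<plusminus>\<^sup>\<infinity>\<close>. An element of the kernel displaces points of a ray sublinearly, so it fixes all three ends
  and moves their rough center by a bounded amount, and acylindricity makes the kernel finite.

  A hyperbolic group acts on itself with its word metric. Cannon's argument, finiteness of cone types,
  produces an element all of whose powers are geodesic, so the same dichotomy applies, and closeness of
  the orbit to the axis says that the powers of this element have finite index.
\<close>

section \<open>The four-point inequality\<close>

text \<open>The inequality replaces geodesics so that one argument serves two kinds of spaces: a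
  geodesic \<open>X\<close> that need not be proper, where geodesics to boundary points cannot be
  obtained as limits, and a group with its word metric, which is not geodesic. Membership in the
  kernel only says that points at distance about \<open>s n\<close> move by o(\<open>s n\<close>),
  which bounds no displacement by itself. It does suffice to fix an end. Two fixed ends still leave
  room for arbitrarily long translations along the axis; three fixed ends pin down a bounded region,
  and this is what turns sublinear motion into a uniform bound. In part (1) elementarity is a
  property of the group and not of an action, so one implication is algebraic: conjugating an
  element of a finite-index infinite cyclic subgroup by \<open>h\<close> gives a result that depends
  only on the coset of \<open>h\<close>, hence the element has finitely many conjugates and lies in
  the kernel.\<close>

locale four_point_space = Metric_space X d for X :: "'x set" and d +
  fixes \<delta> :: real
  assumes four_point: "\<lbrakk>x \<in> X; y \<in> X; z \<in> X; w \<in> X\<rbrakk> \<Longrightarrow>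
    d x z + d y w \<le> max (d x y + d z w) (d y z + d x w) + 2 * \<delta>"

section \<open>From thin triangles to the four-point inequality\<close>

lemma geodesic_segmentE:
  assumes "geodesic_segment X d x y A"
  obtains L \<gamma> where "0 \<le> L" "\<gamma> 0 = x" "\<gamma> L = y" "A = \<gamma> ` {0..L}" "A \<subseteq> X"
    "\<forall>t \<in> {0..L}. \<forall>t' \<in> {0..L}. d (\<gamma> t) (\<gamma> t') = \<bar>t - t'\<bar>"
  using assms unfolding geodesic_segment_def by (elim exE conjE) (rule that)

lemma geodesic_segment_ends:
  assumes "geodesic_segment X d x y A"
  shows "x \<in> A" "y \<in> A"
  by (rule geodesic_segmentE[OF assms], force)+

lemma geodesic_segment_dist:
  assumes "geodesic_segment X d x y A" "p \<in> A"
  shows "d x p + d p y = d x y" "p \<in> X" "x \<in> X" "y \<in> X"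
proof -
  obtain L \<gamma> where L: "0 \<le> L" "\<gamma> 0 = x" "\<gamma> L = y" "A = \<gamma> ` {0..L}" "A \<subseteq> X"
    and iso: "\<forall>t \<in> {0..L}. \<forall>t' \<in> {0..L}. d (\<gamma> t) (\<gamma> t') = \<bar>t - t'\<bar>"
    using geodesic_segmentE[OF assms(1)] .
  obtain t where t: "t \<in> {0..L}" "p = \<gamma> t" using assms(2) unfolding L(4) by (rule imageE)
  show "d x p + d p y = d x y"
    using iso[rule_format, of 0 t] iso[rule_format, of t L] iso[rule_format, of 0 L] t L by auto
  show "p \<in> X" "x \<in> X" "y \<in> X" using L t by auto
qed

text \<open>A coarse form of the connectedness of an interval. The sets where \<open>P\<close> and
  \<open>Q\<close> hold need not be closed, so a common point may fail to exist; a step of length 1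
  from a point just below the supremum of \<open>P\<close> crosses over to \<open>Q\<close>.\<close>

lemma real_interval_crossing:
  fixes L :: real
  assumes "0 \<le> L" "P 0" "Q L" and cover: "\<And>t. t \<in> {0..L} \<Longrightarrow> P t \<or> Q t"
  obtains t t' where "t \<in> {0..L}" "t' \<in> {0..L}" "\<bar>t - t'\<bar> \<le> 1" "P t" "Q t'"
proof -
  let ?A = "{t \<in> {0..L}. P t}"
  have bdd: "bdd_above ?A" by (auto intro!: bdd_aboveI[of _ L])
  have ne: "0 \<in> ?A" using assms by auto
  have up: "t \<le> Sup ?A" if "t \<in> ?A" for t using that bdd by (rule cSup_upper)
  have "Sup ?A - 1/2 < Sup ?A" by simp
  then obtain t where t: "t \<in> ?A" "Sup ?A - 1/2 < t" using less_cSupE[of _ ?A] ne by blast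
  have "min L (t + 1) \<in> {0..L}" using t by auto
  moreover have "Q (min L (t + 1))"
  proof (cases "L \<le> t + 1")
    case False
    then have "\<not> P (t + 1)" using up[of "t + 1"] t by auto
    then show ?thesis using cover[of "t + 1"] False t by auto
  qed (simp add: assms(3))
  ultimately show thesis using that[of t "min L (t + 1)"] t by auto
qed

lemma delta_hyperbolic_geodesic:
  assumes "delta_hyperbolic \<delta> X d" "x \<in> X" "y \<in> X"
  obtains A where "geodesic_segment X d x y A"
  using assms(1)[unfolded delta_hyperbolic_def, THEN conjunct2, THEN conjunct1] assms(2,3) by fast

lemma delta_hyperbolic_thin:
  assumes "delta_hyperbolic \<delta> X d" "geodesic_segment X d x y A" "geodesic_segment X d y z B"
    "geodesic_segment X d z x C" "p \<in> A"
  shows "\<exists>q \<in> B \<union> C. d p q \<le> \<delta>"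
  using assms(1)[unfolded delta_hyperbolic_def, THEN conjunct2, THEN conjunct2, rule_format, of x y A z B C p]
    assms(2-) by fast

text \<open>Walking along \<open>A\<close>, one passes from points close to the side
  \<open>[w, x]\<close> to points close to \<open>[w, y]\<close>. A point at the switch is close to
  both, so the paths from \<open>w\<close> through it to \<open>x\<close> and to \<open>y\<close>
  are nearly geodesic. The 1 is the gap left at the switch.\<close>

lemma delta_hyperbolic_point_near_geodesic:
  assumes hyp: "delta_hyperbolic \<delta> X d" and A: "geodesic_segment X d x y A" and w: "w \<in> X"
  obtains p where "p \<in> A" "d w p \<le> gromov_product d w x y + 2 * \<delta> + 1"
proof -
  interpret Metric_space X d using hyp by (simp add: delta_hyperbolic_def)
  obtain L \<gamma> where L: "0 \<le> L" "\<gamma> 0 = x" "\<gamma> L = y" "A = \<gamma> ` {0..L}" "A \<subseteq> X"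
    and iso: "\<forall>t \<in> {0..L}. \<forall>t' \<in> {0..L}. d (\<gamma> t) (\<gamma> t') = \<bar>t - t'\<bar>"
    using geodesic_segmentE[OF A] .
  have xA: "x \<in> A" and yA: "y \<in> A" using geodesic_segment_ends[OF A] by auto
  then have xX: "x \<in> X" and yX: "y \<in> X" using L by auto
  obtain B where B: "geodesic_segment X d y w B" using delta_hyperbolic_geodesic[OF hyp yX w] .
  obtain C where C: "geodesic_segment X d w x C" using delta_hyperbolic_geodesic[OF hyp w xX] .
  note thin = delta_hyperbolic_thin[OF hyp A B C]
  have d0: "0 \<le> \<delta>" using thin[OF xA] nonneg by (meson order_trans)
  have wx: "x \<in> C" "y \<in> B"
    using geodesic_segment_ends[OF B] geodesic_segment_ends[OF C] by auto
  obtain t t' where t: "t \<in> {0..L}" "t' \<in> {0..L}" "\<bar>t - t'\<bar> \<le> 1"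
    "\<exists>q \<in> C. d (\<gamma> t) q \<le> \<delta>" "\<exists>q \<in> B. d (\<gamma> t') q \<le> \<delta>"
  proof (rule real_interval_crossing[OF L(1), of "\<lambda>t. \<exists>q \<in> C. d (\<gamma> t) q \<le> \<delta>" "\<lambda>t. \<exists>q \<in> B. d (\<gamma> t) q \<le> \<delta>"])
    show "\<exists>q\<in>C. d (\<gamma> 0) q \<le> \<delta>" using wx L d0 xX by force
    show "\<exists>q\<in>B. d (\<gamma> L) q \<le> \<delta>" using wx L d0 yX by force
    show "(\<exists>q\<in>C. d (\<gamma> t) q \<le> \<delta>) \<or> (\<exists>q\<in>B. d (\<gamma> t) q \<le> \<delta>)" if "t \<in> {0..L}" for t
      using thin[of "\<gamma> t"] L that by blast
  qed
  obtain q where q: "q \<in> C" "d (\<gamma> t) q \<le> \<delta>" using t by blast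
  obtain r where r: "r \<in> B" "d (\<gamma> t') r \<le> \<delta>" using t by blast
  have pX: "\<gamma> t \<in> X" "\<gamma> t' \<in> X" "\<gamma> t \<in> A" using L t by auto
  note qd = geodesic_segment_dist[OF C q(1)] and rd = geodesic_segment_dist[OF B r(1)]
  have "d (\<gamma> t) (\<gamma> t') \<le> 1" using iso t by simp
  then have pp: "d (\<gamma> t') (\<gamma> t) \<le> 1" by (simp add: commute)
  have Ad: "d x (\<gamma> t) + d (\<gamma> t) y = d x y" by (rule geodesic_segment_dist(1)[OF A pX(3)])
  have qX: "q \<in> X" and rX: "r \<in> X" using qd rd by auto
  have "d x (\<gamma> t) \<le> d q x + \<delta>" "d w (\<gamma> t) \<le> d w q + \<delta>"
    using triangle[OF xX qX pX(1)] triangle[OF w qX pX(1)] q(2) commute[of q] by simp_all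
  moreover have "d y (\<gamma> t') \<le> d y r + \<delta>" "d w (\<gamma> t') \<le> d r w + \<delta>"
    using triangle[OF yX rX pX(2)] triangle[OF w rX pX(2)] r(2) commute[of r] by simp_all
  moreover have "d w (\<gamma> t) \<le> d w (\<gamma> t') + 1" "d (\<gamma> t) y \<le> d y (\<gamma> t') + 1"
    using triangle[OF w pX(2,1)] triangle[OF yX pX(2,1)] pp commute[of y "\<gamma> t"] by simp_all
  ultimately have "2 * d w (\<gamma> t) + d x y \<le> d w x + d y w + 4 * \<delta> + 2"
    using Ad qd(1) rd(1) by linarith
  then have "d w (\<gamma> t) \<le> gromov_product d w x y + 2 * \<delta> + 1"
    unfolding gromov_product_def commute[of w x] by (simp add: field_simps)
  then show thesis using that pX(3) by blast
qed

text \<open>The distance from \<open>w\<close> to any point of a geodesic bounds the Gromov product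
  of its ends from above, so the point \<open>p\<close> near \<open>w\<close> need only be moved to
  one of the other two sides. Finding \<open>p\<close> costs \<open>2 * \<delta> + 1\<close>, moving
  it costs \<open>\<delta>\<close>.\<close>

lemma delta_hyperbolic_four_point:
  assumes hyp: "delta_hyperbolic \<delta> X d"
  shows "four_point_space X d (3 * \<delta> + 1)"
proof -
  interpret Metric_space X d using hyp by (simp add: delta_hyperbolic_def)
  have upper: "gromov_product d w x y \<le> d w p"
    if "geodesic_segment X d x y A" "p \<in> A" "w \<in> X" for x y w p A
  proof -
    note g = geodesic_segment_dist[OF that(1,2)]
    have "d x w \<le> d x p + d p w" "d y w \<le> d y p + d p w" using g that triangle by auto
    then show ?thesis unfolding gromov_product_def using g(1) by (simp add: commute)
  qed
  show ?thesis
  proof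
    fix x y z w assume X: "x \<in> X" "y \<in> X" "z \<in> X" "w \<in> X"
    obtain A where A: "geodesic_segment X d x z A" using delta_hyperbolic_geodesic[OF hyp X(1,3)] .
    obtain B where B: "geodesic_segment X d z y B" using delta_hyperbolic_geodesic[OF hyp X(3,2)] .
    obtain C where C: "geodesic_segment X d y x C" using delta_hyperbolic_geodesic[OF hyp X(2,1)] .
    obtain p where p: "p \<in> A" "d w p \<le> gromov_product d w x z + 2 * \<delta> + 1"
      using delta_hyperbolic_point_near_geodesic[OF hyp A X(4)] .
    obtain q where q: "q \<in> B \<union> C" "d p q \<le> \<delta>"
      using delta_hyperbolic_thin[OF hyp A B C p(1)] by blast
    have pX: "p \<in> X" using geodesic_segment_dist[OF A p(1)] by simp
    have "gromov_product d w z y \<le> d w q \<or> gromov_product d w y x \<le> d w q"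
      using upper q B C X by blast
    moreover have "q \<in> X" using q geodesic_segment_dist(2)[OF B] geodesic_segment_dist(2)[OF C] by blast
    moreover from this have "d w q \<le> d w p + d p q" using triangle X pX by blast
    ultimately show "d x z + d y w \<le> max (d x y + d z w) (d y z + d x w) + 2 * (3 * \<delta> + 1)"
      using p(2) q(2) commute[of z y] commute[of y x]
      unfolding gromov_product_def by (auto simp: max_def field_simps)
  qed
qed

section \<open>Gromov products and sequences converging to infinity\<close>

context four_point_space
begin

abbreviation gp :: "'x \<Rightarrow> 'x \<Rightarrow> 'x \<Rightarrow> real" where "gp \<equiv> gromov_product d"

lemma delta_nonneg: "x \<in> X \<Longrightarrow> 0 \<le> \<delta>"
  using four_point[of x x x x] by simp

lemma gp_commute: "gp b x y = gp b y x"
  by (simp add: gromov_product_def commute)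

lemma gp_nonneg: "\<lbrakk>b \<in> X; x \<in> X; y \<in> X\<rbrakk> \<Longrightarrow> 0 \<le> gp b x y"
  using triangle[of x b y] by (simp add: gromov_product_def commute)

text \<open>The factor 2 in the locale assumption is there so that the defect in this form is
  exactly \<open>\<delta>\<close>.\<close>

lemma gp_four_point:
  assumes "b \<in> X" "x \<in> X" "y \<in> X" "z \<in> X"
  shows "min (gp b x y) (gp b y z) - \<delta> \<le> gp b x z"
  using four_point[OF assms(2-4,1)] unfolding gromov_product_def
  by (auto simp: max_def min_def field_simps split: if_splits)

lemma gp_base_le:
  assumes "b \<in> X" "b' \<in> X" "x \<in> X" "y \<in> X"
  shows "gp b x y - d b b' \<le> gp b' x y"
  using triangle[of x b' b] triangle[of y b' b] assms
  unfolding gromov_product_def commute[of b' b] by argo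

lemma gp_right_le:
  assumes "b \<in> X" "x \<in> X" "y \<in> X" "y' \<in> X"
  shows "gp b x y - d y y' \<le> gp b x y'"
  using triangle[of y y' b] triangle[of x y y'] assms
  unfolding gromov_product_def by argo

lemma filterlim_gp_iff:
  "filterlim (\<lambda>(m, n). gp b (x m) (y n)) at_top (sequentially \<times>\<^sub>F sequentially)
    \<longleftrightarrow> (\<forall>C. \<exists>N. \<forall>m\<ge>N. \<forall>n\<ge>N. C \<le> gp b (x m) (y n))"
proof -
  have "(\<exists>N. \<forall>m\<ge>N. \<forall>n\<ge>N. C \<le> gp b (x n) (y m)) \<longleftrightarrow> (\<exists>N. \<forall>m\<ge>N. \<forall>n\<ge>N. C \<le> gp b (x m) (y n))" for C
    by blast
  then show ?thesis
    unfolding filterlim_at_top eventually_prod_sequentially by simp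
qed

lemma sequences_equivD:
  assumes "sequences_equiv X d x y" "b \<in> X"
  shows "\<exists>N. \<forall>m\<ge>N. \<forall>n\<ge>N. C \<le> gp b (x m) (y n)"
  using assms unfolding sequences_equiv_def filterlim_gp_iff by blast

lemma sequences_equiv_iff:
  assumes b: "b \<in> X" and x: "\<And>n. x n \<in> X" and y: "\<And>n. y n \<in> X"
  shows "sequences_equiv X d x y \<longleftrightarrow> (\<forall>C. \<exists>N. \<forall>m\<ge>N. \<forall>n\<ge>N. C \<le> gp b (x m) (y n))"
proof
  assume R: "\<forall>C. \<exists>N. \<forall>m\<ge>N. \<forall>n\<ge>N. C \<le> gp b (x m) (y n)"
  have "\<exists>N. \<forall>m\<ge>N. \<forall>n\<ge>N. C \<le> gp b' (x m) (y n)" if b': "b' \<in> X" for b' C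
  proof -
    obtain N where N: "\<And>m n. m \<ge> N \<Longrightarrow> n \<ge> N \<Longrightarrow> C + d b b' \<le> gp b (x m) (y n)"
      using R by blast
    have "C \<le> gp b' (x m) (y n)" if "m \<ge> N" "n \<ge> N" for m n
      using gp_base_le[OF b b' x y, of m n] N[OF that] by linarith
    then show ?thesis by blast
  qed
  then show "sequences_equiv X d x y" unfolding sequences_equiv_def filterlim_gp_iff by blast
qed (use sequences_equivD[OF _ b] in blast)

lemma sequences_equiv_sym:
  assumes X: "\<And>n. x n \<in> X" "\<And>n. y n \<in> X" and xy: "sequences_equiv X d x y"
  shows "sequences_equiv X d y x"
  unfolding sequences_equiv_iff[OF X(1)[of 0] X(2,1)]
proof
  fix C
  obtain N where N: "\<forall>m\<ge>N. \<forall>n\<ge>N. C \<le> gp (x 0) (x m) (y n)"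
    using sequences_equivD[OF xy X(1)] by blast
  then have "\<forall>m\<ge>N. \<forall>n\<ge>N. C \<le> gp (x 0) (y m) (x n)" by (simp add: gp_commute[of "x 0" "y _"])
  then show "\<exists>N. \<forall>m\<ge>N. \<forall>n\<ge>N. C \<le> gp (x 0) (y m) (x n)" by blast
qed

lemma sequences_equiv_trans:
  assumes X: "\<And>n. x n \<in> X" "\<And>n. y n \<in> X" "\<And>n. z n \<in> X"
    and xy: "sequences_equiv X d x y" and yz: "sequences_equiv X d y z"
  shows "sequences_equiv X d x z"
proof -
  have b: "x 0 \<in> X" using X by blast
  show ?thesis
    unfolding sequences_equiv_iff[OF b X(1,3)]
  proof
    fix C
    obtain N where N: "\<And>m n. m \<ge> N \<Longrightarrow> n \<ge> N \<Longrightarrow> C + \<delta> \<le> gp (x 0) (x m) (y n)"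
      using sequences_equivD[OF xy b] by meson
    obtain N' where N': "\<And>m n. m \<ge> N' \<Longrightarrow> n \<ge> N' \<Longrightarrow> C + \<delta> \<le> gp (x 0) (y m) (z n)"
      using sequences_equivD[OF yz b] by meson
    have "C \<le> gp (x 0) (x m) (z n)" if "m \<ge> max N N'" "n \<ge> max N N'" for m n
      using gp_four_point[OF b X(1,2,3), of m "max N N'" n] N[of m "max N N'"] N'[of "max N N'" n] that
      by auto
    then show "\<exists>N. \<forall>m\<ge>N. \<forall>n\<ge>N. C \<le> gp (x 0) (x m) (z n)" by blast
  qed
qed

lemma sequences_to_infinity_iff:
  "x \<in> sequences_to_infinity X d \<longleftrightarrow> (\<forall>n. x n \<in> X) \<and> sequences_equiv X d x x"
  by (simp add: sequences_to_infinity_def)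

text \<open>One pair with a large product, chosen beyond the indices where both sequences have
  settled, bounds all later products from below by two uses of the four-point inequality. Products
  of two sequences converging to infinity therefore either tend to infinity or stay bounded far
  out.\<close>

lemma sequences_equiv_if_frequently:
  assumes x: "x \<in> sequences_to_infinity X d" and y: "y \<in> sequences_to_infinity X d" and b: "b \<in> X"
    and freq: "\<And>C N. \<exists>m\<ge>N. \<exists>n\<ge>N. C \<le> gp b (x m) (y n)"
  shows "sequences_equiv X d x y"
proof -
  have X: "\<And>n. x n \<in> X" "\<And>n. y n \<in> X" and xx: "sequences_equiv X d x x" and yy: "sequences_equiv X d y y"
    using x y by (auto simp: sequences_to_infinity_iff)
  show ?thesis
    unfolding sequences_equiv_iff[OF b X]
  proof
    fix C
    obtain N where N: "\<And>m n. m \<ge> N \<Longrightarrow> n \<ge> N \<Longrightarrow> C + 2 * \<delta> \<le> gp b (x m) (x n)"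
      using sequences_equivD[OF xx b] by meson
    obtain N' where N': "\<And>m n. m \<ge> N' \<Longrightarrow> n \<ge> N' \<Longrightarrow> C + 2 * \<delta> \<le> gp b (y m) (y n)"
      using sequences_equivD[OF yy b] by meson
    obtain i j where ij: "i \<ge> max N N'" "j \<ge> max N N'" "C + 2 * \<delta> \<le> gp b (x i) (y j)"
      using freq by meson
    have "C \<le> gp b (x m) (y n)" if "m \<ge> max N N'" "n \<ge> max N N'" for m n
    proof -
      have "min (gp b (x m) (x i)) (gp b (x i) (y j)) - \<delta> \<le> gp b (x m) (y j)"
        "min (gp b (x m) (y j)) (gp b (y j) (y n)) - \<delta> \<le> gp b (x m) (y n)"
        using gp_four_point b X by auto
      moreover have "C + 2 * \<delta> \<le> gp b (x m) (x i)" "C + 2 * \<delta> \<le> gp b (y j) (y n)"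
        using N N' ij that by auto
      ultimately show ?thesis using ij(3) delta_nonneg[OF b] unfolding min_def by argo
    qed
    then show "\<exists>N. \<forall>m\<ge>N. \<forall>n\<ge>N. C \<le> gp b (x m) (y n)" by blast
  qed
qed

lemma not_sequences_equiv_bounded:
  assumes "x \<in> sequences_to_infinity X d" "y \<in> sequences_to_infinity X d" "b \<in> X"
    and "\<not> sequences_equiv X d x y"
  obtains C N where "\<forall>m\<ge>N. \<forall>n\<ge>N. gp b (x m) (y n) \<le> C"
  using sequences_equiv_if_frequently[OF assms(1-3)] assms(4) by (meson linear)

lemma sequences_equiv_bounded_dist:
  assumes x: "x \<in> sequences_to_infinity X d" and y: "\<And>n. y n \<in> X" and D: "\<And>n. d (x n) (y n) \<le> D"
  shows "sequences_equiv X d x y" "y \<in> sequences_to_infinity X d"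
proof -
  have X: "\<And>n. x n \<in> X" and xx: "sequences_equiv X d x x"
    using x by (auto simp: sequences_to_infinity_iff)
  have b: "x 0 \<in> X" using X by blast
  show xy: "sequences_equiv X d x y"
    unfolding sequences_equiv_iff[OF b X y]
  proof
    fix C
    obtain N where N: "\<And>m n. m \<ge> N \<Longrightarrow> n \<ge> N \<Longrightarrow> C + D \<le> gp (x 0) (x m) (x n)"
      using sequences_equivD[OF xx b] by meson
    have "C \<le> gp (x 0) (x m) (y n)" if "m \<ge> N" "n \<ge> N" for m n
      using gp_right_le[OF b X X y, of m n n] N[OF that] D[of n] by linarith
    then show "\<exists>N. \<forall>m\<ge>N. \<forall>n\<ge>N. C \<le> gp (x 0) (x m) (y n)" by blast
  qed
  have "sequences_equiv X d y y"
    using sequences_equiv_trans[OF y X y sequences_equiv_sym[OF X y xy] xy] .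
  then show "y \<in> sequences_to_infinity X d" using y by (simp add: sequences_to_infinity_iff)
qed

text \<open>Both points are rough centers of the triangle with vertices \<open>u\<close>, \<open>v\<close>, \<open>w\<close>, and rough centers
  are unique up to bounded distance.\<close>

lemma dist_le_if_common_center:
  assumes X: "p \<in> X" "b \<in> X" "u \<in> X" "v \<in> X" "w \<in> X"
    and p: "gp p u v \<le> C" "gp p u w \<le> C" "gp p v w \<le> C"
    and b: "gp b u v \<le> C" "gp b u w \<le> C" "gp b v w \<le> C"
  shows "d p b \<le> 8 * C + 2 * \<delta>"
proof -
  note nn = gp_nonneg[OF X(1,3,4)] gp_nonneg[OF X(1,3,5)] gp_nonneg[OF X(1,4,5)]
    gp_nonneg[OF X(2,3,4)] gp_nonneg[OF X(2,3,5)] gp_nonneg[OF X(2,4,5)]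
  \<comment> \<open>For every \<open>x\<close>,
    \<open>d x u = gp x u v + gp x u w - gp x v w + gp u v w\<close>. The last term does not depend
    on \<open>x\<close>, and for \<open>p\<close> and \<open>b\<close> the others lie between 0 and
    \<open>C\<close>. The same holds with \<open>u\<close> and \<open>v\<close> exchanged.\<close>
  have "d b u \<le> d p u + 3 * C" "d b v \<le> d p v + 3 * C" "d p u + d p v \<le> d u v + 2 * C"
    using nn p b unfolding gromov_product_def commute[of _ p] commute[of _ b] by auto
  moreover   have "d p b + d u v \<le> max (d p u + d b v) (d u b + d p v) + 2 * \<delta>"
    by (rule four_point) (use X in auto)
  ultimately show ?thesis using p(1) nn(1) commute[of u b] by linarith
qed

end

section \<open>Subadditive sequences\<close>

lemma subadditive_mult_le:
  fixes a :: "nat \<Rightarrow> real"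
  assumes sub: "\<And>m n. a (m + n) \<le> a m + a n" and "a 0 = 0"
  shows "a (k * n) \<le> real k * a n"
proof (induction k)
  case (Suc k)
  then show ?case using sub[of n "k * n"] by (simp add: distrib_right)
qed (simp add: assms)

text \<open>Fekete's lemma, with the limit presented through its error term.\<close>

lemma subadditive_rate:
  fixes a :: "nat \<Rightarrow> real"
  assumes sub: "\<And>m n. a (m + n) \<le> a m + a n" and a0: "a 0 = 0"
    and lin: "\<And>n. c * real n - C \<le> a n"
  obtains \<tau> where "c \<le> \<tau>" "\<And>n. \<tau> * real n \<le> a n"
    "\<And>e. 0 < e \<Longrightarrow> \<exists>K. \<forall>n. a n \<le> (\<tau> + e) * real n + K"
proof -
  note mult = subadditive_mult_le[of a, OF sub a0]
  \<comment> \<open>Along the multiples \<open>k * n\<close> the constant \<open>C\<close> is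
    divided by \<open>k\<close> and disappears.\<close>
  have ge: "c \<le> a n / real n" if "n \<ge> 1" for n
  proof (rule field_le_epsilon)
    fix e :: real assume e: "0 < e"
    obtain k :: nat where k: "C / (e * real n) < real k" using reals_Archimedean2 by blast
    have "C < e * real n * real k" using k e that by (simp add: divide_less_eq mult.commute)
    moreover have "c * real (Suc k * n) - C \<le> real (Suc k) * a n"
      using lin[of "Suc k * n"] mult[of "Suc k" n] by linarith
    moreover have "e * real n * real k \<le> e * real n * real (Suc k)" using e by (intro mult_left_mono) auto
    ultimately have "real (Suc k) * (c * real n) \<le> real (Suc k) * (a n + e * real n)"
      by (simp add: algebra_simps)
    then have "c * real n \<le> a n + e * real n" by (rule mult_left_le_imp_le) simp
    then show "c \<le> a n / real n + e" using that by (simp add: field_simps)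
  qed
  define \<tau> where "\<tau> = (INF n\<in>{1..}. a n / real n)"
  have bdd: "bdd_below ((\<lambda>n. a n / real n) ` {1..})" using ge by (intro bdd_belowI2) auto
  have le: "\<tau> * real n \<le> a n" for n
  proof (cases "n = 0")
    case False
    then have "\<tau> \<le> a n / real n" unfolding \<tau>_def using bdd by (intro cINF_lower) auto
    then show ?thesis using False by (simp add: field_simps)
  qed (simp add: a0)
  have "\<exists>K. \<forall>n. a n \<le> (\<tau> + e) * real n + K" if e: "0 < e" for e
  proof -
    have "\<exists>p\<in>{1..}. a p / real p < \<tau> + e"
      using e bdd by (subst cINF_less_iff[symmetric]) (auto simp: \<tau>_def)
    then obtain p where p: "p \<ge> 1" "a p / real p < \<tau> + e" by auto
    have ap: "a p \<le> (\<tau> + e) * real p" using p by (simp add: divide_less_eq less_imp_le)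
    \<comment> \<open>Division with remainder by \<open>p\<close> leaves finitely many residues. The
      absolute value is needed because \<open>c\<close>, and with it \<open>\<tau> + e\<close>, may
      be negative.\<close>
    define K where "K = Max (a ` {..<p}) + \<bar>\<tau> + e\<bar> * real p"
    have "a n \<le> (\<tau> + e) * real n + K" for n
    proof -
      have "a n \<le> a (n div p * p) + a (n mod p)" using sub[of "n div p * p" "n mod p"] by simp
      also have "a (n div p * p) \<le> real (n div p) * a p" by (rule mult)
      also have "real (n div p) * a p \<le> real (n div p) * ((\<tau> + e) * real p)"
        using ap by (intro mult_left_mono) auto
      also have "\<dots> = (\<tau> + e) * real (n div p * p)" by simp
      also have "\<dots> = (\<tau> + e) * real n - (\<tau> + e) * real (n mod p)"
        by (simp flip: right_diff_distrib of_nat_diff add: minus_mod_eq_div_mult)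
      also have "\<dots> \<le> (\<tau> + e) * real n + \<bar>\<tau> + e\<bar> * real (n mod p)"
        using abs_ge_minus_self[of "(\<tau> + e) * real (n mod p)"] by (simp add: abs_mult)
      also have "\<bar>\<tau> + e\<bar> * real (n mod p) \<le> \<bar>\<tau> + e\<bar> * real p"
        using p by (intro mult_left_mono) (auto simp: less_imp_le)
      also have "a (n mod p) \<le> Max (a ` {..<p})" using p by (intro Max_ge) auto
      finally show ?thesis by (simp add: K_def)
    qed
    then show ?thesis by blast
  qed
  moreover have "c \<le> \<tau>" unfolding \<tau>_def using ge by (intro cINF_greatest) auto
  ultimately show thesis using that le by blast
qed

text \<open>A value of the error term \<open>e\<close> above the threshold would double along a sequence of indices that
  at most doubles in each step, contradicting that \<open>e\<close> grows sublinearly.\<close>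

lemma four_point_rate:
  fixes a :: "nat \<Rightarrow> real"
  assumes sub: "\<And>m n. a (m + n) \<le> a m + a n" and a0: "a 0 = 0"
    and lin: "\<And>n. c * real n - C \<le> a n" and c: "0 < c"
    and four: "\<And>m k. k \<le> m \<Longrightarrow> 2 * a m \<le> max (2 * a (m - k)) (a (2 * m - k) + a k) + 2 * \<delta>"
  obtains \<tau> B where "0 < \<tau>" "\<And>n. \<bar>a n - \<tau> * real n\<bar> \<le> B"
proof -
  obtain \<tau> where \<tau>: "c \<le> \<tau>" and le: "\<And>n. \<tau> * real n \<le> a n"
    and rate: "\<And>e. 0 < e \<Longrightarrow> \<exists>K. \<forall>n. a n \<le> (\<tau> + e) * real n + K"
    using subadditive_rate[of a c C, OF sub a0 lin] by blast
  have \<tau>0: "0 < \<tau>" using \<tau> c by simp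
  define e where "e n = a n - \<tau> * real n" for n
  have e0: "0 \<le> e n" for n using le by (simp add: e_def)
  \<comment> \<open>With \<open>\<tau> * k > \<delta>\<close>, going back by \<open>k\<close> lowers
    the linear part by more than the defect, so the first alternative of \<open>four\<close> says
    that \<open>e\<close> is no smaller at \<open>m - k\<close>.\<close>
  obtain k :: nat where k: "\<bar>\<delta>\<bar> / \<tau> < real k" using reals_Archimedean2 by blast
  then have "\<bar>\<delta>\<bar> < \<tau> * real k" using \<tau>0 by (simp add: divide_less_eq mult.commute)
  then have k\<tau>: "\<delta> < \<tau> * real k" and k0: "k \<noteq> 0" by (auto intro!: gr0I)
  \<comment> \<open>The first entry absorbs the summand \<open>a k\<close> and the defect in the
    second alternative of \<open>four\<close>; the second ensures that values above \<open>B\<close>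
    occur only at indices beyond \<open>k\<close>, where \<open>step\<close> applies.\<close>
  define B where "B = max (e k + 2 * \<delta>) (Max (e ` {..k}))"
  have Bk: "e n \<le> B" if "n \<le> k" for n
    unfolding B_def using that by (intro max.coboundedI2 Max_ge) auto
  have step: "e m \<le> e (m - k) \<or> 2 * (e m - B) \<le> e (2 * m - k) - B" if "k \<le> m" for m
  proof -
    have r: "real (m - k) = real m - real k" "real (2 * m - k) = 2 * real m - real k"
      using that by (auto simp: of_nat_diff)
    have "2 * a m \<le> 2 * a (m - k) + 2 * \<delta> \<or> 2 * a m \<le> a (2 * m - k) + a k + 2 * \<delta>"
      using four[OF that] by (auto simp: max_def split: if_splits)
    then show ?thesis
    proof
      assume "2 * a m \<le> 2 * a (m - k) + 2 * \<delta>"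
      then have "e m \<le> e (m - k)" using k\<tau> by (simp add: e_def r algebra_simps)
      then show ?thesis ..
    next
      assume "2 * a m \<le> a (2 * m - k) + a k + 2 * \<delta>"
      then have "2 * e m \<le> e (2 * m - k) + (e k + 2 * \<delta>)"
        unfolding e_def r by (simp add: algebra_simps)
      moreover have "e k + 2 * \<delta> \<le> B" by (simp add: B_def)
      ultimately have "2 * (e m - B) \<le> e (2 * m - k) - B" by argo
      then show ?thesis ..
    qed
  qed
  \<comment> \<open>Backward steps of length \<open>k\<close> keep \<open>e\<close> above the
    threshold but can never reach an index at most \<open>k\<close>, so the doubling alternative
    must occur.\<close>
  have double: "\<exists>m' \<le> 2 * m. 2 * (e m - B) \<le> e m' - B" if "B < e m" for m
    using that
  proof (induction m rule: less_induct)
    case (less m)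
    have m: "k < m" using less.prems Bk[of m] by (meson leI not_le)
    show ?case
    proof -
      have "e m \<le> e (m - k) \<or> 2 * (e m - B) \<le> e (2 * m - k) - B" using step m by simp
      then show ?thesis
      proof
        assume em: "e m \<le> e (m - k)"
        then obtain m' where m': "m' \<le> 2 * (m - k)" "2 * (e (m - k) - B) \<le> e m' - B"
          using less.IH[of "m - k"] less.prems k0 m by auto
        have "m' \<le> 2 * m" "2 * (e m - B) \<le> e m' - B" using m' em by auto
        then show ?thesis by blast
      next
        assume "2 * (e m - B) \<le> e (2 * m - k) - B"
        then show ?thesis by (intro exI[of _ "2 * m - k"]) auto
      qed
    qed
  qed
  have "e m \<le> B" for m
  proof (rule ccontr)
    assume "\<not> e m \<le> B"
    then have m: "B < e m" by simp
    define f where "f = e m - B"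
    have f: "0 < f" using m by (simp add: f_def)
    have grow: "\<exists>m' \<le> 2 ^ j * m. 2 ^ j * f \<le> e m' - B" for j
    proof (induction j)
      case 0
      show ?case by (intro exI[of _ m]) (simp add: f_def)
    next
      case (Suc j)
      then obtain m' where m': "m' \<le> 2 ^ j * m" "2 ^ j * f \<le> e m' - B" by blast
      have "0 < 2 ^ j * f" using f by simp
      then have "B < e m'" using m' by linarith
      then obtain m'' where m'': "m'' \<le> 2 * m'" "2 * (e m' - B) \<le> e m'' - B" using double by blast
      have "2 ^ Suc j * f \<le> e m'' - B" using m' m'' by simp
      moreover have "m'' \<le> 2 ^ Suc j * m" using m' m'' by simp
      ultimately show ?case by blast
    qed
    \<comment> \<open>Chosen so that the sublinear bound at indices up to \<open>2 ^ j * m\<close>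
      is at most half of the forced value \<open>2 ^ j * f\<close>, up to a constant.\<close>
    define \<eta> where "\<eta> = f / (2 * (real m + 1))"
    have \<eta>: "0 < \<eta>" "\<eta> * real m \<le> f / 2" using f by (auto simp: \<eta>_def field_simps)
    obtain K where K: "\<And>n. a n \<le> (\<tau> + \<eta>) * real n + K" using rate[OF \<eta>(1)] by blast
    obtain j where j: "2 * (K - B) / f < 2 ^ j" using real_arch_pow[of 2] by auto
    obtain m' where m': "m' \<le> 2 ^ j * m" "2 ^ j * f \<le> e m' - B" using grow by blast
    have "e m' \<le> \<eta> * real m' + K" using K[of m'] by (simp add: e_def algebra_simps)
    also have "\<eta> * real m' \<le> \<eta> * real (2 ^ j * m)" using m'(1) \<eta>(1) by (intro mult_left_mono of_nat_mono) auto
    also have "\<dots> = 2 ^ j * (\<eta> * real m)" by simp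
    also have "\<dots> \<le> 2 ^ j * (f / 2)" using \<eta>(2) by (intro mult_left_mono) auto
    finally have "2 ^ j * f / 2 \<le> K - B" using m'(2) by simp
    moreover have "2 * (K - B) < 2 ^ j * f" using j f by (simp add: divide_less_eq)
    ultimately show False by simp
  qed
  then have "\<bar>a n - \<tau> * real n\<bar> \<le> B" for n using e0[of n] by (simp add: e_def)
  then show thesis using that \<tau>0 by blast
qed

section \<open>Rough axes of loxodromic isometries\<close>

locale isometric_four_point_action = four_point_space X d \<delta> + group G
  for X :: "'x set" and d \<delta> and G (structure) +
  fixes \<phi> :: "'a \<Rightarrow> 'x \<Rightarrow> 'x"
  assumes act_closed: "\<lbrakk>g \<in> carrier G; x \<in> X\<rbrakk> \<Longrightarrow> \<phi> g x \<in> X"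
    and act_mult: "\<lbrakk>g \<in> carrier G; h \<in> carrier G; x \<in> X\<rbrakk> \<Longrightarrow> \<phi> (g \<otimes> h) x = \<phi> g (\<phi> h x)"
    and act_one: "x \<in> X \<Longrightarrow> \<phi> \<one> x = x"
    and act_dist: "\<lbrakk>g \<in> carrier G; x \<in> X; y \<in> X\<rbrakk> \<Longrightarrow> d (\<phi> g x) (\<phi> g y) = d x y"
begin

lemma act_inv_cancel: "\<lbrakk>g \<in> carrier G; x \<in> X\<rbrakk> \<Longrightarrow> \<phi> (inv g) (\<phi> g x) = x"
  using act_mult[of "inv g" g x] by (simp add: act_one)

lemma act_cancel_inv: "\<lbrakk>g \<in> carrier G; x \<in> X\<rbrakk> \<Longrightarrow> \<phi> g (\<phi> (inv g) x) = x"
  using act_mult[of g "inv g" x] by (simp add: act_one)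

lemma gp_act:
  "\<lbrakk>h \<in> carrier G; b \<in> X; x \<in> X; y \<in> X\<rbrakk> \<Longrightarrow> gp (\<phi> h b) (\<phi> h x) (\<phi> h y) = gp b x y"
  by (simp add: gromov_product_def act_dist)

lemma sequences_equiv_act:
  assumes h: "h \<in> carrier G" and X: "\<And>n. x n \<in> X" "\<And>n. y n \<in> X" and xy: "sequences_equiv X d x y"
  shows "sequences_equiv X d (\<lambda>n. \<phi> h (x n)) (\<lambda>n. \<phi> h (y n))"
proof -
  have b: "\<phi> h (x 0) \<in> X" using h X act_closed by blast
  show ?thesis
    unfolding sequences_equiv_iff[OF b act_closed[OF h X(1)] act_closed[OF h X(2)]]
      gp_act[OF h X(1)[of 0] X]
    using sequences_equivD[OF xy X(1)[of 0]] by blast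
qed

lemma sequences_equiv_act_iff:
  assumes h: "h \<in> carrier G" and X: "\<And>n. x n \<in> X" "\<And>n. y n \<in> X"
  shows "sequences_equiv X d (\<lambda>n. \<phi> h (x n)) (\<lambda>n. \<phi> h (y n)) \<longleftrightarrow> sequences_equiv X d x y"
  using sequences_equiv_act[of "inv h" "\<lambda>n. \<phi> h (x n)" "\<lambda>n. \<phi> h (y n)"] sequences_equiv_act[OF h X] h X
  by (auto simp: act_closed act_inv_cancel)

lemma sequences_to_infinity_act:
  assumes "h \<in> carrier G" "x \<in> sequences_to_infinity X d"
  shows "(\<lambda>n. \<phi> h (x n)) \<in> sequences_to_infinity X d"
  using assms by (auto simp: sequences_to_infinity_iff act_closed intro: sequences_equiv_act)

lemma dist_int_pow:
  assumes g: "g \<in> carrier G" and x: "x \<in> X"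
  shows "d (\<phi> (g [^] (m::int)) x) (\<phi> (g [^] (n::int)) x) = d x (\<phi> (g [^] nat \<bar>m - n\<bar>) x)"
proof -
  have *: "d (\<phi> (g [^] m) x) (\<phi> (g [^] n) x) = d x (\<phi> (g [^] (n - m)) x)" for m n :: int
  proof -
    have "g [^] n = g [^] m \<otimes> g [^] (n - m)" using g by (simp flip: int_pow_mult)
    then show ?thesis using g x by (simp add: act_mult act_dist act_closed)
  qed
  show ?thesis
  proof (cases "m \<le> n")
    case True
    then have "g [^] (n - m) = g [^] nat \<bar>m - n\<bar>" by (simp flip: int_pow_int)
    then show ?thesis using *[of m n] by simp
  next
    case False
    then have "g [^] (m - n) = g [^] nat \<bar>m - n\<bar>" by (simp flip: int_pow_int)
    then show ?thesis using *[of n m] by (simp add: commute)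
  qed
qed

end

locale rough_axis = isometric_four_point_action X d \<delta> G \<phi>
  for X :: "'x set" and d \<delta> and G (structure) and \<phi> +
  fixes g x\<^sub>0 \<tau> B
  assumes g: "g \<in> carrier G" and x\<^sub>0: "x\<^sub>0 \<in> X" and \<tau>: "0 < \<tau>"
    and rough: "\<bar>d (\<phi> (g [^] (m::int)) x\<^sub>0) (\<phi> (g [^] (n::int)) x\<^sub>0) - \<tau> * \<bar>real_of_int (m - n)\<bar>\<bar> \<le> B"

context isometric_four_point_action
begin

lemma rough_axis_if_quasi_isometric:
  assumes g: "g \<in> carrier G" and x: "x \<in> X"
    and qi: "quasi_isometric_embedding (UNIV :: int set) dist X d (\<lambda>n. \<phi> (g [^] n) x)"
  obtains \<tau> B where "rough_axis X d \<delta> G \<phi> g x \<tau> B"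
proof -
  define a where "a n = d x (\<phi> (g [^] n) x)" for n :: nat
  have dist_a: "d (\<phi> (g [^] (m::int)) x) (\<phi> (g [^] (n::int)) x) = a (nat \<bar>m - n\<bar>)" for m n
    by (simp add: a_def dist_int_pow g x)
  define u where "u n = \<phi> (g [^] int n) x" for n
  have uX: "u n \<in> X" for n using g x by (simp add: u_def act_closed)
  have du: "d (u m) (u n) = a (n - m)" "d (u n) (u m) = a (n - m)" if "m \<le> n" for m n
    using dist_a[of "int m" "int n"] dist_a[of "int n" "int m"] that
    by (simp_all add: u_def nat_diff_distrib flip: of_nat_diff)
  obtain K C where K: "1 \<le> K" and C: "\<And>m n. dist m n / K - C \<le> d (\<phi> (g [^] (m::int)) x) (\<phi> (g [^] (n::int)) x)"
    using qi unfolding quasi_isometric_embedding_def by blast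
  have lin: "1 / K * real n - C \<le> a n" for n
    using C[of 0 "int n"] dist_a[of 0 "int n"] by simp
  have K0: "0 < 1 / K" using K by simp
  have sub: "a (m + n) \<le> a m + a n" for m n
    using triangle[OF uX[of 0] uX[of m] uX[of "m + n"]] by (simp add: du)
  have a0: "a 0 = 0" using x by (simp add: a_def act_one)
  \<comment> \<open>The indices 0, \<open>m - k\<close>, \<open>m\<close>, \<open>2 * m - k\<close>
    make both pairs on the left of the four-point inequality differ by exactly
    \<open>m\<close>.\<close>
  have four: "2 * a m \<le> max (2 * a (m - k)) (a (2 * m - k) + a k) + 2 * \<delta>" if "k \<le> m" for m k
  proof -
    have "d (u 0) (u m) = a m" "d (u (m - k)) (u (2 * m - k)) = a m" "d (u 0) (u (m - k)) = a (m - k)"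
      "d (u m) (u (2 * m - k)) = a (m - k)" "d (u (m - k)) (u m) = a k" "d (u 0) (u (2 * m - k)) = a (2 * m - k)"
      using that by (simp_all add: du)
    then show ?thesis
      using four_point[OF uX[of 0] uX[of "m - k"] uX[of m] uX[of "2 * m - k"]] unfolding max_def by argo
  qed
  obtain \<tau> B where \<tau>: "0 < \<tau>" "\<And>n. \<bar>a n - \<tau> * real n\<bar> \<le> B"
    using four_point_rate[OF sub a0 lin K0 four] by blast
  have "\<bar>d (\<phi> (g [^] (m::int)) x) (\<phi> (g [^] (n::int)) x) - \<tau> * \<bar>real_of_int (m - n)\<bar>\<bar> \<le> B" for m n
    using \<tau>(2)[of "nat \<bar>m - n\<bar>"] by (simp add: dist_a)
  then have "rough_axis X d \<delta> G \<phi> g x \<tau> B" using g x \<tau>(1) by unfold_locales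
  then show thesis by (rule that)
qed

end

context rough_axis
begin

definition orb :: "int \<Rightarrow> 'x" where "orb k = \<phi> (g [^] k) x\<^sub>0"

definition ray :: "int \<Rightarrow> nat \<Rightarrow> 'x" where "ray \<sigma> n = orb (\<sigma> * int n)"

lemma orb_in: "orb k \<in> X"
  using g x\<^sub>0 by (simp add: orb_def act_closed)

lemma ray_in: "ray \<sigma> n \<in> X"
  by (simp add: ray_def orb_in)

lemma orb_0: "orb 0 = x\<^sub>0"
  using x\<^sub>0 by (simp add: orb_def act_one)

lemma act_orb: "\<phi> (g [^] m) (orb n) = orb (m + n)"
  using g x\<^sub>0 by (simp add: orb_def int_pow_mult act_mult)

lemma orb_dist: "\<bar>d (orb m) (orb n) - \<tau> * \<bar>real_of_int (m - n)\<bar>\<bar> \<le> B"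
  using rough by (simp add: orb_def)

lemma orb_dist_bounds:
  "\<tau> * \<bar>real_of_int (m - n)\<bar> - B \<le> d (orb m) (orb n)"
  "d (orb m) (orb n) \<le> \<tau> * \<bar>real_of_int (m - n)\<bar> + B"
  using orb_dist[of m n] by linarith+

lemma B_nonneg: "0 \<le> B"
  using orb_dist[of 0 0] by linarith

lemma ray_to_infinity:
  assumes "\<sigma> \<in> {1, -1}"
  shows "ray \<sigma> \<in> sequences_to_infinity X d"
  unfolding sequences_to_infinity_iff sequences_equiv_iff[OF x\<^sub>0 ray_in ray_in]
proof (intro conjI allI)
  fix C
  obtain N :: nat where N: "(C + 2 * B) / \<tau> < real N" using reals_Archimedean2 by blast
  have NC: "C + 2 * B < \<tau> * real N" using N \<tau> by (simp add: divide_less_eq mult.commute)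
  have "C \<le> gp x\<^sub>0 (ray \<sigma> m) (ray \<sigma> n)" if "m \<ge> N" "n \<ge> N" for m n
  proof -
    have s: "\<bar>\<sigma> * int m\<bar> = int m" "\<bar>\<sigma> * int n\<bar> = int n" "\<bar>\<sigma> * int m - \<sigma> * int n\<bar> = \<bar>int m - int n\<bar>"
      using assms by auto
    have "\<tau> * real m - B \<le> d (ray \<sigma> m) x\<^sub>0" "\<tau> * real n - B \<le> d (ray \<sigma> n) x\<^sub>0"
      "d (ray \<sigma> m) (ray \<sigma> n) \<le> \<tau> * \<bar>real m - real n\<bar> + B"
      using orb_dist_bounds(1)[of "\<sigma> * int m" 0] orb_dist_bounds(1)[of "\<sigma> * int n" 0]
        orb_dist_bounds(2)[of "\<sigma> * int m" "\<sigma> * int n"] s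
      unfolding ray_def orb_0 of_int_abs[symmetric] by simp_all
    moreover have "\<tau> * \<bar>real m - real n\<bar> = \<tau> * real m + \<tau> * real n - 2 * (\<tau> * real (min m n))"
      by (auto simp: min_def abs_if algebra_simps)
    moreover have "\<tau> * real N \<le> \<tau> * real (min m n)" using that \<tau> by (intro mult_left_mono) auto
    ultimately have "2 * C \<le> d (ray \<sigma> m) x\<^sub>0 + d (ray \<sigma> n) x\<^sub>0 - d (ray \<sigma> m) (ray \<sigma> n)"
      using NC B_nonneg by linarith
    then show ?thesis by (simp add: gromov_product_def)
  qed
  then show "\<exists>N. \<forall>m\<ge>N. \<forall>n\<ge>N. C \<le> gp x\<^sub>0 (ray \<sigma> m) (ray \<sigma> n)" by blast
qed (rule ray_in)

lemma gp_opposite_rays: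
  assumes "\<sigma> \<in> {1, -1}"
  shows "gp x\<^sub>0 (ray \<sigma> m) (ray (- \<sigma>) n) \<le> 2 * B"
proof -
  have "d (ray \<sigma> m) x\<^sub>0 \<le> \<tau> * real m + B" "d (ray (- \<sigma>) n) x\<^sub>0 \<le> \<tau> * real n + B"
    "\<tau> * (real m + real n) - B \<le> d (ray \<sigma> m) (ray (- \<sigma>) n)"
    using assms orb_dist_bounds(2)[of "\<sigma> * int m" 0] orb_dist_bounds(2)[of "- \<sigma> * int n" 0]
      orb_dist_bounds(1)[of "\<sigma> * int m" "- \<sigma> * int n"]
    unfolding ray_def orb_0 by (auto simp: add.commute)
  then have "d (ray \<sigma> m) x\<^sub>0 + d (ray (- \<sigma>) n) x\<^sub>0 - d (ray \<sigma> m) (ray (- \<sigma>) n) \<le> 4 * B"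
    using B_nonneg by (simp add: distrib_left)
  then show ?thesis by (simp add: gromov_product_def)
qed

lemma opposite_rays_not_equiv:
  assumes "\<sigma> \<in> {1, -1}"
  shows "\<not> sequences_equiv X d (ray \<sigma>) (ray (- \<sigma>))"
proof
  assume "sequences_equiv X d (ray \<sigma>) (ray (- \<sigma>))"
  then obtain N where "\<forall>m\<ge>N. \<forall>n\<ge>N. 2 * B + 1 \<le> gp x\<^sub>0 (ray \<sigma> m) (ray (- \<sigma>) n)"
    using sequences_equivD x\<^sub>0 by blast
  then have "2 * B + 1 \<le> gp x\<^sub>0 (ray \<sigma> N) (ray (- \<sigma>) N)" by blast
  then show False using gp_opposite_rays[OF assms, of N N] by linarith
qed

text \<open>A small product means that \<open>b\<close> lies almost between the two orbit points.
  The orbit point at the matching distance from one of them then lies in the same place, by the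
  four-point inequality.\<close>

lemma near_axis:
  assumes b: "b \<in> X" and C: "gp b (orb (- int n)) (orb (int n)) \<le> C"
  shows "\<exists>j. d b (orb j) \<le> 3 * B + \<tau> + 2 * C + 2 * \<delta>"
proof -
  let ?u = "orb (- int n)" and ?v = "orb (int n)"
  have C0: "0 \<le> C" using gp_nonneg[OF b orb_in orb_in, of "- int n" "int n"] C by linarith
  have uv: "d b ?u + d b ?v \<le> d ?u ?v + 2 * C"
    using C unfolding gromov_product_def by (simp add: commute)
  have L: "d ?u ?v \<le> \<tau> * (2 * real n) + B" using orb_dist_bounds(2)[of "- int n" "int n"] by simp
  \<comment> \<open>The number of steps from \<open>?u\<close> that covers \<open>d b ?u\<close> at
    speed \<open>\<tau>\<close>, clipped at \<open>2 * n\<close> because \<open>b\<close> may lie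
    slightly beyond \<open>?v\<close>.\<close>
  define i where "i = min (2 * n) (nat \<lfloor>d b ?u / \<tau>\<rfloor>)"
  have fl: "real (nat \<lfloor>d b ?u / \<tau>\<rfloor>) \<le> d b ?u / \<tau>" "d b ?u / \<tau> < real (nat \<lfloor>d b ?u / \<tau>\<rfloor>) + 1"
    using \<tau> by (simp_all add: floor_correct)
  have i1: "\<tau> * real i \<le> d b ?u"
  proof -
    have "real i \<le> d b ?u / \<tau>" using fl(1) by (auto simp: i_def)
    then show ?thesis using \<tau> by (simp add: pos_le_divide_eq mult.commute)
  qed
  have i2: "d b ?u \<le> \<tau> * real i + \<tau> + B + 2 * C"
  proof (cases "nat \<lfloor>d b ?u / \<tau>\<rfloor> \<le> 2 * n")
    case True
    then have "d b ?u / \<tau> < real i + 1" using fl(2) by (simp add: i_def)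
    then have "d b ?u < \<tau> * real i + \<tau>" using \<tau> by (simp add: pos_divide_less_eq algebra_simps)
    then show ?thesis using C0 B_nonneg by linarith
  next
    case False
    then have "real i = 2 * real n" by (simp add: i_def)
    then have "\<tau> * real i = \<tau> * (2 * real n)" by simp
    then show ?thesis using uv L \<tau> nonneg[of b ?v] by linarith
  qed
  define w where "w = orb (int i - int n)"
  have iw: "real i \<le> 2 * real n" using of_nat_mono[of i "2 * n"] by (simp add: i_def)
  have w1: "d w ?u \<le> \<tau> * real i + B"
    using orb_dist_bounds(2)[of "int i - int n" "- int n"] by (simp add: w_def)
  have w2: "d w ?v \<le> \<tau> * (2 * real n) - \<tau> * real i + B"
    using orb_dist_bounds(2)[of "int i - int n" "int n"] iw by (simp add: w_def algebra_simps)
  have L': "\<tau> * (2 * real n) \<le> d ?u ?v + B" using orb_dist_bounds(1)[of "- int n" "int n"] by simp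
  have "d b w + d ?u ?v \<le> max (d b ?u + d w ?v) (d ?u w + d b ?v) + 2 * \<delta>"
    by (rule four_point) (auto simp: b orb_in w_def)
  moreover have "d b ?u + d w ?v \<le> d ?u ?v + (3 * B + \<tau> + 2 * C)" using i2 w2 L' by linarith
  moreover have "d ?u w + d b ?v \<le> d ?u ?v + (3 * B + \<tau> + 2 * C)"
    using i1 w1 uv \<tau> B_nonneg commute[of w ?u] by linarith
  ultimately have "d b w \<le> 3 * B + \<tau> + 2 * C + 2 * \<delta>" by (auto simp: max_def split: if_splits)
  then show ?thesis unfolding w_def by blast
qed

definition ends_preserved :: bool where
  "ends_preserved \<longleftrightarrow>
    (\<forall>h\<in>carrier G. \<forall>\<sigma>\<in>{1, -1}. \<exists>\<rho>\<in>{1, -1}. sequences_equiv X d (\<lambda>n. \<phi> h (ray \<sigma> n)) (ray \<rho>))"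

text \<open>The bound is uniform in \<open>h\<close> because the base point moves along: seen from
  \<open>\<phi> h x\<^sub>0\<close>, the translated rays have product at most \<open>2 * B\<close>.
  Far out they can be replaced by rays of the original axis at the cost of \<open>\<delta>\<close>
  each.\<close>

lemma orbit_near_axis:
  assumes ends_preserved
  obtains D where "\<And>h. h \<in> carrier G \<Longrightarrow> \<exists>j. d (\<phi> h x\<^sub>0) (orb j) \<le> D"
proof -
  let ?C = "2 * B + 2 * \<delta>"
  have "\<exists>j. d (\<phi> h x\<^sub>0) (orb j) \<le> 3 * B + \<tau> + 2 * ?C + 2 * \<delta>" if h: "h \<in> carrier G" for h
  proof -
    have hX: "\<phi> h (ray \<sigma> n) \<in> X" for \<sigma> n using h act_closed ray_in by blast
    obtain \<rho> where \<rho>: "\<rho> \<in> {1, -1}" "sequences_equiv X d (\<lambda>n. \<phi> h (ray 1 n)) (ray \<rho>)"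
      using assms h unfolding ends_preserved_def by blast
    obtain \<rho>' where \<rho>': "\<rho>' \<in> {1, -1}" "sequences_equiv X d (\<lambda>n. \<phi> h (ray (-1) n)) (ray \<rho>')"
      using assms h unfolding ends_preserved_def by blast
    have "\<rho>' \<noteq> \<rho>"
    proof
      assume "\<rho>' = \<rho>"
      then have "sequences_equiv X d (\<lambda>n. \<phi> h (ray 1 n)) (\<lambda>n. \<phi> h (ray (-1) n))"
        using sequences_equiv_trans[OF hX ray_in hX \<rho>(2)] sequences_equiv_sym[OF hX ray_in \<rho>'(2)] by simp
      then show False
        using opposite_rays_not_equiv[of 1] sequences_equiv_act_iff[OF h ray_in ray_in] by simp
    qed
    then have \<rho>'_eq: "\<rho>' = - \<rho>" using \<rho> \<rho>' by auto
    let ?b = "\<phi> h x\<^sub>0"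
    have b: "?b \<in> X" using h x\<^sub>0 act_closed by blast
    obtain N where N: "\<And>m n. m \<ge> N \<Longrightarrow> n \<ge> N \<Longrightarrow> ?C + 1 \<le> gp ?b (\<phi> h (ray 1 m)) (ray \<rho> n)"
      using sequences_equivD[OF \<rho>(2) b] by meson
    obtain N' where N': "\<And>m n. m \<ge> N' \<Longrightarrow> n \<ge> N' \<Longrightarrow> ?C + 1 \<le> gp ?b (\<phi> h (ray (-1) m)) (ray \<rho>' n)"
      using sequences_equivD[OF \<rho>'(2) b] by meson
    define n where "n = max N N'"
    let ?y = "\<phi> h (ray 1 n)" and ?y' = "\<phi> h (ray (-1) n)"
    have "gp ?b ?y ?y' \<le> 2 * B"
      using gp_opposite_rays[of 1 n n] by (simp add: gp_act h x\<^sub>0 ray_in)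
    moreover have "?C + 1 \<le> gp ?b ?y (ray \<rho> n)" "?C + 1 \<le> gp ?b (ray \<rho>' n) ?y'"
      using N[of n n] N'[of n n] gp_commute[of ?b ?y'] by (simp_all add: n_def)
    moreover have "min (gp ?b ?y (ray \<rho> n)) (gp ?b (ray \<rho> n) ?y') - \<delta> \<le> gp ?b ?y ?y'"
      "min (gp ?b (ray \<rho> n) (ray \<rho>' n)) (gp ?b (ray \<rho>' n) ?y') - \<delta> \<le> gp ?b (ray \<rho> n) ?y'"
      using gp_four_point b hX ray_in by auto
    ultimately have "gp ?b (ray \<rho> n) (ray \<rho>' n) \<le> ?C"
      using delta_nonneg[OF b] unfolding min_def by argo
    then have "gp ?b (orb (- int n)) (orb (int n)) \<le> ?C"
      using \<rho>(1) by (auto simp: \<rho>'_eq ray_def gp_commute)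
    then show ?thesis by (rule near_axis[OF b])
  qed
  then show thesis using that by blast
qed

end

section \<open>Limit points\<close>

context four_point_space
begin

definition boundary_rel :: "((nat \<Rightarrow> 'x) \<times> (nat \<Rightarrow> 'x)) set" where
  "boundary_rel = {(x, y). x \<in> sequences_to_infinity X d \<and> y \<in> sequences_to_infinity X d \<and>
     sequences_equiv X d x y}"

lemma gromov_boundary_quotient: "gromov_boundary X d = sequences_to_infinity X d // boundary_rel"
  by (simp add: gromov_boundary_def boundary_rel_def)

lemma equiv_boundary_rel: "equiv (sequences_to_infinity X d) boundary_rel"
proof (rule equivI)
  show "boundary_rel \<subseteq> sequences_to_infinity X d \<times> sequences_to_infinity X d"
    by (auto simp: boundary_rel_def)
  show "refl_on (sequences_to_infinity X d) boundary_rel"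
    by (auto simp: refl_on_def boundary_rel_def sequences_to_infinity_iff)
  show "sym boundary_rel"
    by (auto simp: sym_def boundary_rel_def sequences_to_infinity_iff intro: sequences_equiv_sym)
  show "trans boundary_rel"
  proof (rule transI)
    fix x y z assume xy: "(x, y) \<in> boundary_rel" and yz: "(y, z) \<in> boundary_rel"
    then have "sequences_equiv X d x z"
      using sequences_equiv_trans[of x y z] unfolding boundary_rel_def sequences_to_infinity_iff by simp
    then show "(x, z) \<in> boundary_rel" using xy yz by (simp add: boundary_rel_def)
  qed
qed

lemma boundary_class_eq_iff:
  assumes "x \<in> sequences_to_infinity X d" "y \<in> sequences_to_infinity X d"
  shows "boundary_rel `` {x} = boundary_rel `` {y} \<longleftrightarrow> sequences_equiv X d x y"
  using eq_equiv_class_iff[OF equiv_boundary_rel assms] assms by (simp add: boundary_rel_def)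

lemma gromov_boundary_class:
  assumes "\<xi> \<in> gromov_boundary X d" "y \<in> \<xi>"
  shows "y \<in> sequences_to_infinity X d" "\<xi> = boundary_rel `` {y}"
proof -
  obtain x where x: "x \<in> sequences_to_infinity X d" "\<xi> = boundary_rel `` {x}"
    using assms(1) unfolding gromov_boundary_quotient by (rule quotientE)
  then have xy: "(x, y) \<in> boundary_rel" using assms(2) by simp
  then show "y \<in> sequences_to_infinity X d" by (simp add: boundary_rel_def)
  show "\<xi> = boundary_rel `` {y}" using x(2) equiv_class_eq[OF equiv_boundary_rel xy] by simp
qed

end

context isometric_four_point_action
begin

lemma limit_set_classI:
  assumes y: "y \<in> sequences_to_infinity X d" and "x \<in> X" "\<And>n. y n \<in> orbit G \<phi> x"
  shows "boundary_rel `` {y} \<in> limit_set G X d \<phi>"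
proof -
  have "boundary_rel `` {y} \<in> gromov_boundary X d"
    unfolding gromov_boundary_quotient using y by (rule quotientI)
  moreover have "y \<in> boundary_rel `` {y}" using equiv_class_self[OF equiv_boundary_rel y] .
  ultimately show ?thesis using assms(2,3) unfolding limit_set_def by blast
qed

end

context rough_axis
begin

text \<open>The sign of \<open>j n\<close> might alternate forever. It suffices to follow a sign
  that occurs infinitely often, since one frequent match already identifies the end of a convergent
  sequence.\<close>

lemma unbounded_orb_equiv_ray:
  assumes w: "(\<lambda>n. orb (j n)) \<in> sequences_to_infinity X d"
  shows "\<exists>\<sigma>\<in>{1, -1}. sequences_equiv X d (\<lambda>n. orb (j n)) (ray \<sigma>)"
proof -
  define \<sigma> :: int where "\<sigma> = (if \<forall>N. \<exists>m\<ge>N. 0 \<le> j m then 1 else -1)"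
  have \<sigma>: "\<sigma> \<in> {1, -1}" by (simp add: \<sigma>_def)
  have often: "\<exists>m\<ge>N. 0 \<le> \<sigma> * j m" for N
  proof (cases "\<forall>N. \<exists>m\<ge>N. 0 \<le> j m")
    case False
    then obtain N' where "\<And>m. m \<ge> N' \<Longrightarrow> j m < 0" by (meson not_le)
    moreover have "\<sigma> = -1" unfolding \<sigma>_def by (rule if_not_P[OF False])
    ultimately show ?thesis by (intro exI[of _ "max N N'"]) (simp add: less_imp_le)
  qed (simp add: \<sigma>_def)
  have "\<exists>m\<ge>N. \<exists>n\<ge>N. C \<le> gp x\<^sub>0 (orb (j m)) (ray \<sigma> n)" for C N
  proof -
    have ww: "sequences_equiv X d (\<lambda>n. orb (j n)) (\<lambda>n. orb (j n))"
      using w by (simp add: sequences_to_infinity_iff)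
    \<comment> \<open>The product of a point with itself is its distance to the base point, so the
      bound \<open>\<tau> * real N + B\<close> forces the index on the ray to be at least
      \<open>N\<close>.\<close>
    obtain N' where N': "\<forall>m\<ge>N'. \<forall>n\<ge>N'. max C (\<tau> * real N + B) \<le> gp x\<^sub>0 (orb (j m)) (orb (j n))"
      using sequences_equivD[OF ww x\<^sub>0] by blast
    obtain m where m: "m \<ge> max N N'" "0 \<le> \<sigma> * j m" using often by blast
    have gpm: "max C (\<tau> * real N + B) \<le> gp x\<^sub>0 (orb (j m)) (orb (j m))" using N' m by auto
    define n where "n = nat \<bar>j m\<bar>"
    have "\<sigma> * int n = j m" using \<sigma> m(2) by (auto simp: n_def)
    then have r: "ray \<sigma> n = orb (j m)" by (simp add: ray_def)
    have "gp x\<^sub>0 (orb (j m)) (orb (j m)) = d (orb (j m)) x\<^sub>0"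
      using orb_in by (simp add: gromov_product_def)
    also have "\<dots> \<le> \<tau> * real n + B"
      using orb_dist_bounds(2)[of "j m" 0] by (simp add: orb_0 n_def)
    finally have "\<tau> * real N \<le> \<tau> * real n" using gpm by simp
    then have "N \<le> n" using \<tau> by simp
    moreover have "C \<le> gp x\<^sub>0 (orb (j m)) (ray \<sigma> n)" using gpm by (simp add: r)
    moreover have "N \<le> m" using m(1) by simp
    ultimately show ?thesis by blast
  qed
  then have "sequences_equiv X d (\<lambda>n. orb (j n)) (ray \<sigma>)"
    by (rule sequences_equiv_if_frequently[OF w ray_to_infinity[OF \<sigma>] x\<^sub>0])
  then show ?thesis using \<sigma> by blast
qed

lemma elementary_if_orbit_near_axis:
  assumes D: "\<And>h. h \<in> carrier G \<Longrightarrow> \<exists>j. d (\<phi> h x\<^sub>0) (orb j) \<le> D"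
  shows "\<not> nonelementary_action G X d \<phi>"
proof -
  let ?E = "{boundary_rel `` {ray 1}, boundary_rel `` {ray (-1)}}"
  have "limit_set G X d \<phi> \<subseteq> ?E"
  proof
    fix \<xi> assume "\<xi> \<in> limit_set G X d \<phi>"
    then obtain x y where \<xi>: "\<xi> \<in> gromov_boundary X d" and x: "x \<in> X" and y: "y \<in> \<xi>"
      and orbit: "\<forall>n. y n \<in> orbit G \<phi> x"
      unfolding limit_set_def by blast
    have "\<forall>n. \<exists>h. h \<in> carrier G \<and> y n = \<phi> h x" using orbit unfolding orbit_def by blast
    then obtain h where h: "\<And>n. h n \<in> carrier G" "\<And>n. y n = \<phi> (h n) x" by metis
    obtain j where j: "\<And>n. d (\<phi> (h n) x\<^sub>0) (orb (j n)) \<le> D" using D[OF h(1)] by metis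
    note y\<xi> = gromov_boundary_class[OF \<xi> y]
    \<comment> \<open>\<open>limit_set\<close> admits the orbit of any point; passing from
      \<open>x\<close> to \<open>x\<^sub>0\<close> costs a constant and does not change the
      end.\<close>
    have "d (y n) (orb (j n)) \<le> d x x\<^sub>0 + D" for n
    proof -
      have "d (y n) (\<phi> (h n) x\<^sub>0) = d x x\<^sub>0" using h x x\<^sub>0 by (simp add: act_dist)
      moreover have "y n \<in> X" "\<phi> (h n) x\<^sub>0 \<in> X" using h x x\<^sub>0 by (auto simp: act_closed)
      ultimately show ?thesis using triangle[OF _ _ orb_in, of "y n" "\<phi> (h n) x\<^sub>0" "j n"] j[of n] by simp
    qed
    note yw = sequences_equiv_bounded_dist[OF y\<xi>(1) orb_in this]
    obtain \<sigma> where \<sigma>: "\<sigma> \<in> {1, -1}" "sequences_equiv X d (\<lambda>n. orb (j n)) (ray \<sigma>)"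
      using unbounded_orb_equiv_ray[OF yw(2)] by blast
    have yX: "\<And>n. y n \<in> X" using y\<xi>(1) by (simp add: sequences_to_infinity_iff)
    have "sequences_equiv X d y (ray \<sigma>)" by (rule sequences_equiv_trans[OF yX orb_in ray_in yw(1) \<sigma>(2)])
    then have "\<xi> = boundary_rel `` {ray \<sigma>}"
      using boundary_class_eq_iff[OF y\<xi>(1) ray_to_infinity[OF \<sigma>(1)]] y\<xi>(2) by simp
    then show "\<xi> \<in> ?E" using \<sigma>(1) by auto
  qed
  then have "finite (limit_set G X d \<phi>)" "card (limit_set G X d \<phi>) \<le> card ?E"
    by (auto intro: finite_subset card_mono)
  moreover have "card ?E \<le> 2" by (simp add: card_insert_if)
  ultimately show ?thesis by (simp add: nonelementary_action_def)
qed

lemma third_end: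
  assumes "\<not> ends_preserved"
  obtains h \<sigma> where "h \<in> carrier G" "\<sigma> \<in> {1, -1}"
    "\<forall>\<rho>\<in>{1, -1}. \<not> sequences_equiv X d (\<lambda>n. \<phi> h (ray \<sigma> n)) (ray \<rho>)"
  using assms unfolding ends_preserved_def by blast

lemma nonelementary_if_not_ends_preserved:
  assumes "\<not> ends_preserved"
  shows "nonelementary_action G X d \<phi>"
proof -
  obtain h \<sigma> where h: "h \<in> carrier G" and \<sigma>: "\<sigma> \<in> {1, -1}"
    and ne: "\<forall>\<rho>\<in>{1, -1}. \<not> sequences_equiv X d (\<lambda>n. \<phi> h (ray \<sigma> n)) (ray \<rho>)"
    using third_end[OF assms] .
  let ?w = "\<lambda>n. \<phi> h (ray \<sigma> n)" and ?c = "\<lambda>y. boundary_rel `` {y}"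
  have inf: "ray 1 \<in> sequences_to_infinity X d" "ray (-1) \<in> sequences_to_infinity X d"
    "?w \<in> sequences_to_infinity X d"
    using ray_to_infinity \<sigma> sequences_to_infinity_act[OF h] by auto
  have orbit: "\<phi> k x\<^sub>0 \<in> orbit G \<phi> x\<^sub>0" if "k \<in> carrier G" for k
    using that by (auto simp: orbit_def)
  have ro: "ray \<rho> n \<in> orbit G \<phi> x\<^sub>0" for \<rho> n using orbit g by (simp add: ray_def orb_def)
  have "?w n = \<phi> (h \<otimes> g [^] (\<sigma> * int n)) x\<^sub>0" for n
    using h g x\<^sub>0 by (simp add: ray_def orb_def act_mult)
  then have wo: "?w n \<in> orbit G \<phi> x\<^sub>0" for n using orbit h g by simp
  let ?T = "{?c (ray 1), ?c (ray (-1)), ?c ?w}"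
  have sub: "?T \<subseteq> limit_set G X d \<phi>" using limit_set_classI[OF _ x\<^sub>0] inf ro wo by auto
  have "?c (ray 1) \<noteq> ?c (ray (-1))"
    using boundary_class_eq_iff[OF inf(1,2)] opposite_rays_not_equiv[of 1] by simp
  moreover have "?c ?w \<noteq> ?c (ray 1)" "?c ?w \<noteq> ?c (ray (-1))"
    using boundary_class_eq_iff[OF inf(3,1)] boundary_class_eq_iff[OF inf(3,2)] ne by auto
  ultimately have "card ?T = 3" by auto
  then have "infinite (limit_set G X d \<phi>) \<or> 3 \<le> card (limit_set G X d \<phi>)"
    using card_mono[OF _ sub] by metis
  then show ?thesis by (auto simp: nonelementary_action_def)
qed

end

section \<open>The kernel of the action on the asymptotic cone\<close>

text \<open>A singleton in an ultrafilter would make it principal. So every singleton, and then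
  every initial segment, is negligible.\<close>

lemma nonprincipal_ultrafilter_le_sequentially:
  assumes "nonprincipal_ultrafilter \<omega>"
  shows "\<omega> \<le> sequentially"
proof -
  have ne: "\<omega> \<noteq> bot" and ultra: "\<And>P. eventually P \<omega> \<or> eventually (\<lambda>i. \<not> P i) \<omega>"
    and np: "\<And>i. \<omega> \<noteq> principal {i}"
    using assms by (auto simp: nonprincipal_ultrafilter_def)
  have "eventually (\<lambda>n. n \<noteq> i) \<omega>" for i
  proof (rule ccontr)
    assume "\<not> eventually (\<lambda>n. n \<noteq> i) \<omega>"
    then have i: "eventually (\<lambda>n. n = i) \<omega>" using ultra[of "\<lambda>n. n = i"] by blast
    have "eventually P \<omega> \<longleftrightarrow> P i" for P
    proof
      assume "eventually P \<omega>"
      then have "eventually (\<lambda>n. P i) \<omega>" using i by eventually_elim simp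
      then show "P i" using ne by (simp add: eventually_const)
    next
      assume "P i"
      with i show "eventually P \<omega>" by (auto elim: eventually_mono)
    qed
    then have "\<omega> = principal {i}" by (intro filter_eqI) (simp add: eventually_principal)
    then show False using np by blast
  qed
  then have "eventually (\<lambda>n. \<forall>i\<in>{..<N}. n \<noteq> i) \<omega>" for N :: nat
    by (intro eventually_ball_finite) auto
  moreover have "(\<forall>i\<in>{..<N}. n \<noteq> i) \<longleftrightarrow> N \<le> n" for n N :: nat by (auto simp: not_less[symmetric])
  ultimately have "eventually (\<lambda>n. N \<le> n) \<omega>" for N by simp
  then show ?thesis
    unfolding le_filter_def eventually_sequentially by (metis (mono_tags, lifting) eventually_mono)
qed

lemma filterlim_unbounded_mono:
  fixes s :: "nat \<Rightarrow> real"
  assumes "nonprincipal_ultrafilter \<omega>" "mono s" "\<not> bdd_above (range s)"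
  shows "filterlim s at_top \<omega>"
proof -
  have "filterlim s at_top sequentially"
    unfolding filterlim_at_top eventually_sequentially
  proof
    fix C
    obtain N where "C < s N" using assms(3) by (meson bdd_aboveI2 not_le)
    then show "\<exists>N. \<forall>n\<ge>N. C \<le> s n" using monoD[OF assms(2)] by (meson less_imp_le order_trans)
  qed
  then show ?thesis
    using nonprincipal_ultrafilter_le_sequentially[OF assms(1)] by (rule filterlim_mono[OF _ order_refl])
qed

locale cone_scaling = group G for G (structure) +
  fixes \<omega> :: "nat filter" and S :: "'a set" and s :: "nat \<Rightarrow> real"
  assumes S: "finite_generating_set G S" and spos: "\<And>n. 0 < s n" and smono: "mono s"
    and s_at_top: "filterlim s at_top \<omega>" and \<omega>_ne: "\<omega> \<noteq> bot"
begin

lemmas kernel_iff = cone_kernel_iff[of S s, OF S spos smono, of _ \<omega>]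

lemma kernelD:
  assumes "k \<in> cone_kernel \<omega> G S s" "x \<in> admissible G S s"
  shows "((\<lambda>n. real (word_length G S (inv (x n) \<otimes> (k \<otimes> x n))) / s n) \<longlongrightarrow> 0) \<omega>"
  using assms(1)[unfolded kernel_iff, THEN conjunct2] assms(2) by (rule bspec)

text \<open>The displacement of \<open>x n\<close> by \<open>k\<close> is the length of a conjugate
  of \<open>k\<close>; if these lengths are bounded, division by \<open>s n\<close> makes them
  vanish in the limit.\<close>

lemma kernelI_finite_conjugates:
  assumes k: "k \<in> carrier G" and fin: "finite ((\<lambda>h. inv h \<otimes> (k \<otimes> h)) ` carrier G)"
  shows "k \<in> cone_kernel \<omega> G S s"
  unfolding kernel_iff
proof (intro conjI ballI)
  fix x assume x: "x \<in> admissible G S s"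
  define L where "L = Max (word_length G S ` (\<lambda>h. inv h \<otimes> (k \<otimes> h)) ` carrier G)"
  have L: "word_length G S (inv (x n) \<otimes> (k \<otimes> x n)) \<le> L" for n
    unfolding L_def using fin x by (intro Max_ge) (auto simp: admissible_def)
  have "((\<lambda>n. real L / s n) \<longlongrightarrow> 0) \<omega>"
    using s_at_top by (intro tendsto_divide_0[OF tendsto_const] filterlim_at_top_imp_at_infinity)
  then show "((\<lambda>n. real (word_length G S (inv (x n) \<otimes> (k \<otimes> x n))) / s n) \<longlongrightarrow> 0) \<omega>"
  proof (rule tendsto_sandwich[OF _ _ tendsto_const, rotated 2])
    show "\<forall>\<^sub>F n in \<omega>. real (word_length G S (inv (x n) \<otimes> (k \<otimes> x n))) / s n \<le> real L / s n"
      using L spos by (intro always_eventually allI divide_right_mono) (auto intro: less_imp_le)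
    show "\<forall>\<^sub>F n in \<omega>. 0 \<le> real (word_length G S (inv (x n) \<otimes> (k \<otimes> x n))) / s n"
      using spos by (intro always_eventually allI divide_nonneg_pos) auto
  qed
qed (rule k)

lemma kernel_conjugate:
  assumes k: "k \<in> cone_kernel \<omega> G S s" and h: "h \<in> carrier G"
  shows "inv h \<otimes> (k \<otimes> h) \<in> cone_kernel \<omega> G S s"
  unfolding kernel_iff
proof (intro conjI ballI)
  have kG: "k \<in> carrier G" using k by (simp add: kernel_iff)
  then show "inv h \<otimes> (k \<otimes> h) \<in> carrier G" using h by simp
  fix x assume x: "x \<in> admissible G S s"
  have xG: "x n \<in> carrier G" for n using x by (simp add: admissible_def)
  have "(\<lambda>n. h \<otimes> x n) \<in> admissible G S s" by (rule translate_admissible[OF S spos smono h x])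
  then have "((\<lambda>n. real (word_length G S (inv (h \<otimes> x n) \<otimes> (k \<otimes> (h \<otimes> x n)))) / s n) \<longlongrightarrow> 0) \<omega>"
    by (rule kernelD[OF k])
  moreover have "inv (h \<otimes> x n) \<otimes> (k \<otimes> (h \<otimes> x n)) = inv (x n) \<otimes> (inv h \<otimes> (k \<otimes> h) \<otimes> x n)" for n
    using h kG xG by (simp add: inv_mult_group m_assoc)
  ultimately show "((\<lambda>n. real (word_length G S (inv (x n) \<otimes> (inv h \<otimes> (k \<otimes> h) \<otimes> x n))) / s n) \<longlongrightarrow> 0) \<omega>"
    by simp
qed

end

section \<open>Displacements: acylindricity and word length\<close>

context isometric_four_point_action
begin

text \<open>Acylindricity without the uniform bound on the cardinality.\<close>

definition locally_acylindrical :: bool where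
  "locally_acylindrical \<longleftrightarrow> (\<forall>\<epsilon>. \<exists>R. \<forall>x\<in>X. \<forall>y\<in>X. R \<le> d x y \<longrightarrow>
     finite {k \<in> carrier G. d x (\<phi> k x) \<le> \<epsilon> \<and> d y (\<phi> k y) \<le> \<epsilon>})"

lemma dist_act_conjugate:
  assumes "h \<in> carrier G" "k \<in> carrier G" "y \<in> X"
  shows "d y (\<phi> (inv h \<otimes> (k \<otimes> h)) y) = d (\<phi> h y) (\<phi> k (\<phi> h y))"
proof -
  have "\<phi> h (\<phi> (inv h \<otimes> (k \<otimes> h)) y) = \<phi> k (\<phi> h y)"
    using assms by (simp add: act_mult act_closed act_cancel_inv)
  then show ?thesis
    using act_dist[of h y "\<phi> (inv h \<otimes> (k \<otimes> h)) y"] assms by (simp add: act_closed)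
qed

text \<open>Orbit maps are Lipschitz. This is the link from the word lengths that define the cone to
  distances in \<open>X\<close>.\<close>

lemma displacement_le_word_length:
  assumes S: "finite_generating_set G S" and x: "x \<in> X"
  obtains L where "0 \<le> L" "\<And>k. k \<in> carrier G \<Longrightarrow> d x (\<phi> k x) \<le> L * real (word_length G S k)"
proof -
  have SG: "S \<subseteq> carrier G" and fin: "finite S" using S by (auto simp: finite_generating_set_def)
  let ?A = "insert \<one> (S \<union> m_inv G ` S)"
  define L where "L = Max ((\<lambda>k. d x (\<phi> k x)) ` ?A)"
  have L: "d x (\<phi> k x) \<le> L" if "k \<in> ?A" for k
    unfolding L_def using fin that by (intro Max_ge) auto
  have L0: "0 \<le> L" using L[of \<one>] x by (simp add: act_one)
  have "d x (\<phi> (word_eval G ws) x) \<le> L * real (length ws)" if "ws \<in> words G S" for ws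
    using that
  proof (induction ws)
    case Nil
    then show ?case using x by (simp add: act_one)
  next
    case (Cons w ws)
    have w: "w \<in> S \<union> m_inv G ` S" and ws: "ws \<in> words G S" using Cons.prems by (auto simp: words_def)
    have wG: "w \<in> carrier G" using w SG by auto
    have vG: "word_eval G ws \<in> carrier G" using words_carrier[OF SG ws] word_eval_closed by blast
    have "d x (\<phi> (w \<otimes> word_eval G ws) x) \<le> d x (\<phi> w x) + d (\<phi> w x) (\<phi> w (\<phi> (word_eval G ws) x))"
      using wG vG x by (simp add: act_mult act_closed triangle)
    also have "d (\<phi> w x) (\<phi> w (\<phi> (word_eval G ws) x)) = d x (\<phi> (word_eval G ws) x)"
      using wG vG x by (simp add: act_dist act_closed)
    finally show ?case using Cons.IH[OF ws] L[of w] w by (simp add: distrib_left)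
  qed
  then have "d x (\<phi> k x) \<le> L * real (word_length G S k)" if "k \<in> carrier G" for k
    using word_length_witness[OF S that] by metis
  then show thesis using that L0 by blast
qed

end

context rough_axis
begin

lemma far_orb: "\<exists>M. R \<le> d x\<^sub>0 (orb M)"
proof -
  obtain N :: nat where N: "(R + B) / \<tau> < real N" using reals_Archimedean2 by blast
  then have "R + B < \<tau> * real N" using \<tau> by (simp add: divide_less_eq mult.commute)
  then show ?thesis
    using orb_dist_bounds(1)[of 0 "int N"] by (intro exI[of _ "int N"]) (simp add: orb_0)
qed

text \<open>A conjugate of a power of \<open>g\<close> moves the points \<open>x\<^sub>0\<close> and \<open>orb M\<close> as far as the power moves two
  points of the orbit, all of which are close to the axis.\<close>

lemma finite_conjugates_power:
  assumes acyl: locally_acylindrical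
    and D: "\<And>h. h \<in> carrier G \<Longrightarrow> \<exists>j. d (\<phi> h x\<^sub>0) (orb j) \<le> D"
  shows "finite ((\<lambda>h. inv h \<otimes> (g [^] (m::int) \<otimes> h)) ` carrier G)"
proof -
  \<comment> \<open>To the axis, along it by \<open>?k\<close>, and back.\<close>
  let ?k = "g [^] m" and ?\<epsilon> = "2 * D + d x\<^sub>0 (orb m)"
  have k: "?k \<in> carrier G" using g by simp
  have moved: "d (\<phi> h x\<^sub>0) (\<phi> ?k (\<phi> h x\<^sub>0)) \<le> ?\<epsilon>" if h: "h \<in> carrier G" for h
  proof -
    obtain j where j: "d (\<phi> h x\<^sub>0) (orb j) \<le> D" using D[OF h] by blast
    have hX: "\<phi> h x\<^sub>0 \<in> X" using h x\<^sub>0 by (simp add: act_closed)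
    have kX: "\<phi> ?k (\<phi> h x\<^sub>0) \<in> X" "\<phi> ?k (orb j) \<in> X" using k hX orb_in by (auto simp: act_closed)
    have "\<phi> ?k (orb j) = \<phi> (g [^] j) (orb m)" by (simp add: act_orb add.commute)
    then have "d (orb j) (\<phi> ?k (orb j)) = d x\<^sub>0 (orb m)"
      using act_dist[OF int_pow_closed[OF g] x\<^sub>0 orb_in, of j m] by (simp add: orb_def[of j])
    moreover have "d (\<phi> ?k (orb j)) (\<phi> ?k (\<phi> h x\<^sub>0)) \<le> D"
      using k hX orb_in j by (simp add: act_dist commute)
    moreover have "d (\<phi> h x\<^sub>0) (\<phi> ?k (\<phi> h x\<^sub>0)) \<le> d (\<phi> h x\<^sub>0) (orb j) + d (orb j) (\<phi> ?k (\<phi> h x\<^sub>0))"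
      "d (orb j) (\<phi> ?k (\<phi> h x\<^sub>0)) \<le> d (orb j) (\<phi> ?k (orb j)) + d (\<phi> ?k (orb j)) (\<phi> ?k (\<phi> h x\<^sub>0))"
      by (intro triangle hX kX orb_in)+
    ultimately show ?thesis using j by linarith
  qed
  obtain R where R: "\<And>x y. x \<in> X \<Longrightarrow> y \<in> X \<Longrightarrow> R \<le> d x y \<Longrightarrow>
      finite {k \<in> carrier G. d x (\<phi> k x) \<le> ?\<epsilon> \<and> d y (\<phi> k y) \<le> ?\<epsilon>}"
    using acyl unfolding locally_acylindrical_def by blast
  obtain M where M: "R \<le> d x\<^sub>0 (orb M)" using far_orb by blast
  have "inv h \<otimes> (?k \<otimes> h) \<in> {k \<in> carrier G. d x\<^sub>0 (\<phi> k x\<^sub>0) \<le> ?\<epsilon> \<and> d (orb M) (\<phi> k (orb M)) \<le> ?\<epsilon>}"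
    if h: "h \<in> carrier G" for h
  proof -
    have "\<phi> h (orb M) = \<phi> (h \<otimes> g [^] M) x\<^sub>0" using h g x\<^sub>0 by (simp add: orb_def act_mult)
    then show ?thesis
      using moved[OF h] moved[of "h \<otimes> g [^] M"] h g k x\<^sub>0 orb_in by (simp add: dist_act_conjugate)
  qed
  then show ?thesis by (intro finite_subset[OF _ R[OF x\<^sub>0 orb_in M]]) blast
qed

lemma infinite_powers: "infinite (range (\<lambda>m::int. g [^] m))"
proof
  assume fin: "finite (range (\<lambda>m::int. g [^] m))"
  let ?R = "Max ((\<lambda>k. d x\<^sub>0 (\<phi> k x\<^sub>0)) ` range (\<lambda>m::int. g [^] m))"
  obtain M where M: "?R + 1 \<le> d x\<^sub>0 (orb M)" using far_orb by blast
  have "d x\<^sub>0 (orb M) \<le> ?R" unfolding orb_def using fin by (intro Max_ge) auto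
  then show False using M by linarith
qed

lemma infinite_cone_kernel:
  assumes "cone_scaling G \<omega> S s" and locally_acylindrical
    and "\<And>h. h \<in> carrier G \<Longrightarrow> \<exists>j. d (\<phi> h x\<^sub>0) (orb j) \<le> D"
  shows "infinite (cone_kernel \<omega> G S s)"
proof -
  interpret cone_scaling G \<omega> S s by fact
  have "range (\<lambda>m::int. g [^] m) \<subseteq> cone_kernel \<omega> G S s"
    using kernelI_finite_conjugates finite_conjugates_power[OF assms(2,3)] g by auto
  then show ?thesis using infinite_powers infinite_super by blast
qed

text \<open>Along the admissible sequence \<open>h g\<^sup>m\<close> with \<open>m\<close> comparable to \<open>s n\<close>, a kernel element moves
  the orbit point by \<open>o(s n)\<close>, whereas that point is at distance about \<open>\<tau> * s n\<close> from \<open>x\<^sub>0\<close>.\<close>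

lemma kernel_fixes_ray:
  assumes scaling: "cone_scaling G \<omega> S s" and k: "k \<in> cone_kernel \<omega> G S s"
    and h: "h \<in> carrier G" and \<sigma>: "\<sigma> \<in> {1, -1}"
  shows "sequences_equiv X d (\<lambda>n. \<phi> h (ray \<sigma> n)) (\<lambda>n. \<phi> k (\<phi> h (ray \<sigma> n)))"
proof -
  interpret cone_scaling G \<omega> S s by fact
  have kG: "k \<in> carrier G" using k by (simp add: kernel_iff)
  let ?u = "\<lambda>n. \<phi> h (ray \<sigma> n)"
  have u: "?u \<in> sequences_to_infinity X d" by (intro sequences_to_infinity_act h ray_to_infinity \<sigma>)
  then have ku: "(\<lambda>n. \<phi> k (?u n)) \<in> sequences_to_infinity X d" by (rule sequences_to_infinity_act[OF kG])
  have uX: "?u n \<in> X" and kuX: "\<phi> k (?u n) \<in> X" for n using h kG ray_in by (auto simp: act_closed)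
  obtain L where L: "0 \<le> L" "\<And>k. k \<in> carrier G \<Longrightarrow> d x\<^sub>0 (\<phi> k x\<^sub>0) \<le> L * real (word_length G S k)"
    using displacement_le_word_length[OF S x\<^sub>0] by blast
  \<comment> \<open>Rounding the scale to an exponent makes \<open>z\<close> admissible: it
    represents one point of the cone, on the limit of the translated ray.\<close>
  define c where "c n = nat \<lfloor>s n\<rfloor>" for n
  have c: "real (c n) \<le> s n" "s n < real (c n) + 1" for n using spos[of n] by (simp_all add: c_def)
  define z where "z n = h \<otimes> g [^] (\<sigma> * int (c n))" for n
  have zG: "z n \<in> carrier G" for n using h g by (simp add: z_def)
  have zu: "\<phi> (z n) x\<^sub>0 = ?u (c n)" for n using h g x\<^sub>0 by (simp add: z_def ray_def orb_def act_mult)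
  have pow_len: "word_length G S (g [^] (\<sigma> * int n)) \<le> n * word_length G S g" for n
  proof (induction n)
    case 0
    then show ?case using word_length_eq_0[OF S one_closed] by simp
  next
    case (Suc n)
    have "g [^] (\<sigma> * int (Suc n)) = g [^] \<sigma> \<otimes> g [^] (\<sigma> * int n)"
      using g by (simp add: distrib_left flip: int_pow_mult)
    moreover have "word_length G S (g [^] \<sigma>) = word_length G S g"
      using \<sigma> g word_length_inv[OF S g] int_pow_neg[OF g, of 1] by auto
    ultimately show ?case using word_length_mult[OF S, of "g [^] \<sigma>" "g [^] (\<sigma> * int n)"] g Suc by simp
  qed
  have "z \<in> admissible G S s"
  proof -
    have "real (word_length G S (z n)) / s n \<le> real (word_length G S h) / s 0 + real (word_length G S g)" for n
    proof -
      have "word_length G S (z n) \<le> word_length G S h + c n * word_length G S g"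
        using word_length_mult[OF S h, of "g [^] (\<sigma> * int (c n))"] pow_len[of "c n"] g
        unfolding z_def by (meson add_left_mono int_pow_closed order_trans)
      then have "real (word_length G S (z n)) \<le> real (word_length G S h) + real (c n) * real (word_length G S g)"
        by (metis of_nat_add of_nat_mono of_nat_mult)
      also have "\<dots> \<le> real (word_length G S h) + s n * real (word_length G S g)"
        using c by (intro add_left_mono mult_right_mono) auto
      finally have "real (word_length G S (z n)) / s n
          \<le> real (word_length G S h) / s n + real (word_length G S g)"
        using spos[of n] by (simp add: divide_simps mult.commute)
      also have "real (word_length G S h) / s n \<le> real (word_length G S h) / s 0"
        using spos monoD[OF smono, of 0 n] by (intro divide_left_mono mult_pos_pos) auto
      finally show ?thesis by simp
    qed
    then show ?thesis using zG by (auto simp: admissible_def)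
  qed
  then have lim: "((\<lambda>n. real (word_length G S (inv (z n) \<otimes> (k \<otimes> z n))) / s n) \<longlongrightarrow> 0) \<omega>"
    by (rule kernelD[OF k])
  show ?thesis
  \<comment> \<open>A limit along \<open>\<omega>\<close> controls only an
    \<open>\<omega>\<close>-large set of indices, and this criterion asks for no more than one index
    beyond each \<open>N\<close>.\<close>
  proof (rule sequences_equiv_if_frequently[OF u ku x\<^sub>0])
    fix C :: real and N :: nat
    let ?E = "C + \<tau> + B + d x\<^sub>0 (\<phi> h x\<^sub>0) + d x\<^sub>0 (\<phi> k x\<^sub>0)"
    \<comment> \<open>The denominator \<open>L + 1\<close> allows for \<open>L = 0\<close>. The
      point then moves by at most \<open>\<tau> * s n\<close>, while it and its image are each at
      distance about \<open>\<tau> * s n\<close> from \<open>x\<^sub>0\<close>: about half of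
      \<open>\<tau> * s n\<close> remains for the product, and \<open>?E\<close> collects the
      constant errors.\<close>
    have "0 < \<tau> / (L + 1)" using \<tau> L by simp
    with lim have "\<forall>\<^sub>F n in \<omega>. real (word_length G S (inv (z n) \<otimes> (k \<otimes> z n))) / s n < \<tau> / (L + 1)"
      by (rule order_tendstoD(2))
    moreover have "\<forall>\<^sub>F n in \<omega>. max (real N + 1) (2 * ?E / \<tau>) \<le> s n"
      using s_at_top unfolding filterlim_at_top by blast
    ultimately have "\<forall>\<^sub>F n in \<omega>. real (word_length G S (inv (z n) \<otimes> (k \<otimes> z n))) / s n < \<tau> / (L + 1)
        \<and> max (real N + 1) (2 * ?E / \<tau>) \<le> s n" by (rule eventually_conj)
    from eventually_happens'[OF \<omega>_ne this] obtain n where n: "real (word_length G S (inv (z n) \<otimes> (k \<otimes> z n))) / s n < \<tau> / (L + 1)"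
      "max (real N + 1) (2 * ?E / \<tau>) \<le> s n" by blast
    have big: "2 * ?E \<le> \<tau> * s n" using n(2) \<tau> by (simp add: pos_divide_le_eq mult.commute)
    have cN: "N \<le> c n" using n(2) c(2)[of n] by simp
    let ?w = "real (word_length G S (inv (z n) \<otimes> (k \<otimes> z n)))"
    have "?w * (L + 1) \<le> \<tau> * s n" using n(1) spos[of n] L by (simp add: field_simps)
    then have "L * ?w \<le> \<tau> * s n" by (simp add: algebra_simps)
    moreover have "d (?u (c n)) (\<phi> k (?u (c n))) \<le> L * ?w"
      using L(2)[of "inv (z n) \<otimes> (k \<otimes> z n)"] dist_act_conjugate[OF zG kG x\<^sub>0] zG kG by (simp add: zu)
    ultimately have move: "d (?u (c n)) (\<phi> k (?u (c n))) \<le> \<tau> * s n" by linarith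
    have hX: "\<phi> h x\<^sub>0 \<in> X" and kX: "\<phi> k x\<^sub>0 \<in> X" using h kG x\<^sub>0 by (auto simp: act_closed)
    have "\<tau> * real (c n) - B \<le> d (ray \<sigma> (c n)) x\<^sub>0"
      using orb_dist_bounds(1)[of "\<sigma> * int (c n)" 0] \<sigma> by (auto simp: ray_def orb_0)
    also have "\<dots> = d (?u (c n)) (\<phi> h x\<^sub>0)" using h x\<^sub>0 ray_in by (simp add: act_dist)
    also have "\<dots> \<le> d (?u (c n)) x\<^sub>0 + d x\<^sub>0 (\<phi> h x\<^sub>0)" by (intro triangle uX hX x\<^sub>0)
    finally have 1: "\<tau> * real (c n) - B - d x\<^sub>0 (\<phi> h x\<^sub>0) \<le> d (?u (c n)) x\<^sub>0" by simp
    have "d (?u (c n)) x\<^sub>0 = d (\<phi> k (?u (c n))) (\<phi> k x\<^sub>0)" using kG x\<^sub>0 uX by (simp add: act_dist)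
    also have "\<dots> \<le> d (\<phi> k (?u (c n))) x\<^sub>0 + d x\<^sub>0 (\<phi> k x\<^sub>0)" by (intro triangle kuX kX x\<^sub>0)
    finally have 2: "d (?u (c n)) x\<^sub>0 - d x\<^sub>0 (\<phi> k x\<^sub>0) \<le> d (\<phi> k (?u (c n))) x\<^sub>0" by simp
    have "\<tau> * s n \<le> \<tau> * (real (c n) + 1)" using \<tau> c(2)[of n] by (intro mult_left_mono) auto
    then have 3: "\<tau> * s n - \<tau> \<le> \<tau> * real (c n)" by (simp add: distrib_left)
    have "2 * C \<le> d (?u (c n)) x\<^sub>0 + d (\<phi> k (?u (c n))) x\<^sub>0 - d (?u (c n)) (\<phi> k (?u (c n)))"
      using 1 2 3 big move \<tau> B_nonneg nonneg[of x\<^sub>0 "\<phi> h x\<^sub>0"] nonneg[of x\<^sub>0 "\<phi> k x\<^sub>0"] by argo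
    then have "C \<le> gp x\<^sub>0 (?u (c n)) (\<phi> k (?u (c n)))" unfolding gromov_product_def by simp
    then show "\<exists>m\<ge>N. \<exists>n\<ge>N. C \<le> gp x\<^sub>0 (?u m) (\<phi> k (?u n))" using cN by blast
  qed
qed

end

context rough_axis
begin

text \<open>A kernel element fixes three distinct ends, hence moves the rough center of the triangle they
  span, and thereby \<open>x\<^sub>0\<close>, by an amount independent of the element; by normality of the kernel the same
  bound holds at \<open>orb M\<close>.\<close>

lemma finite_cone_kernel:
  assumes scaling: "cone_scaling G \<omega> S s" and acyl: locally_acylindrical
    and "\<not> ends_preserved"
  shows "finite (cone_kernel \<omega> G S s)"
proof -
  interpret cone_scaling G \<omega> S s by fact
  obtain h \<sigma> where h: "h \<in> carrier G" and \<sigma>: "\<sigma> \<in> {1, -1}"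
    and "\<forall>\<rho>\<in>{1, -1}. \<not> sequences_equiv X d (\<lambda>n. \<phi> h (ray \<sigma> n)) (ray \<rho>)"
    using third_end[OF assms(3)] .
  then have ne: "\<not> sequences_equiv X d (\<lambda>n. \<phi> h (ray \<sigma> n)) (ray 1)"
    "\<not> sequences_equiv X d (\<lambda>n. \<phi> h (ray \<sigma> n)) (ray (-1))" by auto
  let ?u = "ray 1" and ?v = "ray (-1)" and ?w = "\<lambda>n. \<phi> h (ray \<sigma> n)"
  have inf: "?u \<in> sequences_to_infinity X d" "?v \<in> sequences_to_infinity X d"
    "?w \<in> sequences_to_infinity X d"
    using ray_to_infinity \<sigma> sequences_to_infinity_act[OF h] by auto
  have in_X: "?w n \<in> X" for n using h ray_in by (simp add: act_closed)
  obtain C1 N1 where C1: "\<forall>m\<ge>N1. \<forall>n\<ge>N1. gp x\<^sub>0 (?w m) (?u n) \<le> C1"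
    using not_sequences_equiv_bounded[OF inf(3,1) x\<^sub>0 ne(1)] .
  obtain C2 N2 where C2: "\<forall>m\<ge>N2. \<forall>n\<ge>N2. gp x\<^sub>0 (?w m) (?v n) \<le> C2"
    using not_sequences_equiv_bounded[OF inf(3,2) x\<^sub>0 ne(2)] .
  define C where "C = max (2 * B) (max C1 C2)"
  have gps: "gp x\<^sub>0 (?u n) (?v n) \<le> C" "gp x\<^sub>0 (?u n) (?w n) \<le> C" "gp x\<^sub>0 (?v n) (?w n) \<le> C"
    if "n \<ge> max N1 N2" for n
    using gp_opposite_rays[of 1 n n] C1[rule_format, of n n] C2[rule_format, of n n] that
      gp_commute[of x\<^sub>0 "?w n" "?u n"] gp_commute[of x\<^sub>0 "?w n" "?v n"]
    unfolding C_def by simp_all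
  \<comment> \<open>The bound of \<open>dist_le_if_common_center\<close>, with \<open>C\<close>
    enlarged by the loss in \<open>transfer\<close> below.\<close>
  let ?\<epsilon> = "8 * (C + 2 * \<delta>) + 2 * \<delta>"
  have \<delta>: "0 \<le> \<delta>" by (rule delta_nonneg[OF x\<^sub>0])
  have moved: "d x\<^sub>0 (\<phi> k x\<^sub>0) \<le> ?\<epsilon>" if k: "k \<in> cone_kernel \<omega> G S s" for k
  proof -
    have kG: "k \<in> carrier G" using k by (simp add: kernel_iff)
    let ?b = "\<phi> k x\<^sub>0"
    have b: "?b \<in> X" using kG x\<^sub>0 by (simp add: act_closed)
    have fix_ray: "sequences_equiv X d (ray \<rho>) (\<lambda>n. \<phi> k (ray \<rho> n))" if "\<rho> \<in> {1, -1}" for \<rho>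
      using kernel_fixes_ray[OF scaling k one_closed that] ray_in by (simp add: act_one)
    obtain Nu where Nu: "\<forall>m\<ge>Nu. \<forall>n\<ge>Nu. C + 2 * \<delta> + 1 \<le> gp ?b (?u m) (\<phi> k (?u n))"
      using sequences_equivD[OF fix_ray[of 1] b] by blast
    obtain Nv where Nv: "\<forall>m\<ge>Nv. \<forall>n\<ge>Nv. C + 2 * \<delta> + 1 \<le> gp ?b (?v m) (\<phi> k (?v n))"
      using sequences_equivD[OF fix_ray[of "-1"] b] by blast
    obtain Nw where Nw: "\<forall>m\<ge>Nw. \<forall>n\<ge>Nw. C + 2 * \<delta> + 1 \<le> gp ?b (?w m) (\<phi> k (?w n))"
      using sequences_equivD[OF kernel_fixes_ray[OF scaling k h \<sigma>] b] by blast
    define n where "n = max (max N1 N2) (max Nu (max Nv Nw))"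
    have n: "n \<ge> max N1 N2" "n \<ge> Nu" "n \<ge> Nv" "n \<ge> Nw" by (auto simp: n_def)
    \<comment> \<open>At \<open>?b\<close> the product of the images \<open>\<phi> k p\<close> and
      \<open>\<phi> k q\<close> is at most \<open>C\<close>. Each image is replaced by its original
      at the cost of one \<open>\<delta>\<close>; the 1 in the assumptions keeps the minimum away
      from the large products.\<close>
    have transfer: "gp ?b p q \<le> C + 2 * \<delta>"
      if X: "p \<in> X" "q \<in> X" and pq: "gp x\<^sub>0 p q \<le> C"
        and p: "C + 2 * \<delta> + 1 \<le> gp ?b p (\<phi> k p)" and q: "C + 2 * \<delta> + 1 \<le> gp ?b q (\<phi> k q)" for p q
    proof -
      have kX: "\<phi> k p \<in> X" "\<phi> k q \<in> X" using X kG by (auto simp: act_closed)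
      have "gp ?b (\<phi> k p) (\<phi> k q) \<le> C" using gp_act[OF kG x\<^sub>0 X] pq by simp
      moreover have "min (gp ?b (\<phi> k p) p) (gp ?b p (\<phi> k q)) - \<delta> \<le> gp ?b (\<phi> k p) (\<phi> k q)"
        "min (gp ?b p q) (gp ?b q (\<phi> k q)) - \<delta> \<le> gp ?b p (\<phi> k q)"
        using gp_four_point b X kX by auto
      ultimately show ?thesis using p q \<delta> unfolding gp_commute[of ?b "\<phi> k p" p] min_def by argo
    qed
    show ?thesis
    proof (rule dist_le_if_common_center[OF x\<^sub>0 b ray_in ray_in in_X])
      show "gp x\<^sub>0 (?u n) (?v n) \<le> C + 2 * \<delta>" "gp x\<^sub>0 (?u n) (?w n) \<le> C + 2 * \<delta>"
        "gp x\<^sub>0 (?v n) (?w n) \<le> C + 2 * \<delta>"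
        using gps[OF n(1)] \<delta> by auto
      show "gp ?b (?u n) (?v n) \<le> C + 2 * \<delta>" "gp ?b (?u n) (?w n) \<le> C + 2 * \<delta>"
        "gp ?b (?v n) (?w n) \<le> C + 2 * \<delta>"
        using gps[OF n(1)] Nu Nv Nw n by (auto intro!: transfer ray_in in_X)
    qed
  qed
  obtain R where R: "\<And>x y. x \<in> X \<Longrightarrow> y \<in> X \<Longrightarrow> R \<le> d x y \<Longrightarrow>
      finite {k \<in> carrier G. d x (\<phi> k x) \<le> ?\<epsilon> \<and> d y (\<phi> k y) \<le> ?\<epsilon>}"
    using acyl unfolding locally_acylindrical_def by blast
  obtain M where M: "R \<le> d x\<^sub>0 (orb M)" using far_orb by blast
  have "cone_kernel \<omega> G S s \<subseteq> {k \<in> carrier G. d x\<^sub>0 (\<phi> k x\<^sub>0) \<le> ?\<epsilon> \<and> d (orb M) (\<phi> k (orb M)) \<le> ?\<epsilon>}"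
  proof
    fix k assume k: "k \<in> cone_kernel \<omega> G S s"
    then have kG: "k \<in> carrier G" by (simp add: kernel_iff)
    have gM: "g [^] M \<in> carrier G" using g by simp
    have "d x\<^sub>0 (\<phi> (inv (g [^] M) \<otimes> (k \<otimes> g [^] M)) x\<^sub>0) \<le> ?\<epsilon>"
      by (rule moved[OF kernel_conjugate[OF k gM]])
    then have "d (orb M) (\<phi> k (orb M)) \<le> ?\<epsilon>"
      unfolding dist_act_conjugate[OF gM kG x\<^sub>0] by (simp add: orb_def)
    then show "k \<in> {k \<in> carrier G. d x\<^sub>0 (\<phi> k x\<^sub>0) \<le> ?\<epsilon> \<and> d (orb M) (\<phi> k (orb M)) \<le> ?\<epsilon>}"
      using moved[OF k] kG by simp
  qed
  then show ?thesis by (rule finite_subset[OF _ R[OF x\<^sub>0 orb_in M]])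
qed

lemma nonelementary_iff_finite_cone_kernel:
  assumes "cone_scaling G \<omega> S s" and locally_acylindrical
  shows "nonelementary_action G X d \<phi> \<longleftrightarrow> finite (cone_kernel \<omega> G S s)"
proof (cases ends_preserved)
  case True
  obtain D where "\<And>h. h \<in> carrier G \<Longrightarrow> \<exists>j. d (\<phi> h x\<^sub>0) (orb j) \<le> D"
    using orbit_near_axis[OF True] by blast
  then show ?thesis
    using elementary_if_orbit_near_axis infinite_cone_kernel[OF assms] by blast
next
  case False
  then show ?thesis
    using nonelementary_if_not_ends_preserved finite_cone_kernel[OF assms] by blast
qed

end

section \<open>Acylindrical actions on hyperbolic spaces as instances\<close>

lemma acylindrical_action_isometric_four_point:
  assumes "hyperbolic_space X d" and acyl: "acylindrical_action G X d \<phi>"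
  obtains \<delta> where "isometric_four_point_action X d \<delta> G \<phi>"
    "isometric_four_point_action.locally_acylindrical X d G \<phi>"
proof -
  obtain \<delta> where "delta_hyperbolic \<delta> X d" using assms(1) by (auto simp: hyperbolic_space_def)
  then interpret four_point_space X d "3 * \<delta> + 1" by (rule delta_hyperbolic_four_point)
  have iso: "isometric_action G X d \<phi>" using acyl by (simp add: acylindrical_action_def)
  interpret group_action G X \<phi> using iso by (simp add: isometric_action_def)
  interpret group G by (rule group_hom.axioms(1)[OF group_hom])
  interpret isometric_four_point_action X d "3 * \<delta> + 1" G \<phi>
  proof
    show "\<phi> h x \<in> X" if "h \<in> carrier G" "x \<in> X" for h x using element_image that by blast
    show "\<phi> (h \<otimes>\<^bsub>G\<^esub> k) x = \<phi> h (\<phi> k x)" if "h \<in> carrier G" "k \<in> carrier G" "x \<in> X" for h k x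
      using composition_rule that by blast
    show "\<phi> \<one>\<^bsub>G\<^esub> x = x" if "x \<in> X" for x using that by (simp flip: id_eq_one)
    show "d (\<phi> h x) (\<phi> h y) = d x y" if "h \<in> carrier G" "x \<in> X" "y \<in> X" for h x y
      using iso that by (simp add: isometric_action_def)
  qed
  have "\<exists>R. \<forall>x\<in>X. \<forall>y\<in>X. R \<le> d x y \<longrightarrow>
      finite {k \<in> carrier G. d x (\<phi> k x) \<le> \<epsilon> \<and> d y (\<phi> k y) \<le> \<epsilon>}" for \<epsilon>
  proof -
    \<comment> \<open>Acylindricity speaks of positive \<open>\<epsilon>\<close> only,
      \<open>locally_acylindrical\<close> of all reals.\<close>
    have "0 < max \<epsilon> 1" by simp
    then obtain R where R: "\<And>x y. x \<in> X \<Longrightarrow> y \<in> X \<Longrightarrow> R \<le> d x y \<Longrightarrow>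
        finite {k \<in> carrier G. d x (\<phi> k x) \<le> max \<epsilon> 1 \<and> d y (\<phi> k y) \<le> max \<epsilon> 1}"
      using acyl unfolding acylindrical_action_def by meson
    have "{k \<in> carrier G. d x (\<phi> k x) \<le> \<epsilon> \<and> d y (\<phi> k y) \<le> \<epsilon>}
        \<subseteq> {k \<in> carrier G. d x (\<phi> k x) \<le> max \<epsilon> 1 \<and> d y (\<phi> k y) \<le> max \<epsilon> 1}" for x y by auto
    then show ?thesis using R by (meson finite_subset)
  qed
  then have locally_acylindrical by (simp add: locally_acylindrical_def)
  then show thesis using that isometric_four_point_action_axioms by blast
qed

section \<open>Word metrics and Cannon's cone types\<close>

context group
begin

text \<open>The value 0 off the carrier is the convention of \<open>cayley_dist\<close>: symmetry of
  \<open>word_dist\<close> is known on the carrier only, and \<open>Metric_space\<close> demands it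
  everywhere.\<close>

definition word_metric :: "'a set \<Rightarrow> 'a \<Rightarrow> 'a \<Rightarrow> real" where
  "word_metric S x y = (if x \<in> carrier G \<and> y \<in> carrier G then real (word_dist G S x y) else 0)"

lemma Metric_space_word_metric:
  assumes S: "finite_generating_set G S"
  shows "Metric_space (carrier G) (word_metric S)"
proof
  show "word_metric S x z \<le> word_metric S x y + word_metric S y z"
    if "x \<in> carrier G" "y \<in> carrier G" "z \<in> carrier G" for x y z
    using word_dist_triangle[OF S that] that by (simp add: word_metric_def)
qed (auto simp: word_metric_def word_dist_commute[OF S] word_dist_eq_0[OF S])

lemma cayley_dist_vertices:
  assumes S: "finite_generating_set G S" and u: "u \<in> carrier G" and v: "v \<in> carrier G"
  shows "(\<lambda>_. 0)(u := 1) \<in> cayley_graph G S"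
    "cayley_dist G S ((\<lambda>_. 0)(u := 1)) ((\<lambda>_. 0)(v := 1)) = word_metric S u v"
proof -
  have vertex: "(\<lambda>_. 0)(w := 1) \<in> cayley_graph G S" if "w \<in> carrier G" for w
    using that unfolding cayley_graph_def by blast
  have supp: "support ((\<lambda>_. 0)(w := 1)) = {w}" for w :: 'a by (auto simp: support_def)
  show "(\<lambda>_. 0)(u := 1) \<in> cayley_graph G S" by (rule vertex[OF u])
  show "cayley_dist G S ((\<lambda>_. 0)(u := 1)) ((\<lambda>_. 0)(v := 1)) = word_metric S u v"
  proof (cases "u = v")
    case True
    then show ?thesis
      using vertex[OF u] u by (simp add: cayley_dist_def supp word_metric_def word_dist_self[OF S])
  next
    case False
    then show ?thesis
      using vertex[OF u] vertex[OF v] u v by (simp add: cayley_dist_def supp word_metric_def)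
  qed
qed

text \<open>Unlike thinness of triangles, the four-point inequality passes to subsets, here to the
  vertices of the Cayley graph.\<close>

lemma four_point_word_metric:
  assumes S: "finite_generating_set G S" and hyp: "hyperbolic_space (cayley_graph G S) (cayley_dist G S)"
  obtains \<delta> where "four_point_space (carrier G) (word_metric S) \<delta>"
proof -
  obtain \<delta> where "delta_hyperbolic \<delta> (cayley_graph G S) (cayley_dist G S)"
    using hyp by (auto simp: hyperbolic_space_def)
  then interpret C: four_point_space "cayley_graph G S" "cayley_dist G S" "3 * \<delta> + 1"
    by (rule delta_hyperbolic_four_point)
  interpret Metric_space "carrier G" "word_metric S" by (rule Metric_space_word_metric[OF S])
  note vertex = cayley_dist_vertices[OF S]
  have "four_point_space (carrier G) (word_metric S) (3 * \<delta> + 1)"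
  proof
    fix x y z w assume X: "x \<in> carrier G" "y \<in> carrier G" "z \<in> carrier G" "w \<in> carrier G"
    show "word_metric S x z + word_metric S y w
      \<le> max (word_metric S x y + word_metric S z w) (word_metric S y z + word_metric S x w) + 2 * (3 * \<delta> + 1)"
      using C.four_point[OF vertex(1)[OF X(1,1)] vertex(1)[OF X(2,2)] vertex(1)[OF X(3,3)] vertex(1)[OF X(4,4)]]
      by (simp add: vertex(2) X)
  qed
  then show thesis by (rule that)
qed

lemma finite_word_ball:
  assumes S: "finite_generating_set G S"
  shows "finite {g \<in> carrier G. word_length G S g \<le> n}"
proof -
  have fin: "finite (S \<union> m_inv G ` S)" using S by (simp add: finite_generating_set_def)
  have "{g \<in> carrier G. word_length G S g \<le> n}
      \<subseteq> word_eval G ` {ws. set ws \<subseteq> S \<union> m_inv G ` S \<and> length ws \<le> n}"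
  proof
    fix g assume g: "g \<in> {g \<in> carrier G. word_length G S g \<le> n}"
    then obtain ws where "ws \<in> words G S" "length ws = word_length G S g" "word_eval G ws = g"
      using word_length_witness[OF S] by blast
    then show "g \<in> word_eval G ` {ws. set ws \<subseteq> S \<union> m_inv G ` S \<and> length ws \<le> n}"
      using g by (intro image_eqI[of _ _ ws]) (auto simp: words_def)
  qed
  then show ?thesis by (rule finite_subset) (intro finite_imageI finite_lists_length_le fin)
qed

text \<open>The lengths of the pieces of a word are bounded by their numbers of letters, and these
  add up to the length of the whole; hence every bound is attained.\<close>

lemma geodesic_subword:
  assumes S: "finite_generating_set G S" and ws: "ws \<in> words G S"
    and geo: "word_length G S (word_eval G ws) = length ws" and ij: "i \<le> j" "j \<le> length ws"
  defines "p \<equiv> \<lambda>i. word_eval G (take i ws)" and "v \<equiv> word_eval G (drop i (take j ws))"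
  shows "word_length G S (p j) = j" "p j = p i \<otimes> v" "word_length G S v = j - i"
    "p j \<in> carrier G" "v \<in> carrier G" "word_length G S (word_eval G (drop j ws)) = length ws - j"
proof -
  have SG: "S \<subseteq> carrier G" using S by (simp add: finite_generating_set_def)
  let ?u = "word_eval G (drop j ws)"
  have W: "take i ws \<in> words G S" "take j ws \<in> words G S" "drop i (take j ws) \<in> words G S"
    "drop j ws \<in> words G S"
    using ws by (auto simp: words_def dest: in_set_takeD in_set_dropD)
  note C = words_carrier[OF SG W(1)] words_carrier[OF SG W(2)] words_carrier[OF SG W(3)]
    words_carrier[OF SG W(4)]
  show pj: "p j \<in> carrier G" and v: "v \<in> carrier G"
    using C word_eval_closed by (auto simp: p_def v_def)
  have pi: "p i \<in> carrier G" and u: "?u \<in> carrier G" using C word_eval_closed by (auto simp: p_def)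
  have "take j ws = take i ws @ drop i (take j ws)"
    using ij by (metis append_take_drop_id min.absorb1 take_take)
  then show eq: "p j = p i \<otimes> v" unfolding p_def v_def using word_eval_append[OF C(1,3)] by metis
  have "word_eval G ws = p j \<otimes> ?u"
    unfolding p_def using word_eval_append[OF C(2,4)] by simp
  then have "length ws \<le> word_length G S (p j) + word_length G S ?u"
    using geo word_length_mult[OF S pj u] by simp
  moreover have "word_length G S (p j) \<le> word_length G S (p i) + word_length G S v"
    unfolding eq by (rule word_length_mult[OF S pi v])
  moreover have "word_length G S (p i) \<le> i" "word_length G S (p j) \<le> j" "word_length G S v \<le> j - i"
    "word_length G S ?u \<le> length ws - j"
    using word_length_le[OF W(1)] word_length_le[OF W(2)] word_length_le[OF W(3)] word_length_le[OF W(4)] ij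
    by (auto simp: p_def v_def)
  ultimately show "word_length G S (p j) = j" "word_length G S v = j - i"
    "word_length G S ?u = length ws - j"
    using ij by auto
qed

lemma word_length_split:
  assumes S: "finite_generating_set G S" and x: "x \<in> carrier G" and i: "i \<le> word_length G S x"
  obtains z u where "z \<in> carrier G" "u \<in> carrier G" "x = z \<otimes> u" "word_length G S z = i"
    "word_length G S u = word_length G S x - i"
proof -
  obtain ws where ws: "ws \<in> words G S" "length ws = word_length G S x" "word_eval G ws = x"
    using word_length_witness[OF S x] .
  have geo: "word_length G S (word_eval G ws) = length ws" using ws by simp
  have le: "i \<le> length ws" unfolding ws(2) by (rule i)
  note a = geodesic_subword[OF S ws(1) geo order_refl le]
  note b = geodesic_subword[OF S ws(1) geo le order_refl]
  show thesis
  proof (rule that)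
    show "word_eval G (take i ws) \<in> carrier G" by (rule a(4))
    show "word_eval G (drop i ws) \<in> carrier G" using b(5) by simp
    show "x = word_eval G (take i ws) \<otimes> word_eval G (drop i ws)" using b(2) ws(3) by simp
    show "word_length G S (word_eval G (take i ws)) = i" by (rule a(1))
    show "word_length G S (word_eval G (drop i ws)) = word_length G S x - i" using b(3) ws(2) by simp
  qed
qed

text \<open>Cannon's \<open>k\<close>-tail is the set where this function is negative; the function
  keeps the full change of length. The value 0 outside the ball leaves finitely many possible
  functions.\<close>

definition tail :: "'a set \<Rightarrow> nat \<Rightarrow> 'a \<Rightarrow> 'a \<Rightarrow> int" where
  "tail S k g = (\<lambda>h. if h \<in> carrier G \<and> word_length G S h \<le> k
     then int (word_length G S (g \<otimes> h)) - int (word_length G S g) else 0)"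

lemma finite_tails:
  assumes S: "finite_generating_set G S"
  shows "finite (tail S k ` carrier G)"
proof -
  let ?B = "{h \<in> carrier G. word_length G S h \<le> k}"
  have "tail S k g \<in> {f. (\<forall>h. (h \<in> ?B \<longrightarrow> f h \<in> {- int k..int k}) \<and> (h \<notin> ?B \<longrightarrow> f h = 0))}"
    if g: "g \<in> carrier G" for g
  proof -
    have "tail S k g h \<in> {- int k..int k}" if h: "h \<in> ?B" for h
    proof -
      have "word_length G S (g \<otimes> h) \<le> word_length G S g + word_length G S h"
        using word_length_mult[OF S g] h by simp
      moreover have "word_length G S g \<le> word_length G S (g \<otimes> h) + word_length G S h"
        using word_length_mult[OF S, of "g \<otimes> h" "inv h"] word_length_inv[OF S, of h] g h
        by (simp add: m_assoc)
      ultimately show ?thesis using h by (auto simp: tail_def)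
    qed
    then show ?thesis by (auto simp: tail_def)
  qed
  then have "tail S k ` carrier G \<subseteq> {f. (\<forall>h. (h \<in> ?B \<longrightarrow> f h \<in> {- int k..int k}) \<and> (h \<notin> ?B \<longrightarrow> f h = 0))}"
    by blast
  moreover have "finite {f. (\<forall>h. (h \<in> ?B \<longrightarrow> f h \<in> {- int k..int k}) \<and> (h \<notin> ?B \<longrightarrow> f h = (0::int)))}"
    by (rule finite_set_of_finite_funs[OF finite_word_ball[OF S] finite_atLeastAtMost_int])
  ultimately show ?thesis by (rule finite_subset)
qed

text \<open>Cannon: the \<open>k\<close>-tail of \<open>g\<close> determines its cone type. If \<open>w\<close> failed to extend \<open>g'\<close>
  geodesically, a point \<open>z\<close> on a geodesic to \<open>g' w\<close> would be close to \<open>g'\<close> but closer to the identity,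
  and the equality of tails would give a shortcut for \<open>g w\<close>.\<close>

lemma tail_determines_cone:
  assumes S: "finite_generating_set G S" and four: "four_point_space (carrier G) (word_metric S) \<delta>"
    and k: "1 + 4 * \<delta> \<le> real k" and g: "g \<in> carrier G" and g': "g' \<in> carrier G"
    and tails: "tail S k g = tail S k g'"
  shows "\<lbrakk>w \<in> carrier G; word_length G S w = n; word_length G S (g \<otimes> w) = word_length G S g + n\<rbrakk>
    \<Longrightarrow> word_length G S (g' \<otimes> w) = word_length G S g' + n"
proof (induction n arbitrary: w)
  case 0
  then have "w = \<one>" using word_length_eq_0[OF S] by blast
  then show ?case using g' by simp
next
  case (Suc n)
  interpret four_point_space "carrier G" "word_metric S" \<delta> by (rule four)
  let ?l = "word_length G S"
  have mult: "?l (x \<otimes> y) \<le> ?l x + ?l y" if "x \<in> carrier G" "y \<in> carrier G" for x y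
    by (rule word_length_mult[OF S that])
  have dist: "word_metric S x (x \<otimes> y) = real (?l y)" "word_metric S (x \<otimes> y) x = real (?l y)"
    if "x \<in> carrier G" "y \<in> carrier G" for x y
  proof -
    show "word_metric S x (x \<otimes> y) = real (?l y)"
      using that by (simp add: word_metric_def word_dist_def inv_mult_cancel)
    then show "word_metric S (x \<otimes> y) x = real (?l y)" by (simp only: commute)
  qed
  have dist1: "word_metric S x \<one> = real (?l x)" if "x \<in> carrier G" for x
    using dist(2)[of \<one> x] that by simp
  have w: "w \<in> carrier G" "?l w = Suc n" by (rule Suc.prems)+
  have "n \<le> ?l w" using w(2) by simp
  then obtain w' t where w't: "w' \<in> carrier G" "t \<in> carrier G" "w = w' \<otimes> t" "?l w' = n" "?l t = ?l w - n"
    using word_length_split[OF S w(1)] by metis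
  have "?l t = 1" using w't(5) w(2) by simp
  note w' = w't(1-4) this
  have "?l (g \<otimes> w) \<le> ?l (g \<otimes> w') + ?l t"
    using mult[of "g \<otimes> w'" t] g w' by (simp add: m_assoc)
  then have "?l (g \<otimes> w') = ?l g + n" using mult[OF g w'(1)] Suc.prems(3) w' by simp
  then have p: "?l (g' \<otimes> w') = ?l g' + n" by (rule Suc.IH[OF w'(1,4)])
  have q_eq: "g' \<otimes> w = g' \<otimes> w' \<otimes> t" using g' w' by (simp add: m_assoc)
  have pG: "g' \<otimes> w' \<in> carrier G" and qG: "g' \<otimes> w \<in> carrier G" using g' w w' by auto
  have q_ge: "?l (g' \<otimes> w') \<le> ?l (g' \<otimes> w) + 1"
  proof -
    have "real (?l (g' \<otimes> w')) \<le> real (?l (g' \<otimes> w)) + real (?l t)"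
      using triangle[OF pG qG one_closed] dist1[OF pG] dist1[OF qG] dist(1)[OF pG w'(2)]
      by (simp add: q_eq)
    then show ?thesis using w' by simp
  qed
  show ?case
  proof (rule ccontr)
    assume "?l (g' \<otimes> w) \<noteq> ?l g' + Suc n"
    then have small: "?l (g' \<otimes> w) \<le> ?l g' + n" using mult[OF g' w(1)] w(2) by simp
    have "?l g' \<noteq> 0"
    proof
      assume "?l g' = 0"
      then have "g' = \<one>" using word_length_eq_0[OF S g'] by simp
      then show False using small w word_length_eq_0[OF S one_closed] by simp
    qed
    then have pos: "1 \<le> ?l g'" by simp
    have z_le: "?l g' - 1 \<le> ?l (g' \<otimes> w)" using q_ge p by simp
    obtain z u where z: "z \<in> carrier G" "u \<in> carrier G" "g' \<otimes> w = z \<otimes> u"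
      "?l z = ?l g' - 1" "?l u = ?l (g' \<otimes> w) - (?l g' - 1)"
      using word_length_split[OF S qG z_le] .
    \<comment> \<open>The assumed failure enters here: \<open>z\<close> is shorter than
      \<open>g'\<close> by one, yet \<open>u\<close> is no longer than \<open>w\<close>.\<close>
    have u_le: "?l u \<le> Suc n" using z(5) small pos by simp
    let ?a = "real (?l g')"
    have lz: "real (?l z) = ?a - 1" using z(4) pos by simp
    have lu: "real (?l u) = real (?l (g' \<otimes> w)) - (?a - 1)"
      using z(5) z_le pos by (simp add: of_nat_diff)
    \<comment> \<open>In the chain \<open>g'\<close>, \<open>g' \<otimes> w'\<close>,
      \<open>g' \<otimes> w\<close>, \<open>z\<close>, the first lies on a geodesic from
      \<open>\<one>\<close> to the second, the second and third are at distance 1, and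
      \<open>z\<close> lies on a geodesic to the third; so consecutive products are at least
      \<open>?a - 1\<close>. Two uses of the four-point inequality lose \<open>2 * \<delta>\<close>,
      which yields the distance \<open>1 + 4 * \<delta>\<close> demanded of
      \<open>k\<close>.\<close>
    have "gp \<one> g' (g' \<otimes> w') = ?a"
      unfolding gromov_product_def dist1[OF g'] dist1[OF pG] dist(1)[OF g' w'(1)] using p w'(4) by simp
    moreover have "?a - 1 \<le> gp \<one> (g' \<otimes> w') (g' \<otimes> w)"
      unfolding gromov_product_def dist1[OF pG] dist1[OF qG] using dist(1)[OF pG w'(2)] q_ge p w'(5)
      by (simp add: q_eq)
    moreover have "gp \<one> (g' \<otimes> w) z = ?a - 1"
      unfolding gromov_product_def dist1[OF qG] dist1[OF z(1)] using dist(2)[OF z(1,2)] z(3) lz lu by simp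
    moreover have "min (gp \<one> g' (g' \<otimes> w')) (gp \<one> (g' \<otimes> w') (g' \<otimes> w)) - \<delta> \<le> gp \<one> g' (g' \<otimes> w)"
      "min (gp \<one> g' (g' \<otimes> w)) (gp \<one> (g' \<otimes> w) z) - \<delta> \<le> gp \<one> g' z"
      by (intro gp_four_point one_closed g' pG qG z)+
    ultimately have "?a - 1 - 2 * \<delta> \<le> gp \<one> g' z"
      using delta_nonneg[OF one_closed] unfolding min_def by argo
    then have close: "word_metric S g' z \<le> 1 + 4 * \<delta>"
      unfolding gromov_product_def dist1[OF g'] dist1[OF z(1)] lz by argo
    define h where "h = inv g' \<otimes> z"
    have hG: "h \<in> carrier G" using g' z by (simp add: h_def)
    have gh: "g' \<otimes> h = z" using g' z by (simp add: h_def mult_inv_cancel)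
    have "real (?l h) \<le> real k" using close k dist(1)[OF g' hG] gh by simp
    then have hk: "?l h \<le> k" by simp
    have "int (?l (g \<otimes> h)) - int (?l g) = int (?l (g' \<otimes> h)) - int (?l g')"
      using fun_cong[OF tails, of h] hG hk by (simp add: tail_def)
    then have "?l (g \<otimes> h) + 1 = ?l g" using gh z(4) pos by simp
    moreover have "g \<otimes> w = g \<otimes> h \<otimes> u"
    proof -
      have "h \<otimes> u = inv g' \<otimes> (g' \<otimes> w)" using g' z by (simp add: h_def m_assoc)
      then have "h \<otimes> u = w" using g' w by (simp add: inv_mult_cancel)
      then show ?thesis using g hG z by (simp add: m_assoc)
    qed
    moreover have "?l (g \<otimes> h \<otimes> u) \<le> ?l (g \<otimes> h) + ?l u" by (intro mult m_closed g hG z)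
    ultimately show False using Suc.prems(3) u_le by simp
  qed
qed

text \<open>Two prefixes of a long geodesic have the same cone type, so the subword between them can be
  repeated.\<close>

lemma exists_geodesic_powers:
  assumes S: "finite_generating_set G S" and four: "four_point_space (carrier G) (word_metric S) \<delta>"
    and inf: "infinite (carrier G)"
  obtains v where "v \<in> carrier G" "0 < word_length G S v"
    "\<And>n::nat. word_length G S (v [^] n) = n * word_length G S v"
proof -
  let ?l = "word_length G S"
  obtain k :: nat where k: "1 + 4 * \<delta> \<le> real k" using real_arch_simple by blast
  let ?T = "tail S k ` carrier G"
  \<comment> \<open>A geodesic word longer than the number of tails has more proper prefixes than
    there are tails.\<close>
  have "\<not> carrier G \<subseteq> {g \<in> carrier G. ?l g \<le> card ?T}"
    using finite_word_ball[OF S] inf finite_subset by blast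
  then obtain g where g: "g \<in> carrier G" "card ?T < ?l g"
    unfolding subset_iff mem_Collect_eq not_all not_imp by (metis not_le)
  obtain ws where ws: "ws \<in> words G S" "length ws = ?l g" "word_eval G ws = g"
    using word_length_witness[OF S g(1)] .
  have geo: "?l (word_eval G ws) = length ws" using ws by simp
  define p where "p i = word_eval G (take i ws)" for i
  note sub = geodesic_subword[OF S ws(1) geo, folded p_def]
  have "(\<lambda>i. tail S k (p i)) ` {..<length ws} \<subseteq> ?T" using sub(4)[OF order_refl] by auto
  then have "card ((\<lambda>i. tail S k (p i)) ` {..<length ws}) < card {..<length ws}"
    using card_mono[OF finite_tails[OF S]] g(2) ws(2) by (metis card_lessThan le_less_trans)
  then have "\<not> inj_on (\<lambda>i. tail S k (p i)) {..<length ws}" by (rule pigeonhole)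
  then obtain i j where "i < length ws" "j < length ws" "i \<noteq> j" "tail S k (p i) = tail S k (p j)"
    by (auto simp: inj_on_def)
  then obtain i j where ij: "i < j" "j < length ws" "tail S k (p i) = tail S k (p j)"
    by (metis linorder_neqE_nat)
  define v where "v = word_eval G (drop i (take j ws))"
  have ij': "i \<le> j" "j \<le> length ws" "i \<le> length ws" using ij by auto
  note subv = sub[OF ij'(1,2), folded v_def]
  have piG: "p i \<in> carrier G" and pil: "?l (p i) = i" using sub(4,1)[OF order_refl ij'(3)] by auto
  have v: "v \<in> carrier G" "?l v = j - i" by (rule subv)+
  \<comment> \<open>The second conjunct drives the induction: \<open>v [^] n\<close> extends
    \<open>p i\<close> geodesically, hence also \<open>p j\<close>, and
    \<open>p j = p i \<otimes> v\<close> absorbs one more factor. The first conjunct follows from it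
    by subadditivity.\<close>
  have "?l (v [^] n) = n * ?l v \<and> ?l (p i \<otimes> v [^] n) = i + n * ?l v" for n :: nat
  proof (induction n)
    case 0
    then show ?case using piG pil word_length_eq_0[OF S one_closed] by simp
  next
    case (Suc n)
    have vn: "v [^] n \<in> carrier G" using v by simp
    have "?l (p j \<otimes> v [^] n) = ?l (p j) + n * ?l v"
      by (rule tail_determines_cone[OF S four k piG subv(4) ij(3) vn]) (use Suc pil in auto)
    moreover have "p j \<otimes> v [^] n = p i \<otimes> v [^] Suc n"
      unfolding nat_pow_Suc2[OF v(1)] subv(2) by (rule m_assoc[OF piG v(1) vn])
    ultimately have 1: "?l (p i \<otimes> v [^] Suc n) = i + Suc n * ?l v"
      using subv(1) v(2) ij by simp
    moreover have "?l (p i \<otimes> v [^] Suc n) \<le> i + ?l (v [^] Suc n)"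
      using word_length_mult[OF S piG, of "v [^] Suc n"] v pil by simp
    moreover have "?l (v [^] Suc n) \<le> Suc n * ?l v"
      using word_length_mult[OF S vn v(1)] Suc by simp
    ultimately show ?case by auto
  qed
  then show thesis using that[of v] v ij by simp
qed

end

section \<open>Hyperbolic groups\<close>

context group
begin

lemma isometric_four_point_action_left_mult:
  assumes S: "finite_generating_set G S" and four: "four_point_space (carrier G) (word_metric S) \<delta>"
  shows "isometric_four_point_action (carrier G) (word_metric S) \<delta> G (\<otimes>)"
proof -
  interpret four_point_space "carrier G" "word_metric S" \<delta> by (rule four)
  show ?thesis
    by unfold_locales (simp_all add: m_assoc word_metric_def word_dist_left)
qed

text \<open>The action is free and balls are finite, so the displacement of the single point
  \<open>x\<close> leaves finitely many elements.\<close>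

lemma locally_acylindrical_left_mult:
  assumes S: "finite_generating_set G S" and four: "four_point_space (carrier G) (word_metric S) \<delta>"
  shows "isometric_four_point_action.locally_acylindrical (carrier G) (word_metric S) G (\<otimes>)"
proof -
  interpret isometric_four_point_action "carrier G" "word_metric S" \<delta> G "(\<otimes>)"
    by (rule isometric_four_point_action_left_mult[OF assms])
  have "finite {k \<in> carrier G. word_metric S x (k \<otimes> x) \<le> \<epsilon> \<and> word_metric S y (k \<otimes> y) \<le> \<epsilon>}"
    if x: "x \<in> carrier G" for x y \<epsilon>
  proof (rule finite_subset)
    show "{k \<in> carrier G. word_metric S x (k \<otimes> x) \<le> \<epsilon> \<and> word_metric S y (k \<otimes> y) \<le> \<epsilon>}
      \<subseteq> (\<lambda>b. x \<otimes> b \<otimes> inv x) ` {b \<in> carrier G. word_length G S b \<le> nat \<lfloor>\<epsilon>\<rfloor>}"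
    proof
      fix k assume "k \<in> {k \<in> carrier G. word_metric S x (k \<otimes> x) \<le> \<epsilon> \<and> word_metric S y (k \<otimes> y) \<le> \<epsilon>}"
      then have k: "k \<in> carrier G" "word_metric S x (k \<otimes> x) \<le> \<epsilon>" by auto
      let ?b = "inv x \<otimes> (k \<otimes> x)"
      have "real (word_length G S ?b) \<le> \<epsilon>" using k x by (simp add: word_metric_def word_dist_def)
      then have "word_length G S ?b \<le> nat \<lfloor>\<epsilon>\<rfloor>" by (simp add: le_nat_floor)
      moreover have "k = x \<otimes> ?b \<otimes> inv x" using k x by (simp add: mult_inv_cancel m_assoc)
      ultimately show "k \<in> (\<lambda>b. x \<otimes> b \<otimes> inv x) ` {b \<in> carrier G. word_length G S b \<le> nat \<lfloor>\<epsilon>\<rfloor>}"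
        using k x by (intro image_eqI[of _ _ ?b]) auto
    qed
    show "finite ((\<lambda>b. x \<otimes> b \<otimes> inv x) ` {b \<in> carrier G. word_length G S b \<le> nat \<lfloor>\<epsilon>\<rfloor>})"
      by (intro finite_imageI finite_word_ball[OF S])
  qed
  then show ?thesis by (simp add: locally_acylindrical_def)
qed

lemma rough_axis_geodesic_powers:
  assumes S: "finite_generating_set G S" and four: "four_point_space (carrier G) (word_metric S) \<delta>"
    and v: "v \<in> carrier G" "0 < word_length G S v"
    and pow: "\<And>n::nat. word_length G S (v [^] n) = n * word_length G S v"
  shows "rough_axis (carrier G) (word_metric S) \<delta> G (\<otimes>) v \<one> (real (word_length G S v)) 0"
proof -
  interpret isometric_four_point_action "carrier G" "word_metric S" \<delta> G "(\<otimes>)"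
    by (rule isometric_four_point_action_left_mult[OF S four])
  have "word_metric S (v [^] (m::int) \<otimes> \<one>) (v [^] (n::int) \<otimes> \<one>)
      = real (word_length G S v) * \<bar>real_of_int (m - n)\<bar>" for m n
  proof -
    have "word_metric S (v [^] m \<otimes> \<one>) (v [^] n \<otimes> \<one>) = real (word_length G S (v [^] nat \<bar>m - n\<bar>))"
      unfolding dist_int_pow[OF v(1) one_closed] using v(1) by (simp add: word_metric_def word_dist_def)
    also have "\<dots> = real (word_length G S v) * real (nat \<bar>m - n\<bar>)" by (simp only: pow of_nat_mult mult.commute)
    also have "real (nat \<bar>m - n\<bar>) = \<bar>real_of_int (m - n)\<bar>" by simp
    finally show ?thesis .
  qed
  then show ?thesis using v by unfold_locales auto
qed

text \<open>By left invariance, closeness of \<open>h\<close> to a power means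
  \<open>h = v [^] j \<otimes> inv b\<close> with \<open>b\<close> in a finite ball. The right
  cosets of the powers are thus represented by inverses of ball elements.\<close>

lemma elementary_if_near_cyclic:
  assumes S: "finite_generating_set G S" and v: "v \<in> carrier G"
    and inj: "inj (\<lambda>j::int. v [^] j)"
    and D: "\<And>h. h \<in> carrier G \<Longrightarrow> \<exists>j::int. word_metric S h (v [^] j) \<le> D"
  shows "elementary_group G"
proof -
  let ?H = "range (\<lambda>j::int. v [^] j)"
  have H: "subgroup ?H G"
  proof (rule subgroupI)
    show "?H \<subseteq> carrier G" using v by auto
    show "inv a \<in> ?H" if a: "a \<in> ?H" for a
    proof -
      obtain j :: int where "a = v [^] j" using a by blast
      then have "inv a = v [^] (- j)" by (simp add: int_pow_neg[OF v])
      then show ?thesis by blast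
    qed
    show "a \<otimes> b \<in> ?H" if ab: "a \<in> ?H" "b \<in> ?H" for a b
    proof -
      obtain i j :: int where "a = v [^] i" "b = v [^] j" using ab by blast
      then have "a \<otimes> b = v [^] (i + j)" by (simp add: int_pow_mult[OF v])
      then show ?thesis by blast
    qed
  qed auto
  have "finite (rcosets ?H)"
  proof (rule finite_subset)
    let ?B = "{b \<in> carrier G. word_length G S b \<le> nat \<lfloor>D\<rfloor>}"
    show "rcosets ?H \<subseteq> (\<lambda>b. ?H #> inv b) ` ?B"
    proof
      fix C assume "C \<in> rcosets ?H"
      then obtain h where h: "h \<in> carrier G" "C = ?H #> h" by (auto simp: RCOSETS_def)
      obtain j :: int where j: "word_metric S h (v [^] j) \<le> D" using D[OF h(1)] by blast
      let ?b = "inv h \<otimes> v [^] j"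
      have b: "?b \<in> carrier G" using h v by simp
      have "real (word_length G S ?b) \<le> D" using j h v by (simp add: word_metric_def word_dist_def)
      then have "word_length G S ?b \<le> nat \<lfloor>D\<rfloor>" by (simp add: le_nat_floor)
      moreover have "inv ?b = inv (v [^] j) \<otimes> h" using h v by (simp add: inv_mult_group)
      moreover have "?H #> (inv (v [^] j) \<otimes> h) = ?H #> h"
      proof -
        have "inv (v [^] j) \<in> ?H" using subgroup.m_inv_closed[OF H] by blast
        then have "?H #> inv (v [^] j) = ?H" by (simp add: coset_join2 H v)
        then show ?thesis using coset_mult_assoc[of ?H "inv (v [^] j)" h] H h v
          by (simp add: subgroup.subset)
      qed
      ultimately show "C \<in> (\<lambda>b. ?H #> inv b) ` ?B"
        using b h(2) by (intro image_eqI[of _ _ ?b]) auto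
    qed
    show "finite ((\<lambda>b. ?H #> inv b) ` ?B)" by (intro finite_imageI finite_word_ball[OF S])
  qed
  moreover have "G\<lparr>carrier := ?H\<rparr> \<cong> integer_group"
  proof -
    have "(\<lambda>j::int. v [^] j) \<in> iso integer_group (G\<lparr>carrier := ?H\<rparr>)"
      using inj by (auto simp: iso_def hom_def bij_betw_def int_pow_mult[OF v])
    then have "integer_group \<cong> G\<lparr>carrier := ?H\<rparr>" by (auto simp: is_iso_def)
    then show ?thesis by (rule group.iso_sym[OF group_integer_group])
  qed
  ultimately show ?thesis using H unfolding elementary_group_def by blast
qed

text \<open>Since \<open>k\<close> commutes with \<open>H\<close>, its conjugate by \<open>h\<close>
  depends only on the right coset of \<open>h\<close>.\<close>

lemma finite_conjugates_finite_index:
  assumes H: "subgroup H G" and fin: "finite (rcosets H)"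
    and comm: "\<And>x y. x \<in> H \<Longrightarrow> y \<in> H \<Longrightarrow> x \<otimes> y = y \<otimes> x" and k: "k \<in> H"
  shows "finite ((\<lambda>h. inv h \<otimes> (k \<otimes> h)) ` carrier G)"
proof -
  let ?f = "\<lambda>h. inv h \<otimes> (k \<otimes> h)"
  have kG: "k \<in> carrier G" by (rule subgroup.mem_carrier[OF H k])
  have const: "?f (x \<otimes> a) = ?f a" if x: "x \<in> H" and a: "a \<in> carrier G" for x a
  proof -
    have xG: "x \<in> carrier G" by (rule subgroup.mem_carrier[OF H x])
    have "k \<otimes> (x \<otimes> a) = x \<otimes> (k \<otimes> a)"
      using comm[OF k x] xG kG a by (simp flip: m_assoc)
    then show ?thesis using xG kG a by (simp add: inv_mult_group m_assoc inv_mult_cancel)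
  qed
  have "?f ` carrier G \<subseteq> (\<lambda>C. ?f (SOME a. a \<in> C)) ` (rcosets H)"
  proof
    fix y assume "y \<in> ?f ` carrier G"
    then obtain h where h: "h \<in> carrier G" "y = ?f h" by blast
    let ?C = "H #> h"
    have "h \<in> ?C" by (rule rcos_self[OF h(1) H])
    then have "(SOME a. a \<in> ?C) \<in> ?C" by (rule someI)
    then obtain x where x: "x \<in> H" "(SOME a. a \<in> ?C) = x \<otimes> h" by (auto simp: r_coset_def)
    have "?f (SOME a. a \<in> ?C) = y" unfolding x(2) using const[OF x(1) h(1)] h(2) by simp
    moreover have "?C \<in> rcosets H" using h by (auto simp: RCOSETS_def)
    ultimately show "y \<in> (\<lambda>C. ?f (SOME a. a \<in> C)) ` (rcosets H)" by blast
  qed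
  then show ?thesis using fin finite_subset by blast
qed

end

section \<open>The cone kernel of virtually cyclic and of hyperbolic groups\<close>

context cone_scaling
begin

lemma elementary_infinite_cone_kernel:
  assumes "elementary_group G" and "infinite (carrier G)"
  shows "infinite (cone_kernel \<omega> G S s)"
proof -
  obtain H where H: "subgroup H G" "finite (rcosets H)" "G\<lparr>carrier := H\<rparr> \<cong> integer_group"
    using assms unfolding elementary_group_def by blast
  then obtain f where f: "f \<in> iso (G\<lparr>carrier := H\<rparr>) integer_group" by (auto simp: is_iso_def)
  then have bij: "bij_betw f H UNIV" and hom: "\<And>x y. x \<in> H \<Longrightarrow> y \<in> H \<Longrightarrow> f (x \<otimes> y) = f x + f y"
    by (auto simp: iso_def hom_def)
  have inj: "inj_on f H" using bij by (rule bij_betw_imp_inj_on)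
  have comm: "x \<otimes> y = y \<otimes> x" if "x \<in> H" "y \<in> H" for x y
    using inj_onD[OF inj, of "x \<otimes> y" "y \<otimes> x"] hom that subgroup.m_closed[OF H(1)] by simp
  have "H \<subseteq> cone_kernel \<omega> G S s"
    using kernelI_finite_conjugates finite_conjugates_finite_index[OF H(1,2) comm]
      subgroup.mem_carrier[OF H(1)] by blast
  moreover have "infinite H" using bij_betw_finite[OF bij] by simp
  ultimately show ?thesis using finite_subset by blast
qed

lemma hyperbolic_group_cone_kernel:
  assumes hyp: "hyperbolic_group G" and inf: "infinite (carrier G)"
  shows "\<not> elementary_group G \<longleftrightarrow> finite (cone_kernel \<omega> G S s)"
proof
  assume ne: "\<not> elementary_group G"
  \<comment> \<open>\<open>T\<close> may differ from the set \<open>S\<close> that defines the cone.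
    The action is studied in the metric of \<open>T\<close>, and \<open>S\<close> enters only
    through the Lipschitz bound on displacements, so hyperbolicity need not be transferred between
    generating sets.\<close>
  obtain T where T: "finite_generating_set G T" "hyperbolic_space (cayley_graph G T) (cayley_dist G T)"
    using hyp by (auto simp: hyperbolic_group_def)
  obtain \<delta> where four: "four_point_space (carrier G) (word_metric T) \<delta>"
    using four_point_word_metric[OF T] .
  obtain v where v: "v \<in> carrier G" "0 < word_length G T v"
    and pow: "\<And>n::nat. word_length G T (v [^] n) = n * word_length G T v"
    using exists_geodesic_powers[OF T(1) four inf] by blast
  interpret A: rough_axis "carrier G" "word_metric T" \<delta> G "(\<otimes>)" v \<one> "real (word_length G T v)" 0
    by (rule rough_axis_geodesic_powers[OF T(1) four v pow])
  have orb: "A.orb j = v [^] j" for j using v by (simp add: A.orb_def)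
  have "\<not> A.ends_preserved"
  proof
    assume A.ends_preserved
    then obtain D where D: "\<And>h. h \<in> carrier G \<Longrightarrow> \<exists>j. word_metric T (h \<otimes> \<one>) (A.orb j) \<le> D"
      using A.orbit_near_axis by blast
    have "inj (\<lambda>j::int. v [^] j)"
    proof (rule injI)
      fix i j :: int assume eq: "v [^] i = v [^] j"
      have "real (word_length G T v) * \<bar>real_of_int (i - j)\<bar> \<le> 0"
        using A.orb_dist_bounds(1)[of i j] v by (simp add: orb eq)
      then show "i = j" using v(2) by (simp add: mult_le_0_iff)
    qed
    then have "elementary_group G"
      by (rule elementary_if_near_cyclic[OF T(1) v(1)]) (use D in \<open>simp add: orb\<close>)
    with ne show False ..
  qed
  then show "finite (cone_kernel \<omega> G S s)"
    using A.finite_cone_kernel[OF cone_scaling_axioms locally_acylindrical_left_mult[OF T(1) four]]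
    by blast
next
  assume "finite (cone_kernel \<omega> G S s)"
  then show "\<not> elementary_group G" using elementary_infinite_cone_kernel inf by blast
qed

end

theorem corollary1p8:
  fixes \<omega> :: "nat filter" and s :: "nat \<Rightarrow> real"
    and G :: "('a, 'm) monoid_scheme" and S :: "'a set"
  assumes "nonprincipal_ultrafilter \<omega>"
    and "\<forall>n. 0 < s n" and "mono s" and "\<not> bdd_above (range s)"
    and "group G" and "finite_generating_set G S"
  shows "(hyperbolic_group G \<and> infinite (carrier G) \<longrightarrow>
            (\<not> elementary_group G \<longleftrightarrow> finite (cone_kernel \<omega> G S s)))
       \<and> (\<forall>(X :: 'x set) d \<phi>.
            hyperbolic_space X d \<and> acylindrical_action G X d \<phi> \<and> (\<exists>g. loxodromic G X d \<phi> g) \<longrightarrow>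
            (nonelementary_action G X d \<phi> \<longleftrightarrow> finite (cone_kernel \<omega> G S s)) \<and>
            (nonelementary_action G X d \<phi> \<longrightarrow> acylindrically_hyperbolic TYPE('x) G))"
proof -
  interpret group G by fact
  interpret cone_scaling G \<omega> S s
  proof
    show "filterlim s at_top \<omega>" by (rule filterlim_unbounded_mono[OF assms(1,3,4)])
    show "\<omega> \<noteq> bot" using assms(1) by (simp add: nonprincipal_ultrafilter_def)
  qed (use assms in auto)
  have "nonelementary_action G X d \<phi> \<longleftrightarrow> finite (cone_kernel \<omega> G S s)"
    if hyp: "hyperbolic_space X d" and acyl: "acylindrical_action G X d \<phi>"
      and lox: "loxodromic G X d \<phi> g" for X :: "'x set" and d \<phi> g
  proof -
    obtain \<delta> where "isometric_four_point_action X d \<delta> G \<phi>"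
      and local: "isometric_four_point_action.locally_acylindrical X d G \<phi>"
      using acylindrical_action_isometric_four_point[OF hyp acyl] .
    then interpret isometric_four_point_action X d \<delta> G \<phi> by simp
    obtain x where x: "g \<in> carrier G" "x \<in> X"
      "quasi_isometric_embedding (UNIV :: int set) dist X d (\<lambda>n. \<phi> (g [^]\<^bsub>G\<^esub> n) x)"
      using lox by (auto simp: loxodromic_def)
    obtain \<tau> B where "rough_axis X d \<delta> G \<phi> g x \<tau> B"
      using rough_axis_if_quasi_isometric[OF x] .
    then show ?thesis
      by (rule rough_axis.nonelementary_iff_finite_cone_kernel[OF _ cone_scaling_axioms local])
  qed
  then show ?thesis
    using hyperbolic_group_cone_kernel unfolding acylindrically_hyperbolic_def by blast
qed

end
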